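(* There do not exist real hypersurfaces $M$ in $\mathbb{C}P^{2}$ or $\mathbb{C}H^{2}$ whose shape operator $A$ satisfies $$\mathcal{L}_{X}A=\nabla_{X}A\qquad\text{for every vector field } X \text{ on } M \text{ with values in } \mathbb{D}=\ker\eta \ (\text{i.e. } X \text{ orthogonal to } \xi).$$
   Context: All manifolds, vector fields, etc. are of class $C^\infty$, and all manifolds are connected (and nonempty). For $c\neq 0$, $M_2(c)$ denotes the complex projective plane $\mathbb{C}P^2$ (if $c>0$) or the complex hyperbolic plane $\mathbb{C}H^2$ (if $c<0$), i.e. the complete simply connected Kaehler manifold of complex dimension 2 and constant holomorphic sectional curvature $c$, with Kaehler metric $G$, complex structure $J$ and Levi-Civita connection $\overline\nabla$. A real hypersurface $M$ of $M_2(c)$ is a connected immersed submanifold of real codimension one; $g$ is the induced metric and $\nabla$ its Levi-Civita connection. Let $N$ be a locally defined unit normal field of $M$. The shape operator $A$ is defined by $\overline\nabla_XN=-AX$ (locally defined, up to sign; the condition considered does not depend on the sign). The structure vector field is $\xi=-JN$; for $X$ tangent to $M$ write $JX=\varphi X+\eta(X)N$ with $\varphi X$ tangent, so that $\eta(X)=g(X,\xi)$; $\mathbb{D}=\ker\eta$ is the distribution orthogonal to $\xi$. $\mathcal{L}_X$ is the Lie derivative: $(\mathcal{L}_XA)Y=[X,AY]-A[X,Y]$, while $(\nabla_XA)Y=\nabla_X(AY)-A\nabla_XY$, for all vector fields $Y$ on $M$. *)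

theory Defs
  imports "HOL-Analysis.Analysis"
begin

section \<open>Smooth manifolds\<close>

text \<open>
  \<open>Ck_on k S f\<close> is used for open \<open>S\<close> only: \<open>f\<close> has continuous partial derivatives on \<open>S\<close> up to
  order \<open>k\<close>.
\<close>

primrec Ck_on :: "nat \<Rightarrow> 'a::real_normed_vector set \<Rightarrow> ('a \<Rightarrow> 'b::real_normed_vector) \<Rightarrow> bool" where
  "Ck_on 0 S f \<longleftrightarrow> continuous_on S f"
| "Ck_on (Suc k) S f \<longleftrightarrow>
     (\<forall>x\<in>S. f differentiable (at x)) \<and> (\<forall>v. Ck_on k S (\<lambda>x. frechet_derivative f (at x) v))"

definition smooth_on :: "'a::real_normed_vector set \<Rightarrow> ('a \<Rightarrow> 'b::real_normed_vector) \<Rightarrow> bool" where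
  "smooth_on S f \<longleftrightarrow> (\<forall>k. Ck_on k S f)"

text \<open>
  The underlying set of a manifold is a whole type; Hausdorff and second countable are imposed by
  type classes. A chart is a domain together with its coordinate map, whose values outside of the
  domain are irrelevant.
\<close>

type_synonym ('m, 'e) chart = "'m set \<times> ('m \<Rightarrow> 'e)"

definition chart_inv :: "('m, 'e) chart \<Rightarrow> 'e \<Rightarrow> 'm" where
  "chart_inv \<alpha> = inv_into (fst \<alpha>) (snd \<alpha>)"

definition is_chart :: "('m::topological_space, 'e::euclidean_space) chart \<Rightarrow> bool" where
  "is_chart \<alpha> \<longleftrightarrow> open (fst \<alpha>) \<and> open (snd \<alpha> ` fst \<alpha>) \<and>
     homeomorphism (fst \<alpha>) (snd \<alpha> ` fst \<alpha>) (snd \<alpha>) (chart_inv \<alpha>)"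

definition smooth_fun ::
  "('m, 'e::euclidean_space) chart set \<Rightarrow> 'm set \<Rightarrow> ('m \<Rightarrow> 'b::real_normed_vector) \<Rightarrow> bool" where
  "smooth_fun \<A> S F \<longleftrightarrow> (\<forall>\<alpha>\<in>\<A>. smooth_on (snd \<alpha> ` (S \<inter> fst \<alpha>)) (F \<circ> chart_inv \<alpha>))"

definition smooth_atlas ::
  "('m::{t2_space,second_countable_topology}, 'e::euclidean_space) chart set \<Rightarrow> bool" where
  "smooth_atlas \<A> \<longleftrightarrow> (\<forall>\<alpha>\<in>\<A>. is_chart \<alpha>) \<and> (\<Union>\<alpha>\<in>\<A>. fst \<alpha>) = UNIV \<and>
     (\<forall>\<beta>\<in>\<A>. smooth_fun \<A> (fst \<beta>) (snd \<beta>))"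

definition chart_at :: "('m, 'e) chart set \<Rightarrow> 'm \<Rightarrow> ('m, 'e) chart" where
  "chart_at \<A> p = (SOME \<alpha>. \<alpha> \<in> \<A> \<and> p \<in> fst \<alpha>)"

text \<open>
  A tangent vector at \<open>p\<close> is given by its components in all the charts around \<open>p\<close>; these are related
  by the derivatives of the coordinate changes. \<open>dd \<alpha> F p v\<close> is the derivative at \<open>p\<close> of the
  vector-valued function \<open>F\<close> along the tangent vector with \<open>\<alpha>\<close>-components \<open>v\<close>. Hence
  \<open>dd \<alpha> (snd \<beta>) p v\<close> are the \<open>\<beta>\<close>-components of that vector, and \<open>dd \<alpha> (snd \<beta> \<circ> f) p v\<close> are the
  \<open>\<beta>\<close>-components of its image under the differential of a map \<open>f\<close>.
\<close>

definition dd ::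
  "('m, 'e::euclidean_space) chart \<Rightarrow> ('m \<Rightarrow> 'b::real_normed_vector) \<Rightarrow> 'm \<Rightarrow> 'e \<Rightarrow> 'b" where
  "dd \<alpha> F p v = frechet_derivative (F \<circ> chart_inv \<alpha>) (at (snd \<alpha> p)) v"

definition smooth_map ::
  "('m::topological_space, 'e::euclidean_space) chart set \<Rightarrow>
   ('n::topological_space, 'f::euclidean_space) chart set \<Rightarrow> ('m \<Rightarrow> 'n) \<Rightarrow> bool" where
  "smooth_map \<A> \<B> f \<longleftrightarrow> continuous_on UNIV f \<and>
     (\<forall>\<beta>\<in>\<B>. smooth_fun \<A> (f -` fst \<beta>) (snd \<beta> \<circ> f))"

definition immersion ::
  "('m::topological_space, 'e::euclidean_space) chart set \<Rightarrow>
   ('n::topological_space, 'f::euclidean_space) chart set \<Rightarrow> ('m \<Rightarrow> 'n) \<Rightarrow> bool" where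
  "immersion \<A> \<B> f \<longleftrightarrow> smooth_map \<A> \<B> f \<and>
     (\<forall>\<alpha>\<in>\<A>. \<forall>\<beta>\<in>\<B>. \<forall>p\<in>fst \<alpha> \<inter> f -` fst \<beta>. inj (dd \<alpha> (snd \<beta> \<circ> f) p))"

text \<open>
  The next three types collect components with respect to the charts. The values of the components
  with respect to \<open>\<alpha>\<close> matter only at the points of \<open>fst \<alpha>\<close> at which the object is defined.
\<close>

type_synonym ('m, 'e) vfield = "('m, 'e) chart \<Rightarrow> 'm \<Rightarrow> 'e"
type_synonym ('m, 'e) endofield = "('m, 'e) chart \<Rightarrow> 'm \<Rightarrow> 'e \<Rightarrow> 'e"
type_synonym ('m, 'e) metric = "('m, 'e) chart \<Rightarrow> 'm \<Rightarrow> 'e \<Rightarrow> 'e \<Rightarrow> real"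

text \<open>
  Smooth vector fields along a map \<open>f\<close>, defined on an open set \<open>S\<close>: the value at \<open>p\<close> is tangent to the
  target manifold at \<open>f p\<close>. Here \<open>V \<beta> p\<close> are the components with respect to a chart \<open>\<beta>\<close> around \<open>f p\<close>.
\<close>

definition vector_field_along ::
  "('m, 'e::euclidean_space) chart set \<Rightarrow> ('n, 'f::euclidean_space) chart set \<Rightarrow> ('m \<Rightarrow> 'n) \<Rightarrow> 'm set \<Rightarrow>
   (('n, 'f) chart \<Rightarrow> 'm \<Rightarrow> 'f) \<Rightarrow> bool" where
  "vector_field_along \<A> \<B> f S V \<longleftrightarrow>
     (\<forall>\<beta>\<in>\<B>. smooth_fun \<A> (S \<inter> f -` fst \<beta>) (V \<beta>)) \<and>
     (\<forall>\<beta>\<in>\<B>. \<forall>\<beta>'\<in>\<B>. \<forall>p\<in>S. f p \<in> fst \<beta> \<inter> fst \<beta>' \<longrightarrow> V \<beta>' p = dd \<beta> (snd \<beta>') (f p) (V \<beta> p))"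

definition vector_field ::
  "('m, 'e::euclidean_space) chart set \<Rightarrow> 'm set \<Rightarrow> ('m, 'e) vfield \<Rightarrow> bool" where
  "vector_field \<A> S X \<longleftrightarrow> vector_field_along \<A> \<A> (\<lambda>p. p) S X"

definition lie_bracket ::
  "('m, 'e::euclidean_space) vfield \<Rightarrow> ('m, 'e) vfield \<Rightarrow> ('m, 'e) vfield" where
  "lie_bracket X Y \<alpha> p = dd \<alpha> (Y \<alpha>) p (X \<alpha> p) - dd \<alpha> (X \<alpha>) p (Y \<alpha> p)"


section \<open>Riemannian metrics\<close>

definition riemannian_metric ::
  "('m, 'e::euclidean_space) chart set \<Rightarrow> ('m, 'e) metric \<Rightarrow> bool" where
  "riemannian_metric \<A> g \<longleftrightarrow>
     (\<forall>\<alpha>\<in>\<A>. \<forall>p\<in>fst \<alpha>. bilinear (g \<alpha> p) \<and> (\<forall>u v. g \<alpha> p u v = g \<alpha> p v u) \<and>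
        (\<forall>u. u \<noteq> 0 \<longrightarrow> g \<alpha> p u u > 0)) \<and>
     (\<forall>\<alpha>\<in>\<A>. \<forall>u v. smooth_on (snd \<alpha> ` fst \<alpha>) (\<lambda>x. g \<alpha> (chart_inv \<alpha> x) u v)) \<and>
     (\<forall>\<alpha>\<in>\<A>. \<forall>\<beta>\<in>\<A>. \<forall>p\<in>fst \<alpha> \<inter> fst \<beta>. \<forall>u v.
        g \<beta> p (dd \<alpha> (snd \<beta>) p u) (dd \<alpha> (snd \<beta>) p v) = g \<alpha> p u v)"

text \<open>
  A connection is given by its Christoffel symbols: \<open>\<Gamma> \<alpha> p u v\<close> are the \<open>\<alpha>\<close>-components at \<open>p\<close> of the
  derivative along \<open>u\<close> of the field with constant \<open>\<alpha>\<close>-components \<open>v\<close>. The Levi-Civita connection is the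
  unique one that is torsion-free and compatible with the metric.
\<close>

type_synonym ('m, 'e) connection = "('m, 'e) chart \<Rightarrow> 'm \<Rightarrow> 'e \<Rightarrow> 'e \<Rightarrow> 'e"

definition levi_civita :: "('m, 'e::euclidean_space) metric \<Rightarrow> ('m, 'e) connection" where
  "levi_civita g \<alpha> p = (THE \<Gamma>. bilinear \<Gamma> \<and> (\<forall>u v. \<Gamma> u v = \<Gamma> v u) \<and>
     (\<forall>u v w. dd \<alpha> (\<lambda>q. g \<alpha> q u v) p w = g \<alpha> p (\<Gamma> w u) v + g \<alpha> p u (\<Gamma> w v)))"

definition nabla ::
  "('m, 'e::euclidean_space) connection \<Rightarrow> ('m, 'e) vfield \<Rightarrow> ('m, 'e) vfield \<Rightarrow> ('m, 'e) vfield" where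
  "nabla \<Gamma> X Y \<alpha> p = dd \<alpha> (Y \<alpha>) p (X \<alpha> p) + \<Gamma> \<alpha> p (X \<alpha> p) (Y \<alpha> p)"

text \<open>
  The covariant derivative of a vector field \<open>V\<close> along \<open>f\<close>, in the direction with \<open>\<alpha>\<close>-components \<open>v\<close> at \<open>p\<close>.
  The result is expressed in the chart \<open>\<beta>\<close> around \<open>f p\<close>.
\<close>

definition nabla_along ::
  "('n, 'f::euclidean_space) connection \<Rightarrow> ('m \<Rightarrow> 'n) \<Rightarrow> ('m, 'e::euclidean_space) chart \<Rightarrow>
   (('n, 'f) chart \<Rightarrow> 'm \<Rightarrow> 'f) \<Rightarrow> 'm \<Rightarrow> 'e \<Rightarrow> ('n, 'f) chart \<Rightarrow> 'f" where
  "nabla_along \<Gamma> f \<alpha> V p v \<beta> =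
     dd \<alpha> (V \<beta>) p v + \<Gamma> \<beta> (f p) (dd \<alpha> (snd \<beta> \<circ> f) p v) (V \<beta> p)"

text \<open>
  \<open>R(u,v)w = \<nabla>\<^sub>u\<nabla>\<^sub>vw - \<nabla>\<^sub>v\<nabla>\<^sub>uw\<close>, where \<open>u\<close>, \<open>v\<close>, \<open>w\<close> are extended to fields with constant components
  in the chart \<open>\<alpha>\<close>. As these commute, there is no bracket term.
\<close>

definition curvature ::
  "('m, 'e::euclidean_space) connection \<Rightarrow> ('m, 'e) chart \<Rightarrow> 'm \<Rightarrow> 'e \<Rightarrow> 'e \<Rightarrow> 'e \<Rightarrow> 'e" where
  "curvature \<Gamma> \<alpha> p u v w =
     nabla \<Gamma> (\<lambda>_ _. u) (nabla \<Gamma> (\<lambda>_ _. v) (\<lambda>_ _. w)) \<alpha> p -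
     nabla \<Gamma> (\<lambda>_ _. v) (nabla \<Gamma> (\<lambda>_ _. u) (\<lambda>_ _. w)) \<alpha> p"

definition sectional_curvature ::
  "('m, 'e::euclidean_space) metric \<Rightarrow> ('m, 'e) chart \<Rightarrow> 'm \<Rightarrow> 'e \<Rightarrow> 'e \<Rightarrow> real" where
  "sectional_curvature g \<alpha> p u v =
     g \<alpha> p (curvature (levi_civita g) \<alpha> p u v v) u /
     (g \<alpha> p u u * g \<alpha> p v v - (g \<alpha> p u v)\<^sup>2)"

abbreviation real_line :: "(real, real) chart" where
  "real_line \<equiv> (UNIV, \<lambda>t. t)"

definition velocity ::
  "(real \<Rightarrow> 'm) \<Rightarrow> ('m, 'e::euclidean_space) chart \<Rightarrow> real \<Rightarrow> 'e" where
  "velocity \<gamma> \<beta> t = dd real_line (snd \<beta> \<circ> \<gamma>) t 1"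

definition geodesic ::
  "('m::topological_space, 'e::euclidean_space) chart set \<Rightarrow> ('m, 'e) metric \<Rightarrow> (real \<Rightarrow> 'm) \<Rightarrow> bool" where
  "geodesic \<A> g \<gamma> \<longleftrightarrow> smooth_map {real_line} \<A> \<gamma> \<and>
     (\<forall>\<beta>\<in>\<A>. \<forall>t. \<gamma> t \<in> fst \<beta> \<longrightarrow> nabla_along (levi_civita g) \<gamma> real_line (velocity \<gamma>) t 1 \<beta> = 0)"

definition geodesically_complete ::
  "('m::topological_space, 'e::euclidean_space) chart set \<Rightarrow> ('m, 'e) metric \<Rightarrow> bool" where
  "geodesically_complete \<A> g \<longleftrightarrow> (\<forall>\<alpha>\<in>\<A>. \<forall>p\<in>fst \<alpha>. \<forall>v.
     \<exists>\<gamma>. geodesic \<A> g \<gamma> \<and> \<gamma> 0 = p \<and> velocity \<gamma> \<alpha> 0 = v)"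


section \<open>The spaces \<open>M\<^sub>2(c)\<close>\<close>

text \<open>
  Complex surfaces are modelled on \<open>complex ^ 2\<close>, with holomorphic coordinate changes. In every such
  chart the complex structure \<open>J\<close> is the multiplication by the imaginary unit.
\<close>

abbreviation J :: "complex ^ 2 \<Rightarrow> complex ^ 2" where
  "J v \<equiv> \<i> *s v"

definition complex_atlas ::
  "('a::{t2_space,second_countable_topology}, complex ^ 2) chart set \<Rightarrow> bool" where
  "complex_atlas \<B> \<longleftrightarrow> smooth_atlas \<B> \<and>
     (\<forall>\<alpha>\<in>\<B>. \<forall>\<beta>\<in>\<B>. \<forall>p\<in>fst \<alpha> \<inter> fst \<beta>. \<forall>v. dd \<alpha> (snd \<beta>) p (J v) = J (dd \<alpha> (snd \<beta>) p v))"

text \<open>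
  The last condition says that \<open>J\<close> is parallel: as \<open>J\<close> has constant components,
  \<open>(\<nabla>\<^sub>uJ)v = \<Gamma>(u,Jv) - J\<Gamma>(u,v)\<close>.
\<close>

definition kaehler_metric ::
  "('a::{t2_space,second_countable_topology}, complex ^ 2) chart set \<Rightarrow> ('a, complex ^ 2) metric \<Rightarrow> bool" where
  "kaehler_metric \<B> G \<longleftrightarrow> riemannian_metric \<B> G \<and>
     (\<forall>\<beta>\<in>\<B>. \<forall>q\<in>fst \<beta>. \<forall>u v. G \<beta> q (J u) (J v) = G \<beta> q u v) \<and>
     (\<forall>\<beta>\<in>\<B>. \<forall>q\<in>fst \<beta>. \<forall>u v. levi_civita G \<beta> q u (J v) = J (levi_civita G \<beta> q u v))"

text \<open>
  \<open>space_form \<B> G c\<close>: the underlying type of \<open>\<B>\<close>, with the complex structure given by the atlas \<open>\<B>\<close> and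
  the metric \<open>G\<close>, is \<open>M\<^sub>2(c)\<close>.
\<close>

definition space_form ::
  "('a::{t2_space,second_countable_topology}, complex ^ 2) chart set \<Rightarrow> ('a, complex ^ 2) metric \<Rightarrow>
   real \<Rightarrow> bool" where
  "space_form \<B> G c \<longleftrightarrow> complex_atlas \<B> \<and> kaehler_metric \<B> G \<and>
     connected (UNIV :: 'a set) \<and> simply_connected (UNIV :: 'a set) \<and> geodesically_complete \<B> G \<and>
     (\<forall>\<beta>\<in>\<B>. \<forall>q\<in>fst \<beta>. \<forall>u. u \<noteq> 0 \<longrightarrow> sectional_curvature G \<beta> q u (J u) = c)"


section \<open>Real hypersurfaces\<close>

text \<open>
  The immersion \<open>f\<close> is not required to be injective.
\<close>

definition real_hypersurface ::
  "('a::{t2_space,second_countable_topology}, complex ^ 2) chart set \<Rightarrow>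
   ('m::{t2_space,second_countable_topology}, real ^ 3) chart set \<Rightarrow> ('m \<Rightarrow> 'a) \<Rightarrow> bool" where
  "real_hypersurface \<B> \<A> f \<longleftrightarrow> smooth_atlas \<A> \<and> connected (UNIV :: 'm set) \<and> immersion \<A> \<B> f"

text \<open>
  In the next definitions the result does not depend on the auxiliary chart \<open>chart_at \<B> (f p)\<close> of the
  ambient space.
\<close>

definition induced_metric ::
  "('a, complex ^ 2) chart set \<Rightarrow> ('a, complex ^ 2) metric \<Rightarrow> ('m \<Rightarrow> 'a) \<Rightarrow> ('m, real ^ 3) metric" where
  "induced_metric \<B> G f \<alpha> p u v = (let \<beta> = chart_at \<B> (f p) in
     G \<beta> (f p) (dd \<alpha> (snd \<beta> \<circ> f) p u) (dd \<alpha> (snd \<beta> \<circ> f) p v))"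

definition unit_normal_field ::
  "('a, complex ^ 2) chart set \<Rightarrow> ('a, complex ^ 2) metric \<Rightarrow>
   ('m::topological_space, real ^ 3) chart set \<Rightarrow> ('m \<Rightarrow> 'a) \<Rightarrow> 'm set \<Rightarrow>
   (('a, complex ^ 2) chart \<Rightarrow> 'm \<Rightarrow> complex ^ 2) \<Rightarrow> bool" where
  "unit_normal_field \<B> G \<A> f U N \<longleftrightarrow> open U \<and> vector_field_along \<A> \<B> f U N \<and>
     (\<forall>\<beta>\<in>\<B>. \<forall>p\<in>U \<inter> f -` fst \<beta>. G \<beta> (f p) (N \<beta> p) (N \<beta> p) = 1 \<and>
        (\<forall>\<alpha>\<in>\<A>. p \<in> fst \<alpha> \<longrightarrow> (\<forall>v. G \<beta> (f p) (dd \<alpha> (snd \<beta> \<circ> f) p v) (N \<beta> p) = 0)))"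

definition shape_operator ::
  "('a, complex ^ 2) chart set \<Rightarrow> ('a, complex ^ 2) metric \<Rightarrow> ('m \<Rightarrow> 'a) \<Rightarrow>
   (('a, complex ^ 2) chart \<Rightarrow> 'm \<Rightarrow> complex ^ 2) \<Rightarrow> ('m, real ^ 3) endofield" where
  "shape_operator \<B> G f N \<alpha> p v = (let \<beta> = chart_at \<B> (f p) in
     THE a. nabla_along (levi_civita G) f \<alpha> N p v \<beta> = - dd \<alpha> (snd \<beta> \<circ> f) p a)"

definition structure_field ::
  "('a, complex ^ 2) chart set \<Rightarrow> ('m \<Rightarrow> 'a) \<Rightarrow>
   (('a, complex ^ 2) chart \<Rightarrow> 'm \<Rightarrow> complex ^ 2) \<Rightarrow> ('m, real ^ 3) vfield" where
  "structure_field \<B> f N \<alpha> p = (let \<beta> = chart_at \<B> (f p) in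
     THE x. dd \<alpha> (snd \<beta> \<circ> f) p x = - J (N \<beta> p))"

definition eta ::
  "('a, complex ^ 2) chart set \<Rightarrow> ('a, complex ^ 2) metric \<Rightarrow> ('m \<Rightarrow> 'a) \<Rightarrow>
   (('a, complex ^ 2) chart \<Rightarrow> 'm \<Rightarrow> complex ^ 2) \<Rightarrow> ('m, real ^ 3) chart \<Rightarrow> 'm \<Rightarrow> real ^ 3 \<Rightarrow> real" where
  "eta \<B> G f N \<alpha> p v = induced_metric \<B> G f \<alpha> p v (structure_field \<B> f N \<alpha> p)"

text \<open>
  As \<open>N\<close> is unique up to sign at every point, \<open>ker \<eta>\<close> is globally defined.
\<close>

definition valued_in_D ::
  "('a, complex ^ 2) chart set \<Rightarrow> ('a, complex ^ 2) metric \<Rightarrow>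
   ('m::topological_space, real ^ 3) chart set \<Rightarrow> ('m \<Rightarrow> 'a) \<Rightarrow> ('m, real ^ 3) vfield \<Rightarrow> bool" where
  "valued_in_D \<B> G \<A> f X \<longleftrightarrow> (\<forall>U N. unit_normal_field \<B> G \<A> f U N \<longrightarrow>
     (\<forall>\<alpha>\<in>\<A>. \<forall>p\<in>U \<inter> fst \<alpha>. eta \<B> G f N \<alpha> p (X \<alpha> p) = 0))"

definition endo_apply :: "('m, 'e) endofield \<Rightarrow> ('m, 'e) vfield \<Rightarrow> ('m, 'e) vfield" where
  "endo_apply A Y \<alpha> p = A \<alpha> p (Y \<alpha> p)"

text \<open>
  \<open>(\<L>\<^sub>XA)Y\<close> and \<open>(\<nabla>\<^sub>XA)Y\<close> for a field of endomorphisms \<open>A\<close>.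
\<close>

definition lie_derivative ::
  "('m, 'e::euclidean_space) vfield \<Rightarrow> ('m, 'e) endofield \<Rightarrow> ('m, 'e) vfield \<Rightarrow> ('m, 'e) vfield" where
  "lie_derivative X A Y \<alpha> p =
     lie_bracket X (endo_apply A Y) \<alpha> p - endo_apply A (lie_bracket X Y) \<alpha> p"

definition covariant_derivative ::
  "('m, 'e::euclidean_space) connection \<Rightarrow> ('m, 'e) vfield \<Rightarrow> ('m, 'e) endofield \<Rightarrow> ('m, 'e) vfield \<Rightarrow>
   ('m, 'e) vfield" where
  "covariant_derivative \<Gamma> X A Y \<alpha> p =
     nabla \<Gamma> X (endo_apply A Y) \<alpha> p - endo_apply A (nabla \<Gamma> X Y) \<alpha> p"

end

theory Submission
  imports Defs
begin
text \<open>
  Evaluated at a point \<open>p\<close>, the condition \<open>\<L>\<^sub>XA = \<nabla>\<^sub>XA\<close> reads \<open>\<nabla>\<^bsub>AY\<^esub>X = A\<nabla>\<^sub>YX\<close>. Replacing \<open>X\<close> by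
  \<open>hX\<close>, where \<open>h\<close> is a function, gives \<open>dh(AY) X = dh(Y) AX\<close>. As \<open>dh\<close> and \<open>Y\<close> are arbitrary and \<open>X\<close> can be
  chosen nonzero at \<open>p\<close>, the shape operator is a multiple \<open>\<lambda>\<close> of the identity. Differentiating
  \<open>\<nabla>\<^sub>XN = - \<lambda>X\<close> once more gives \<open>R(X,Y)N = - (X\<lambda>)Y + (Y\<lambda>)X\<close> for the curvature tensor of the ambient
  space. Hence all the terms of bidegree \<open>(2, 2)\<close> in \<open>g(R(u,Ju)Ju,u) = c g(u,u)\<^sup>2\<close> at \<open>u = X + tN\<close> with
  \<open>X\<close> orthogonal to \<open>N\<close> and \<open>JN\<close> vanish on the left, and so \<open>c = 0\<close>.
\<close>

section \<open>Functions of class \<open>C\<^sup>k\<close>\<close>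

text \<open>The condition speaks of globally defined fields with values in
  \<open>ker \<eta>\<close>, so \<open>h\<close> and \<open>X\<close> are not at free disposal: both
  are built in one chart, cut off by a bump function and extended by zero. The comparison is between
  two fields with the same value \<open>W\<close> at \<open>p\<close>, whose derivatives there
  differ by \<open>v \<mapsto> (v \<bullet> e) W\<close>; the Christoffel terms of the two then
  cancel. A section of \<open>ker \<eta>\<close> that does not vanish at \<open>p\<close> comes from
  two constant vectors \<open>a\<close>, \<open>b\<close> as \<omega>(b) a - \<omega>(a) b, where
  \<omega> is \<eta> up to sign. The condition is quantified over local unit normals, hence it gives
  information only once such a normal exists around a point; Gram-Schmidt provides a smooth one.
  Umbilicity yields a factor \<lambda> at each point separately; the differentiability that the
  curvature formula requires is recovered by writing \<lambda> as a quotient of components. Complex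
  dimension 2 enters twice: a hypersurface has codimension one, so a vector orthogonal to
  \<open>N\<close> is tangent, and four real dimensions leave room for a unit vector
  \<open>X\<close> orthogonal to both \<open>N\<close> and \<open>JN\<close>.\<close>

lemma Ck_on_imp_continuous_on: "Ck_on k S f \<Longrightarrow> continuous_on S f"
  by (cases k) (auto intro!: continuous_at_imp_continuous_on differentiable_imp_continuous_within)

lemma Ck_on_SucD: "Ck_on (Suc k) S f \<Longrightarrow> Ck_on k S f"
proof (induction k arbitrary: f)
  case 0
  then show ?case using Ck_on_imp_continuous_on[of "Suc 0" S f] by simp
next
  case (Suc k)
  then show ?case by (simp del: Ck_on.simps(2) add: Ck_on.simps(2)[of "Suc k"])
      (metis Ck_on.simps(2))
qed

lemma Ck_on_has_derivative:
  "Ck_on (Suc k) S f \<Longrightarrow> x \<in> S \<Longrightarrow> (f has_derivative frechet_derivative f (at x)) (at x)"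
  by (simp add: frechet_derivative_works)

lemma Ck_on_deriv: "Ck_on (Suc k) S f \<Longrightarrow> Ck_on k S (\<lambda>x. frechet_derivative f (at x) v)"
  by simp

text \<open>Openness of \<open>S\<close> turns equality on \<open>S\<close> into equality near each
  of its points, so the derivatives of \<open>f\<close> and \<open>g\<close> agree there as well and
  the induction can pass to them.\<close>

lemma Ck_on_cong:
  assumes "open S" "\<And>x. x \<in> S \<Longrightarrow> f x = g x" "Ck_on k S f"
  shows "Ck_on k S g"
  using assms(2,3)
proof (induction k arbitrary: f g)
  case 0
  then show ?case by (simp cong: continuous_on_cong)
next
  case (Suc k)
  have d: "(g has_derivative frechet_derivative f (at x)) (at x)" if "x \<in> S" for x
    using has_derivative_transform_within_open[OF Ck_on_has_derivative[OF Suc.prems(2) that] \<open>open S\<close> that]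
      Suc.prems(1) by blast
  have eq: "frechet_derivative f (at x) = frechet_derivative g (at x)" if "x \<in> S" for x
    using frechet_derivative_at[OF d[OF that]] .
  have "Ck_on k S (\<lambda>x. frechet_derivative g (at x) v)" for v
    by (rule Suc.IH[OF _ Ck_on_deriv[OF Suc.prems(2)]]) (simp add: eq)
  then show ?case using d by (auto simp: differentiable_def)
qed

text \<open>\<open>frechet_derivative\<close> is defined by a choice and does not compute.
  Uniqueness of the derivative lets an explicit formula \<open>f'\<close> take its place on
  \<open>S\<close>.\<close>

lemma Ck_on_SucI:
  assumes "open S" "\<And>x. x \<in> S \<Longrightarrow> (f has_derivative f' x) (at x)"
    and "\<And>v. Ck_on k S (\<lambda>x. f' x v)"
  shows "Ck_on (Suc k) S f"
proof -
  have eq: "f' x = frechet_derivative f (at x)" if "x \<in> S" for x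
    using frechet_derivative_at[OF assms(2)[OF that]] .
  have "Ck_on k S (\<lambda>x. frechet_derivative f (at x) v)" for v
    by (rule Ck_on_cong[OF \<open>open S\<close> _ assms(3)]) (simp add: eq)
  then show ?thesis using assms(2) by (auto simp: differentiable_def)
qed

lemma Ck_on_subset: "Ck_on k S f \<Longrightarrow> T \<subseteq> S \<Longrightarrow> Ck_on k T f"
  by (induction k arbitrary: f) (auto intro: continuous_on_subset)

lemma Ck_on_local:
  assumes "\<And>x. x \<in> S \<Longrightarrow> \<exists>T. open T \<and> x \<in> T \<and> Ck_on k T f"
  shows "Ck_on k S f"
  using assms
proof (induction k arbitrary: f)
  case 0
  show ?case
  proof (simp, rule continuous_at_imp_continuous_on, rule ballI)
    fix x assume "x \<in> S"
    with 0 obtain T where "open T" "x \<in> T" "continuous_on T f" by auto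
    then show "isCont f x" by (simp add: continuous_on_eq_continuous_at)
  qed
next
  case (Suc k)
  have "f differentiable at x" if "x \<in> S" for x
    using Suc.prems[OF that] by auto
  moreover have "Ck_on k S (\<lambda>x. frechet_derivative f (at x) v)" for v
    by (rule Suc.IH) (use Suc.prems in \<open>fastforce\<close>)
  ultimately show ?case by simp
qed

lemma Ck_on_const: "open S \<Longrightarrow> Ck_on k S (\<lambda>x. c)"
  by (induction k arbitrary: c) (auto intro!: Ck_on_SucI[where f' = "\<lambda>_ _. 0"])

lemma Ck_on_linear:
  assumes "bounded_linear L" "open S" "Ck_on k S f"
  shows "Ck_on k S (\<lambda>x. L (f x))"
  using assms(3)
proof (induction k arbitrary: f)
  case 0
  then show ?case using bounded_linear.continuous_on[OF assms(1)] by simp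
next
  case (Suc k)
  show ?case
    by (rule Ck_on_SucI[OF \<open>open S\<close>
          bounded_linear.has_derivative[OF assms(1) Ck_on_has_derivative[OF Suc.prems]]])
      (use Suc in auto)
qed

lemma Ck_on_id: "open S \<Longrightarrow> Ck_on k S (\<lambda>x. x)"
  by (cases k) (auto intro!: Ck_on_SucI[where f' = "\<lambda>_ v. v"] Ck_on_const)

lemma Ck_on_add:
  assumes "open S" "Ck_on k S f" "Ck_on k S g"
  shows "Ck_on k S (\<lambda>x. f x + g x)"
  using assms(2,3)
proof (induction k arbitrary: f g)
  case 0
  then show ?case by (auto intro: continuous_on_add)
next
  case (Suc k)
  show ?case
    by (rule Ck_on_SucI[OF \<open>open S\<close> has_derivative_add[OF Ck_on_has_derivative[OF Suc.prems(1)]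
          Ck_on_has_derivative[OF Suc.prems(2)]]])
      (use Suc in auto)
qed

lemma Ck_on_sum:
  assumes "open S" "\<And>i. i \<in> I \<Longrightarrow> Ck_on k S (f i)"
  shows "Ck_on k S (\<lambda>x. \<Sum>i\<in>I. f i x)"
  using assms(2) by (induction I rule: infinite_finite_induct)
    (auto intro: Ck_on_const Ck_on_add assms(1))

text \<open>The product rule pairs a derivative of one factor, of class k, with the other factor, of
  class k + 1. The latter is lowered by \<open>Ck_on_SucD\<close>, so that the induction hypothesis
  applies to both summands.\<close>

lemma Ck_on_bilinear:
  assumes "bounded_bilinear B" "open S" "Ck_on k S f" "Ck_on k S g"
  shows "Ck_on k S (\<lambda>x. B (f x) (g x))"
  using assms(3,4)
proof (induction k arbitrary: f g)
  case 0
  then show ?case using bounded_bilinear.continuous_on[OF assms(1)] by auto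
next
  case (Suc k)
  have "Ck_on k S f" "Ck_on k S g" using Suc.prems Ck_on_SucD by auto
  then have "Ck_on k S (\<lambda>x. B (f x) (frechet_derivative g (at x) v) + B (frechet_derivative f (at x) v) (g x))" for v
    using Suc by (intro Ck_on_add assms(2)) (auto intro!: Suc.IH)
  then show ?case
    by (intro Ck_on_SucI[OF \<open>open S\<close> bounded_bilinear.FDERIV[OF assms(1)
          Ck_on_has_derivative[OF Suc.prems(1)] Ck_on_has_derivative[OF Suc.prems(2)]]])
qed

lemma linear_sum_Basis:
  fixes L :: "'b::euclidean_space \<Rightarrow> 'c::real_vector"
  assumes "linear L"
  shows "L u = (\<Sum>b\<in>Basis. (u \<bullet> b) *\<^sub>R L b)"
proof -
  have "L u = L (\<Sum>b\<in>Basis. (u \<bullet> b) *\<^sub>R b)" by (simp add: euclidean_representation)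
  then show ?thesis by (simp only: linear_sum[OF assms] linear_scale[OF assms])
qed

text \<open>By the chain rule the derivative of \<open>g\<close> at \<open>f x\<close> is applied to
  a vector depending on \<open>x\<close>, whereas \<open>Ck_on\<close> controls derivatives in fixed
  directions only. Expanding that vector in the standard basis of the middle space leaves fixed
  directions; hence the class \<open>euclidean_space\<close> there.\<close>

lemma Ck_on_compose:
  fixes f :: "'a::real_normed_vector \<Rightarrow> 'b::euclidean_space"
    and g :: "'b \<Rightarrow> 'c::real_normed_vector"
  assumes "open S" "Ck_on k S f" "Ck_on k T g" "f ` S \<subseteq> T"
  shows "Ck_on k S (\<lambda>x. g (f x))"
  using assms(2,3)
proof (induction k arbitrary: g)
  case 0
  then show ?case using continuous_on_compose2[OF _ _ assms(4)] by simp
next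
  case (Suc k)
  have g: "(g has_derivative frechet_derivative g (at (f x))) (at (f x))" if "x \<in> S" for x
    using Suc.prems(2) assms(4) that by (auto intro!: Ck_on_has_derivative)
  have "Ck_on k S (\<lambda>x. frechet_derivative g (at (f x)) (frechet_derivative f (at x) v))" for v
  proof (rule Ck_on_cong[OF \<open>open S\<close>])
    show "Ck_on k S (\<lambda>x. \<Sum>b\<in>Basis. (frechet_derivative f (at x) v \<bullet> b) *\<^sub>R frechet_derivative g (at (f x)) b)"
      using Suc.prems Ck_on_SucD[OF Suc.prems(1)]
      by (intro Ck_on_sum Ck_on_bilinear[OF bounded_bilinear_scaleR]
          Ck_on_linear[OF bounded_linear_inner_left] Suc.IH assms(1)) auto
    show "(\<Sum>b\<in>Basis. (frechet_derivative f (at x) v \<bullet> b) *\<^sub>R frechet_derivative g (at (f x)) b)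
      = frechet_derivative g (at (f x)) (frechet_derivative f (at x) v)" if "x \<in> S" for x
      using linear_sum_Basis[OF has_derivative_linear[OF g[OF that]]] by metis
  qed
  moreover have "((\<lambda>x. g (f x)) has_derivative
      (\<lambda>v. frechet_derivative g (at (f x)) (frechet_derivative f (at x) v))) (at x)" if "x \<in> S" for x
    using diff_chain_at[OF Ck_on_has_derivative[OF Suc.prems(1) that] g[OF that]] by (simp add: o_def)
  ultimately show ?case
    by (intro Ck_on_SucI[OF \<open>open S\<close>])
qed

section \<open>Reciprocals and square roots\<close>

lemma Ck_on_inverse: "Ck_on k (- {0}) (inverse :: real \<Rightarrow> real)"
proof (induction k)
  case 0
  then show ?case by (auto intro!: continuous_intros)
next
  case (Suc k)
  have op: "open (- {0 :: real})" by (simp add: open_Compl)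
  show ?case
  proof (rule Ck_on_SucI[OF op])
    show "(inverse has_derivative (\<lambda>v. - (inverse x * v * inverse x))) (at x)" if "x \<in> - {0}" for x :: real
      using that by (auto intro!: derivative_eq_intros)
    \<comment> \<open>The derivative of \<open>inverse\<close> is a polynomial in
      \<open>inverse\<close>, so the class k already established carries over to it.\<close>
    show "Ck_on k (- {0}) (\<lambda>x. - (inverse x * v * inverse x))" for v :: real
      by (intro Ck_on_linear[OF bounded_linear_minus[OF bounded_linear_ident]]
          Ck_on_bilinear[OF bounded_bilinear_mult] Suc Ck_on_const op)
  qed
qed

lemma Ck_on_sqrt: "Ck_on k {0<..} sqrt"
proof (induction k)
  case 0
  then show ?case by (auto intro!: continuous_intros)
next
  case (Suc k)
  have op: "open {0::real<..}" by simp
  show ?case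
  proof (rule Ck_on_SucI[OF op])
    \<comment> \<open>The derivative is written through \<open>inverse\<close> and
      \<open>sqrt\<close> themselves, so that the induction hypothesis composed with
      \<open>Ck_on_inverse\<close> covers it.\<close>
    show "(sqrt has_derivative (\<lambda>v. inverse (sqrt x) * (v / 2))) (at x)" if "x \<in> {0<..}" for x :: real
      using that by (auto intro!: derivative_eq_intros)
    show "Ck_on k {0<..} (\<lambda>x. inverse (sqrt x) * (v / 2))" for v :: real
      by (intro Ck_on_bilinear[OF bounded_bilinear_mult] Ck_on_const op
          Ck_on_compose[OF op Suc Ck_on_inverse]) auto
  qed
qed

section \<open>Calculus rules for smooth functions\<close>

lemma smooth_onI: "(\<And>k. Ck_on k S f) \<Longrightarrow> smooth_on S f"
  by (simp add: smooth_on_def)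

lemma smooth_onD: "smooth_on S f \<Longrightarrow> Ck_on k S f"
  by (simp add: smooth_on_def)

lemma smooth_on_imp_continuous_on: "smooth_on S f \<Longrightarrow> continuous_on S f"
  using Ck_on_imp_continuous_on smooth_onD by blast

lemma smooth_on_has_derivative:
  "smooth_on S f \<Longrightarrow> x \<in> S \<Longrightarrow> (f has_derivative frechet_derivative f (at x)) (at x)"
  using Ck_on_has_derivative smooth_onD by blast

lemma smooth_on_differentiable: "smooth_on S f \<Longrightarrow> x \<in> S \<Longrightarrow> f differentiable at x"
  using smooth_on_has_derivative by (auto simp: differentiable_def)

lemma smooth_on_deriv: "smooth_on S f \<Longrightarrow> smooth_on S (\<lambda>x. frechet_derivative f (at x) v)"
  unfolding smooth_on_def using Ck_on_deriv by blast

lemma smooth_on_cong: "open S \<Longrightarrow> (\<And>x. x \<in> S \<Longrightarrow> f x = g x) \<Longrightarrow> smooth_on S f \<Longrightarrow> smooth_on S g"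
  unfolding smooth_on_def using Ck_on_cong by blast

lemma smooth_on_subset: "smooth_on S f \<Longrightarrow> T \<subseteq> S \<Longrightarrow> smooth_on T f"
  unfolding smooth_on_def using Ck_on_subset by blast

lemma smooth_on_local:
  "(\<And>x. x \<in> S \<Longrightarrow> \<exists>T. open T \<and> x \<in> T \<and> smooth_on T f) \<Longrightarrow> smooth_on S f"
  unfolding smooth_on_def using Ck_on_local by meson

lemma smooth_on_const: "open S \<Longrightarrow> smooth_on S (\<lambda>x. c)"
  by (simp add: smooth_on_def Ck_on_const)

lemma smooth_on_id: "open S \<Longrightarrow> smooth_on S (\<lambda>x. x)"
  by (simp add: smooth_on_def Ck_on_id)

lemma smooth_on_linear:
  "bounded_linear L \<Longrightarrow> open S \<Longrightarrow> smooth_on S f \<Longrightarrow> smooth_on S (\<lambda>x. L (f x))"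
  by (simp add: smooth_on_def Ck_on_linear)

lemma smooth_on_add:
  "open S \<Longrightarrow> smooth_on S f \<Longrightarrow> smooth_on S g \<Longrightarrow> smooth_on S (\<lambda>x. f x + g x)"
  by (simp add: smooth_on_def Ck_on_add)

lemma smooth_on_minus: "open S \<Longrightarrow> smooth_on S f \<Longrightarrow> smooth_on S (\<lambda>x. - f x)"
  by (rule smooth_on_linear[OF bounded_linear_minus[OF bounded_linear_ident]])

lemma smooth_on_diff:
  "open S \<Longrightarrow> smooth_on S f \<Longrightarrow> smooth_on S g \<Longrightarrow> smooth_on S (\<lambda>x. f x - g x)"
  using smooth_on_add[OF _ _ smooth_on_minus] by fastforce

lemma smooth_on_sum:
  "open S \<Longrightarrow> (\<And>i. i \<in> I \<Longrightarrow> smooth_on S (f i)) \<Longrightarrow> smooth_on S (\<lambda>x. \<Sum>i\<in>I. f i x)"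
  by (simp add: smooth_on_def Ck_on_sum)

lemma smooth_on_scaleR:
  "open S \<Longrightarrow> smooth_on S f \<Longrightarrow> smooth_on S g \<Longrightarrow> smooth_on S (\<lambda>x. f x *\<^sub>R g x)"
  by (simp add: smooth_on_def Ck_on_bilinear[OF bounded_bilinear_scaleR])

lemma smooth_on_mult:
  fixes f g :: "'a::real_normed_vector \<Rightarrow> real"
  shows "open S \<Longrightarrow> smooth_on S f \<Longrightarrow> smooth_on S g \<Longrightarrow> smooth_on S (\<lambda>x. f x * g x)"
  by (simp add: smooth_on_def Ck_on_bilinear[OF bounded_bilinear_mult])

lemma smooth_on_inner:
  "open S \<Longrightarrow> smooth_on S f \<Longrightarrow> smooth_on S g \<Longrightarrow> smooth_on S (\<lambda>x. f x \<bullet> g x)"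
  by (simp add: smooth_on_def Ck_on_bilinear[OF bounded_bilinear_inner])

lemma smooth_on_compose:
  fixes f :: "'a::real_normed_vector \<Rightarrow> 'b::euclidean_space"
  shows "open S \<Longrightarrow> smooth_on S f \<Longrightarrow> smooth_on T g \<Longrightarrow> f ` S \<subseteq> T \<Longrightarrow> smooth_on S (\<lambda>x. g (f x))"
  unfolding smooth_on_def using Ck_on_compose by blast

lemma smooth_on_inverse:
  fixes f :: "'a::real_normed_vector \<Rightarrow> real"
  shows "open S \<Longrightarrow> smooth_on S f \<Longrightarrow> (\<And>x. x \<in> S \<Longrightarrow> f x \<noteq> 0) \<Longrightarrow> smooth_on S (\<lambda>x. inverse (f x))"
  by (rule smooth_on_compose[where T = "- {0}"]) (auto simp: smooth_on_def Ck_on_inverse)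

lemma smooth_on_sqrt:
  fixes f :: "'a::real_normed_vector \<Rightarrow> real"
  shows "open S \<Longrightarrow> smooth_on S f \<Longrightarrow> (\<And>x. x \<in> S \<Longrightarrow> f x > 0) \<Longrightarrow> smooth_on S (\<lambda>x. sqrt (f x))"
  by (rule smooth_on_compose[where T = "{0<..}"]) (auto simp: smooth_on_def Ck_on_sqrt)

text \<open>The arguments of \<open>B x\<close> are expanded in the standard basis, because \<open>B\<close> is known to be smooth
  only after evaluation at constant vectors.\<close>

lemma smooth_on_linear_family:
  fixes L :: "'a::real_normed_vector \<Rightarrow> 'b::euclidean_space \<Rightarrow> 'c::real_normed_vector"
  assumes "open S" "\<And>x. x \<in> S \<Longrightarrow> linear (L x)" "\<And>u. smooth_on S (\<lambda>x. L x u)" "smooth_on S P"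
  shows "smooth_on S (\<lambda>x. L x (P x))"
proof (rule smooth_on_cong[OF \<open>open S\<close>])
  show "smooth_on S (\<lambda>x. \<Sum>b\<in>Basis. (P x \<bullet> b) *\<^sub>R L x b)"
    by (intro smooth_on_sum smooth_on_scaleR smooth_on_inner smooth_on_const assms)
qed (simp add: linear_sum_Basis[symmetric] assms(2))

lemma smooth_on_bilinear_family:
  fixes B :: "'a::real_normed_vector \<Rightarrow> 'b::euclidean_space \<Rightarrow> 'd::euclidean_space \<Rightarrow> 'c::real_normed_vector"
  assumes "open S" "\<And>x. x \<in> S \<Longrightarrow> bilinear (B x)" "\<And>u v. smooth_on S (\<lambda>x. B x u v)"
    and "smooth_on S P" "smooth_on S Q"
  shows "smooth_on S (\<lambda>x. B x (P x) (Q x))"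
proof (rule smooth_on_linear_family[OF \<open>open S\<close> _ _ assms(5)])
  show "linear (B x (P x))" if "x \<in> S" for x using assms(2)[OF that] by (simp add: bilinear_def)
  show "smooth_on S (\<lambda>x. B x (P x) v)" for v
    by (rule smooth_on_linear_family[OF \<open>open S\<close> _ assms(3,4)]) (use assms(2) in \<open>simp add: bilinear_def\<close>)
qed

section \<open>Bump functions and the symmetry of second derivatives\<close>

text \<open>The case n = 0 is the classical flat function exp(-1/t). The powers of 1/t make the
  family closed under differentiation up to linear combinations, so a single induction on the order
  treats all n at once.\<close>

definition flat_exp :: "nat \<Rightarrow> real \<Rightarrow> real" where
  "flat_exp n t = (if t > 0 then inverse t ^ n * exp (- inverse t) else 0)"

text \<open>With s = 1/t the limit from the right becomes that of \<open>s ^ n / exp s\<close> at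
  infinity.\<close>

lemma flat_exp_tendsto_0: "(flat_exp n \<longlongrightarrow> 0) (at 0)"
proof (rule filterlim_split_at)
  show "(flat_exp n \<longlongrightarrow> 0) (at_left 0)"
    by (rule tendsto_eventually) (auto simp: flat_exp_def eventually_at_filter)
  have "((\<lambda>t. inverse t ^ n / exp (inverse t)) \<longlongrightarrow> 0) (at_right (0::real))"
    by (rule filterlim_compose[OF tendsto_power_div_exp_0 filterlim_inverse_at_top_right])
  then show "(flat_exp n \<longlongrightarrow> 0) (at_right 0)"
    by (rule Lim_transform_eventually)
      (auto simp: flat_exp_def exp_minus divide_inverse eventually_at_filter)
qed

lemma flat_exp_has_derivative:
  "(flat_exp n has_real_derivative flat_exp (Suc (Suc n)) t - n * flat_exp (Suc n) t) (at t)"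
proof -
  consider "t > 0" | "t < 0" | "t = 0" by linarith
  then show ?thesis
  proof cases
    case 1
    have "((\<lambda>t. inverse t ^ n * exp (- inverse t)) has_real_derivative
        inverse t ^ n * (exp (- inverse t) * (inverse t * inverse t)) +
        n * (inverse t ^ (n - 1) * (- (inverse t * inverse t))) * exp (- inverse t)) (at t)"
      using 1 by (auto intro!: derivative_eq_intros)
    \<comment> \<open>The exponent \<open>n - 1\<close> is truncated at n = 0, where the factor
      \<open>n\<close> removes the term; hence the case distinction on \<open>n\<close>.\<close>
    moreover have "inverse t ^ n * (exp (- inverse t) * (inverse t * inverse t)) +
        n * (inverse t ^ (n - 1) * (- (inverse t * inverse t))) * exp (- inverse t) =
        flat_exp (Suc (Suc n)) t - n * flat_exp (Suc n) t"
      using 1 by (cases n) (simp_all add: flat_exp_def algebra_simps)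
    ultimately have "((\<lambda>t. inverse t ^ n * exp (- inverse t)) has_real_derivative
        flat_exp (Suc (Suc n)) t - n * flat_exp (Suc n) t) (at t)"
      by simp
    then show ?thesis
      by (rule has_field_derivative_transform_within_open[of _ _ _ "{0<..}"])
        (use 1 in \<open>auto simp: flat_exp_def\<close>)
  next
    case 2
    have "((\<lambda>_. 0) has_real_derivative 0) (at t)" by simp
    then have "(flat_exp n has_real_derivative 0) (at t)"
      by (rule has_field_derivative_transform_within_open[of _ _ _ "{..<0}"])
        (use 2 in \<open>auto simp: flat_exp_def\<close>)
    then show ?thesis using 2 by (simp add: flat_exp_def)
  next
    case 3
    \<comment> \<open>The difference quotient of \<open>flat_exp n\<close> at 0 is
      \<open>flat_exp (Suc n)\<close>, whose limit is known.\<close>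
    have "((\<lambda>h. (flat_exp n (0 + h) - flat_exp n 0) / h) \<longlongrightarrow> 0) (at 0)"
      by (rule Lim_transform_eventually[OF flat_exp_tendsto_0[of "Suc n"]])
        (auto simp: flat_exp_def eventually_at_filter divide_inverse)
    then show ?thesis using 3 by (simp add: DERIV_def flat_exp_def)
  qed
qed

lemma Ck_on_flat_exp: "Ck_on k UNIV (flat_exp n)"
proof (induction k arbitrary: n)
  case 0
  then show ?case
    by (auto intro!: continuous_at_imp_continuous_on DERIV_isCont[OF flat_exp_has_derivative])
next
  case (Suc k)
  have "Ck_on k UNIV (\<lambda>t. (flat_exp (Suc (Suc n)) t + (- real n) * flat_exp (Suc n) t) * v)" for v
    by (intro Ck_on_bilinear[OF bounded_bilinear_mult] Ck_on_add Ck_on_const open_UNIV Suc)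
  then show ?case
    by (intro Ck_on_SucI[OF open_UNIV flat_exp_has_derivative[unfolded has_field_derivative_def]]) simp
qed

text \<open>The compact set \<open>K\<close> outside of which \<open>b\<close> vanishes is what
  later makes extension by zero smooth across the edge of a chart.\<close>

lemma smooth_bump:
  fixes x :: "'a::euclidean_space"
  assumes "open S" "x \<in> S"
  obtains b :: "'a \<Rightarrow> real" and K where "smooth_on UNIV b" "compact K" "K \<subseteq> S" "b x \<noteq> 0"
    "\<And>y. y \<notin> K \<Longrightarrow> b y = 0"
proof -
  obtain r where r: "r > 0" "cball x r \<subseteq> S"
    using assms by (meson open_contains_cball)
  \<comment> \<open>The squared distance is a polynomial in the coordinates, whereas the norm is not
    differentiable at the centre. \<open>b\<close> is positive exactly inside the ball of radius
    \<open>r\<close>.\<close>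
  define b where "b y = flat_exp 0 (r\<^sup>2 - (y - x) \<bullet> (y - x))" for y
  have "smooth_on UNIV b"
    unfolding b_def
    by (rule smooth_on_compose[where T = UNIV])
      (auto intro!: smooth_on_diff smooth_on_inner smooth_on_id smooth_on_const
        smooth_onI[OF Ck_on_flat_exp])
  moreover have "b y = 0" if "y \<notin> cball x r" for y
  proof -
    have "r\<^sup>2 \<le> (norm (y - x))\<^sup>2"
      using that r(1) by (intro power_mono) (auto simp: dist_norm norm_minus_commute)
    then show ?thesis by (simp add: b_def flat_exp_def power2_norm_eq_inner)
  qed
  moreover have "b x \<noteq> 0" using r(1) by (simp add: b_def flat_exp_def)
  ultimately show ?thesis using that[of b "cball x r"] r by auto
qed

section \<open>Symmetry of second derivatives\<close>

lemma has_real_derivative_along_line: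
  fixes f :: "'a::real_normed_vector \<Rightarrow> real"
  assumes "(f has_derivative f') (at (x + a *\<^sub>R u))"
  shows "((\<lambda>t. f (x + t *\<^sub>R u)) has_real_derivative f' u) (at a)"
proof -
  have "((\<lambda>t. x + t *\<^sub>R u) has_derivative (\<lambda>t. t *\<^sub>R u)) (at a)"
    by (auto intro!: derivative_eq_intros)
  from diff_chain_at[OF this assms]
  have "((\<lambda>t. f (x + t *\<^sub>R u)) has_derivative (\<lambda>t. f' (t *\<^sub>R u))) (at a)" by (simp add: o_def)
  then show ?thesis
    by (simp add: has_field_derivative_def linear_scale[OF has_derivative_linear[OF assms]]
        mult.commute[of _ "f' u"])
qed

text \<open>The mean value theorem is applied to
  \<open>a \<mapsto> f (x + s v + a u) - f (x + a u)\<close>, and a second time, along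
  \<open>v\<close>, to the difference of derivatives which this produces.\<close>

lemma mixed_difference_MVT:
  fixes f :: "'a::real_normed_vector \<Rightarrow> real"
  assumes f: "Ck_on (Suc (Suc 0)) S f" and "0 < s"
    and S: "\<And>a b. 0 \<le> a \<Longrightarrow> a \<le> s \<Longrightarrow> 0 \<le> b \<Longrightarrow> b \<le> s \<Longrightarrow> x + a *\<^sub>R u + b *\<^sub>R v \<in> S"
  obtains a b where "0 < a" "a < s" "0 < b" "b < s"
    "f (x + s *\<^sub>R u + s *\<^sub>R v) - f (x + s *\<^sub>R u) - f (x + s *\<^sub>R v) + f x =
     s * (s * frechet_derivative (\<lambda>y. frechet_derivative f (at y) u) (at (x + a *\<^sub>R u + b *\<^sub>R v)) v)"
proof -
  have S0: "x + a *\<^sub>R u \<in> S" if "0 \<le> a" "a \<le> s" for a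
    using S[of a 0] that \<open>0 < s\<close> by simp
  have Ss: "(x + s *\<^sub>R v) + a *\<^sub>R u \<in> S" if "0 \<le> a" "a \<le> s" for a
    using S[of a s] that \<open>0 < s\<close> by (simp add: algebra_simps)
  have "((\<lambda>a. f ((x + s *\<^sub>R v) + a *\<^sub>R u) - f (x + a *\<^sub>R u)) has_real_derivative
      frechet_derivative f (at ((x + s *\<^sub>R v) + a *\<^sub>R u)) u - frechet_derivative f (at (x + a *\<^sub>R u)) u) (at a)"
    if "0 \<le> a" "a \<le> s" for a
    using that by (intro DERIV_diff has_real_derivative_along_line Ck_on_has_derivative[OF f] S0 Ss)
  from MVT2[OF \<open>0 < s\<close> this] obtain a where a: "0 < a" "a < s"
    "f ((x + s *\<^sub>R v) + s *\<^sub>R u) - f (x + s *\<^sub>R u) - (f (x + s *\<^sub>R v) - f x) =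
      s * (frechet_derivative f (at ((x + s *\<^sub>R v) + a *\<^sub>R u)) u - frechet_derivative f (at (x + a *\<^sub>R u)) u)"
    by auto
  have "((\<lambda>b. frechet_derivative f (at ((x + a *\<^sub>R u) + b *\<^sub>R v)) u) has_real_derivative
      frechet_derivative (\<lambda>y. frechet_derivative f (at y) u) (at ((x + a *\<^sub>R u) + b *\<^sub>R v)) v) (at b)"
    if "0 \<le> b" "b \<le> s" for b
    using that a by (intro has_real_derivative_along_line[where f = "\<lambda>y. frechet_derivative f (at y) u"]
        Ck_on_has_derivative[OF Ck_on_deriv[OF f]] S) auto
  from MVT2[OF \<open>0 < s\<close> this] obtain b where b: "0 < b" "b < s"
    "frechet_derivative f (at ((x + a *\<^sub>R u) + s *\<^sub>R v)) u - frechet_derivative f (at (x + a *\<^sub>R u)) u =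
      s * frechet_derivative (\<lambda>y. frechet_derivative f (at y) u) (at ((x + a *\<^sub>R u) + b *\<^sub>R v)) v"
    by auto
  have "x + s *\<^sub>R v + a *\<^sub>R u = x + a *\<^sub>R u + s *\<^sub>R v" "x + s *\<^sub>R v + s *\<^sub>R u = x + s *\<^sub>R u + s *\<^sub>R v"
    by (simp_all add: algebra_simps)
  then show ?thesis using a b that[of a b] by (simp add: algebra_simps)
qed

text \<open>The second difference over the parallelogram with sides \<open>s u\<close> and
  \<open>s v\<close> is symmetric in \<open>u\<close> and \<open>v\<close>, and it equals the square
  of \<open>s\<close> times either mixed derivative at some nearby point. Continuity of both mixed
  derivatives at \<open>x\<close> forces them to agree.\<close>

lemma real_second_derivative_symmetric:
  fixes f :: "'a::real_normed_vector \<Rightarrow> real"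
  assumes f: "Ck_on (Suc (Suc 0)) S f" and "open S" "x \<in> S"
  shows "frechet_derivative (\<lambda>y. frechet_derivative f (at y) u) (at x) v =
    frechet_derivative (\<lambda>y. frechet_derivative f (at y) v) (at x) u"
proof (rule ccontr)
  define P where "P u v y = frechet_derivative (\<lambda>y. frechet_derivative f (at y) u) (at y) v" for u v y
  assume "\<not> ?thesis"
  then have ne: "P u v x \<noteq> P v u x" by (simp add: P_def)
  \<comment> \<open>Half the gap: a value within \<epsilon> of \<open>P u v x\<close> cannot equal
    one within \<epsilon> of \<open>P v u x\<close>.\<close>
  define \<epsilon> where "\<epsilon> = \<bar>P u v x - P v u x\<bar> / 2"
  have "\<epsilon> > 0" using ne by (simp add: \<epsilon>_def)
  have "continuous_on S (P u v)" for u v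
    using f unfolding P_def by simp
  then have cont: "isCont (P u v) x" for u v
    using assms(2,3) by (simp add: continuous_on_eq_continuous_at)
  obtain d1 where d1: "d1 > 0" "\<And>y. dist y x < d1 \<Longrightarrow> dist (P u v y) (P u v x) < \<epsilon>"
    using cont[of u v] \<open>\<epsilon> > 0\<close> unfolding continuous_at_eps_delta by blast
  obtain d2 where d2: "d2 > 0" "\<And>y. dist y x < d2 \<Longrightarrow> dist (P v u y) (P v u x) < \<epsilon>"
    using cont[of v u] \<open>\<epsilon> > 0\<close> unfolding continuous_at_eps_delta by blast
  obtain d3 where d3: "d3 > 0" "ball x d3 \<subseteq> S"
    using assms(2,3) by (meson open_contains_ball)
  define d where "d = min d1 (min d2 d3)"
  \<comment> \<open>Keeps the whole parallelogram within distance \<open>d\<close> of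
    \<open>x\<close>; the summand 1 makes the denominator positive even for
    \<open>u = v = 0\<close>.\<close>
  define s where "s = d / (2 * (norm u + norm v + 1))"
  have "d > 0" using d1(1) d2(1) d3(1) by (simp add: d_def)
  then have "s > 0" by (simp add: s_def add_nonneg_pos)
  have near: "dist (x + a *\<^sub>R u + b *\<^sub>R v) x < d" if "0 \<le> a" "a \<le> s" "0 \<le> b" "b \<le> s" for a b
  proof -
    have "dist (x + a *\<^sub>R u + b *\<^sub>R v) x \<le> norm (a *\<^sub>R u) + norm (b *\<^sub>R v)"
      using norm_triangle_ineq[of "a *\<^sub>R u" "b *\<^sub>R v"]
      by (simp add: dist_norm add.assoc del: norm_scaleR)
    also have "\<dots> \<le> s * norm u + s * norm v"
      using that by (auto intro!: add_mono mult_right_mono)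
    also have "\<dots> < s * (2 * (norm u + norm v + 1))"
      using \<open>s > 0\<close> by (simp add: algebra_simps add_nonneg_pos)
    also have "\<dots> = d" unfolding s_def by (simp add: add_nonneg_eq_0_iff)
    finally show ?thesis .
  qed
  have inS: "x + a *\<^sub>R u + b *\<^sub>R v \<in> S" if "0 \<le> a" "a \<le> s" "0 \<le> b" "b \<le> s" for a b
    using near[OF that] d3 by (auto simp: d_def dist_commute)
  have inS': "x + a *\<^sub>R v + b *\<^sub>R u \<in> S" if "0 \<le> a" "a \<le> s" "0 \<le> b" "b \<le> s" for a b
    using inS[of b a] that by (simp add: algebra_simps)
  obtain a b where ab: "0 < a" "a < s" "0 < b" "b < s"
    "f (x + s *\<^sub>R u + s *\<^sub>R v) - f (x + s *\<^sub>R u) - f (x + s *\<^sub>R v) + f x =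
     s * (s * P u v (x + a *\<^sub>R u + b *\<^sub>R v))"
    unfolding P_def by (rule mixed_difference_MVT[OF f \<open>s > 0\<close> inS])
  obtain a' b' where ab': "0 < a'" "a' < s" "0 < b'" "b' < s"
    "f (x + s *\<^sub>R v + s *\<^sub>R u) - f (x + s *\<^sub>R v) - f (x + s *\<^sub>R u) + f x =
     s * (s * P v u (x + a' *\<^sub>R v + b' *\<^sub>R u))"
    unfolding P_def by (rule mixed_difference_MVT[OF f \<open>s > 0\<close> inS'])
  have eq: "x + s *\<^sub>R v + s *\<^sub>R u = x + s *\<^sub>R u + s *\<^sub>R v"
    by (simp add: algebra_simps)
  have "s * (s * P u v (x + a *\<^sub>R u + b *\<^sub>R v)) = s * (s * P v u (x + a' *\<^sub>R v + b' *\<^sub>R u))"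
    using ab(5) ab'(5)[unfolded eq] by linarith
  then have "P u v (x + a *\<^sub>R u + b *\<^sub>R v) = P v u (x + a' *\<^sub>R v + b' *\<^sub>R u)"
    using \<open>s > 0\<close> by simp
  moreover have "dist (P u v (x + a *\<^sub>R u + b *\<^sub>R v)) (P u v x) < \<epsilon>"
    using d1(2) near[of a b] ab by (simp add: d_def)
  moreover have "dist (P v u (x + a' *\<^sub>R v + b' *\<^sub>R u)) (P v u x) < \<epsilon>"
    using d2(2) near[of b' a'] ab' by (simp add: d_def algebra_simps)
  ultimately show False
    by (simp add: \<epsilon>_def dist_real_def abs_if split: if_splits)
qed

text \<open>Taking the inner product with a basis vector commutes with both differentiations, which
  reduces the claim to real-valued functions.\<close>

lemma second_derivative_symmetric:
  fixes f :: "'a::real_normed_vector \<Rightarrow> 'b::euclidean_space"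
  assumes f: "smooth_on S f" and "open S" "x \<in> S"
  shows "frechet_derivative (\<lambda>y. frechet_derivative f (at y) u) (at x) v =
    frechet_derivative (\<lambda>y. frechet_derivative f (at y) v) (at x) u"
proof (rule euclidean_eqI)
  fix b :: 'b assume "b \<in> Basis"
  have comp: "frechet_derivative (\<lambda>y. g y \<bullet> b) (at y) w = frechet_derivative g (at y) w \<bullet> b"
    if "smooth_on S g" "y \<in> S" for g :: "'a \<Rightarrow> 'b" and y w
    using frechet_derivative_at[OF bounded_linear.has_derivative[OF bounded_linear_inner_left
          smooth_on_has_derivative[OF that]]] by metis
  have sm: "smooth_on S (\<lambda>y. f y \<bullet> b)"
    by (intro smooth_on_inner f smooth_on_const assms(2))
  have "frechet_derivative (\<lambda>y. frechet_derivative f (at y) u) (at x) v \<bullet> b =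
      frechet_derivative (\<lambda>y. frechet_derivative (\<lambda>y. f y \<bullet> b) (at y) u) (at x) v" for u v
  proof -
    have "frechet_derivative (\<lambda>y. frechet_derivative f (at y) u \<bullet> b) (at x) =
        frechet_derivative (\<lambda>y. frechet_derivative (\<lambda>y. f y \<bullet> b) (at y) u) (at x)"
      by (rule frechet_derivative_transform_within_open[OF _ assms(2,3)])
        (auto simp: comp[OF f] intro!: smooth_on_differentiable[OF _ assms(3)] smooth_on_inner
          smooth_on_deriv f smooth_on_const assms(2))
    then show ?thesis using comp[OF smooth_on_deriv[OF f] assms(3)] by metis
  qed
  then show "frechet_derivative (\<lambda>y. frechet_derivative f (at y) u) (at x) v \<bullet> b =
      frechet_derivative (\<lambda>y. frechet_derivative f (at y) v) (at x) u \<bullet> b"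
    using real_second_derivative_symmetric[OF smooth_onD[OF sm] assms(2,3)] by simp
qed

section \<open>Smooth orthonormal frames\<close>

definition inner_form :: "('a::real_vector \<Rightarrow> 'a \<Rightarrow> real) \<Rightarrow> bool" where
  "inner_form g \<longleftrightarrow> bilinear g \<and> (\<forall>u v. g u v = g v u) \<and> (\<forall>u. u \<noteq> 0 \<longrightarrow> g u u > 0)"

lemma inner_form_bilinear: "inner_form g \<Longrightarrow> bilinear g"
  and inner_form_commute: "inner_form g \<Longrightarrow> g u v = g v u"
  and inner_form_pos: "inner_form g \<Longrightarrow> u \<noteq> 0 \<Longrightarrow> g u u > 0"
  by (auto simp: inner_form_def)

lemma bilinear_linear_left: "bilinear h \<Longrightarrow> linear (\<lambda>u. h u v)"
  and bilinear_linear_right: "bilinear h \<Longrightarrow> linear (h u)"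
  by (auto simp: bilinear_def)

lemma bilinear_sum_left:
  assumes "bilinear h"
  shows "h (\<Sum>i\<in>I. f i) v = (\<Sum>i\<in>I. h (f i) v)"
  using linear_sum[OF bilinear_linear_left[OF assms]] .

lemma inner_form_eqI:
  assumes "inner_form g" "\<And>v. g u v = g u' v"
  shows "u = u'"
proof (rule ccontr)
  assume "u \<noteq> u'"
  then have "g (u - u') (u - u') > 0" using inner_form_pos[OF assms(1)] by simp
  then show False
    by (simp add: bilinear_lsub[OF inner_form_bilinear[OF assms(1)]] assms(2))
qed

text \<open>\<open>L\<close> is the operator that represents \<open>g\<close> by the Euclidean
  product: \<open>g v u = L v \<bullet> u\<close>. Definiteness makes it injective, hence
  surjective, and a preimage of the coefficient vector of \<open>K\<close> is the representing
  vector.\<close>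

lemma inner_form_riesz:
  fixes g :: "'a::euclidean_space \<Rightarrow> 'a \<Rightarrow> real"
  assumes g: "inner_form g" and K: "linear K"
  obtains r where "\<And>v. g r v = K v"
proof -
  note bl = inner_form_bilinear[OF g]
  define L where "L v = (\<Sum>b\<in>Basis. g v b *\<^sub>R b)" for v
  have lin: "linear L"
    by (rule linearI)
      (simp_all add: L_def bilinear_ladd[OF bl] bilinear_lmul[OF bl] sum.distrib scaleR_sum_right
        scaleR_add_left)
  have comp: "L v \<bullet> b = g v b" if "b \<in> Basis" for v b
    using that by (simp add: L_def inner_sum_left inner_Basis if_distrib cong: if_cong)
  have gL: "g v u = L v \<bullet> u" for v u
  proof -
    have "g v u = (\<Sum>b\<in>Basis. (u \<bullet> b) *\<^sub>R g v b)"
      by (rule linear_sum_Basis[OF bilinear_linear_right[OF bl]])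
    also have "\<dots> = L v \<bullet> u"
      by (simp add: euclidean_inner[of "L v" u] comp mult.commute)
    finally show ?thesis .
  qed
  have "inj L"
    by (rule linear_injective_0[OF lin, THEN iffD2]) (metis gL inner_form_pos[OF g] inner_zero_left less_irrefl)
  then have "surj L" using linear_injective_imp_surjective[OF lin] by simp
  then obtain r where r: "L r = (\<Sum>b\<in>Basis. K b *\<^sub>R b)" by (metis surjD)
  have "g r v = K v" for v
    unfolding gL r
    by (subst linear_sum_Basis[OF K, of v]) (simp add: inner_sum_left inner_commute[of v] mult.commute)
  then show ?thesis by (rule that)
qed

definition smooth_family :: "'a::real_normed_vector set \<Rightarrow> ('a \<Rightarrow> 'b \<Rightarrow> 'c \<Rightarrow> 'd::real_normed_vector) \<Rightarrow> bool" where
  "smooth_family S B \<longleftrightarrow> (\<forall>u v. smooth_on S (\<lambda>x. B x u v))"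

text \<open>A frame is an unindexed set of fields, so the Kronecker delta compares fields as
  functions: two different members must be orthogonal at every point of \<open>S\<close>.\<close>

definition orthonormal_on :: "'a set \<Rightarrow> ('a \<Rightarrow> 'b \<Rightarrow> 'b \<Rightarrow> real) \<Rightarrow> ('a \<Rightarrow> 'b) set \<Rightarrow> bool" where
  "orthonormal_on S B \<E> \<longleftrightarrow> (\<forall>x\<in>S. \<forall>E\<in>\<E>. \<forall>E'\<in>\<E>. B x (E x) (E' x) = (if E = E' then 1 else 0))"

text \<open>The new member is the normalised component of \<open>V\<close> orthogonal to the frame.
  As this component never vanishes on \<open>S\<close>, the square root and the reciprocal stay
  smooth. \<open>E \<notin> \<E>\<close> is claimed under \<open>x \<in> S\<close>, since it is read
  off from the values at a point.\<close>

lemma Gram_Schmidt_step: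
  fixes B :: "'a::real_normed_vector \<Rightarrow> 'b::euclidean_space \<Rightarrow> 'b \<Rightarrow> real"
  assumes S: "open S" and B: "\<And>x. x \<in> S \<Longrightarrow> inner_form (B x)" and sB: "smooth_family S B"
    and \<E>: "finite \<E>" "\<And>E. E \<in> \<E> \<Longrightarrow> smooth_on S E" "orthonormal_on S B \<E>" and V: "smooth_on S V"
    and notin: "\<And>x. x \<in> S \<Longrightarrow> V x \<notin> span ((\<lambda>E. E x) ` \<E>)"
  obtains E where "smooth_on S E" "orthonormal_on S B (insert E \<E>)"
    "\<And>x. x \<in> S \<Longrightarrow> E \<notin> \<E> \<and> span (insert (E x) ((\<lambda>E. E x) ` \<E>)) = span (insert (V x) ((\<lambda>E. E x) ` \<E>))"
proof -
  define m where "m x = V x - (\<Sum>E\<in>\<E>. B x (V x) (E x) *\<^sub>R E x)" for x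
  define n where "n x = inverse (sqrt (B x (m x) (m x))) *\<^sub>R m x" for x
  note bl = inner_form_bilinear[OF B]
  have sBs: "smooth_on S (\<lambda>x. B x (P x) (Q x))" if "smooth_on S P" "smooth_on S Q" for P Q
    by (rule smooth_on_bilinear_family[OF S bl _ that]) (use sB in \<open>auto simp: smooth_family_def\<close>)
  have sm: "smooth_on S m"
    unfolding m_def by (intro smooth_on_diff S V smooth_on_sum smooth_on_scaleR sBs \<E>(2))
  have proj: "(\<Sum>E\<in>\<E>. B x (V x) (E x) *\<^sub>R E x) \<in> span ((\<lambda>E. E x) ` \<E>)" for x
    by (intro span_sum span_scale span_base) auto
  have m0: "m x \<noteq> 0" if "x \<in> S" for x
    using notin[OF that] proj[of x] by (auto simp: m_def)
  then have mpos: "B x (m x) (m x) > 0" if "x \<in> S" for x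
    using inner_form_pos[OF B[OF that]] that by blast
  have sn: "smooth_on S n"
    unfolding n_def
    by (intro smooth_on_scaleR smooth_on_inverse smooth_on_sqrt sBs sm S) (use mpos in force)+
  have mE: "B x (m x) (E x) = 0" if "x \<in> S" "E \<in> \<E>" for x E
  proof -
    have "B x (\<Sum>E'\<in>\<E>. B x (V x) (E' x) *\<^sub>R E' x) (E x) = (\<Sum>E'\<in>\<E>. B x (V x) (E' x) * B x (E' x) (E x))"
      using bl[OF that(1)] by (simp add: bilinear_sum_left bilinear_lmul)
    also have "\<dots> = (\<Sum>E'\<in>\<E>. if E' = E then B x (V x) (E' x) else 0)"
      by (rule sum.cong) (use \<E>(3) that in \<open>auto simp: orthonormal_on_def\<close>)
    also have "\<dots> = B x (V x) (E x)"
      using that \<E>(1) by simp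
    finally show ?thesis by (simp add: m_def bilinear_lsub[OF bl[OF that(1)]])
  qed
  have nE: "B x (n x) (E x) = 0" "B x (E x) (n x) = 0" if "x \<in> S" "E \<in> \<E>" for x E
    using mE[OF that] inner_form_commute[OF B[OF that(1)], of "E x"]
    by (simp_all add: n_def bilinear_lmul[OF bl[OF that(1)]])
  have nn: "B x (n x) (n x) = 1" if "x \<in> S" for x
    using mpos[OF that]
    by (simp add: n_def bilinear_lmul[OF bl[OF that]] bilinear_rmul[OF bl[OF that]] divide_simps)
  have notin: "n \<notin> \<E>" if "x \<in> S" for x
    using nn[OF that] nE[OF that, of n] by auto
  have on: "orthonormal_on S B (insert n \<E>)"
    using \<E>(3) nn nE notin by (auto simp: orthonormal_on_def)
  have spn: "span (insert (n x) ((\<lambda>E. E x) ` \<E>)) = span (insert (V x) ((\<lambda>E. E x) ` \<E>))" if "x \<in> S" for x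
  proof -
    have span_E: "(\<Sum>E\<in>\<E>. B x (V x) (E x) *\<^sub>R E x) \<in> span (insert w ((\<lambda>E. E x) ` \<E>))" for w
      using proj[of x] span_mono[of "(\<lambda>E. E x) ` \<E>" "insert w ((\<lambda>E. E x) ` \<E>)"] by auto
    have "m x = sqrt (B x (m x) (m x)) *\<^sub>R n x"
      using mpos[OF that] by (simp add: n_def)
    then have "m x \<in> span (insert (n x) ((\<lambda>E. E x) ` \<E>))"
      by (metis insertI1 span_base span_scale)
    then have "V x \<in> span (insert (n x) ((\<lambda>E. E x) ` \<E>))"
      using span_add[OF _ span_E] by (fastforce simp: m_def)
    moreover have "n x \<in> span (insert (V x) ((\<lambda>E. E x) ` \<E>))"
      unfolding n_def m_def by (intro span_scale span_diff span_E span_base) simp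
    ultimately show ?thesis
      by (auto simp: span_eq intro: span_base)
  qed
  show ?thesis using that[OF sn on] spn notin by blast
qed

text \<open>Induction over the given fields. Keeping the spans equal is what turns independence of
  the fields into the hypothesis \<open>notin\<close> of the next Gram-Schmidt step.\<close>

lemma smooth_orthonormal_frame:
  fixes B :: "'a::real_normed_vector \<Rightarrow> 'b::euclidean_space \<Rightarrow> 'b \<Rightarrow> real"
  assumes S: "open S" and B: "\<And>x. x \<in> S \<Longrightarrow> inner_form (B x)" and sB: "smooth_family S B"
    and "finite \<V>" "\<And>V. V \<in> \<V> \<Longrightarrow> smooth_on S V"
    and "\<And>x. x \<in> S \<Longrightarrow> inj_on (\<lambda>V. V x) \<V> \<and> independent ((\<lambda>V. V x) ` \<V>)"
  shows "\<exists>\<E>. finite \<E> \<and> (\<forall>E\<in>\<E>. smooth_on S E) \<and> orthonormal_on S B \<E> \<and>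
    (\<forall>x\<in>S. span ((\<lambda>E. E x) ` \<E>) = span ((\<lambda>V. V x) ` \<V>))"
  using assms(4-)
proof (induction \<V> rule: finite_induct)
  case empty
  then show ?case by (intro exI[of _ "{}"]) (simp add: orthonormal_on_def)
next
  case (insert V \<V>)
  have ind: "inj_on (\<lambda>V. V x) \<V> \<and> independent ((\<lambda>V. V x) ` \<V>)"
    "V x \<notin> span ((\<lambda>V. V x) ` \<V>)" if "x \<in> S" for x
  proof -
    have i: "inj_on (\<lambda>V. V x) (insert V \<V>)" "independent (insert (V x) ((\<lambda>V. V x) ` \<V>))"
      using insert.prems(2)[OF that] by simp_all
    have "V x \<notin> (\<lambda>V. V x) ` \<V>"
      using i(1) insert.hyps(2) by (simp add: inj_on_insert)
    then show "inj_on (\<lambda>V. V x) \<V> \<and> independent ((\<lambda>V. V x) ` \<V>)" "V x \<notin> span ((\<lambda>V. V x) ` \<V>)"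
      using i by (simp_all add: independent_insert inj_on_insert)
  qed
  obtain \<E> where \<E>: "finite \<E>" "\<And>E. E \<in> \<E> \<Longrightarrow> smooth_on S E" "orthonormal_on S B \<E>"
    "\<And>x. x \<in> S \<Longrightarrow> span ((\<lambda>E. E x) ` \<E>) = span ((\<lambda>V. V x) ` \<V>)"
    using insert.IH[OF _ ind(1)] insert.prems(1) by auto
  obtain E where E: "smooth_on S E" "orthonormal_on S B (insert E \<E>)"
    "\<And>x. x \<in> S \<Longrightarrow> E \<notin> \<E> \<and> span (insert (E x) ((\<lambda>E. E x) ` \<E>)) = span (insert (V x) ((\<lambda>E. E x) ` \<E>))"
    using Gram_Schmidt_step[OF S B sB \<E>(1-3), of V] insert.prems(1) ind(2) \<E>(4) by auto
  show ?case
  proof (intro exI[of _ "insert E \<E>"] conjI ballI)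
    fix x assume x: "x \<in> S"
    show "span ((\<lambda>E. E x) ` insert E \<E>) = span ((\<lambda>V. V x) ` insert V \<V>)"
      using E(3)[OF x] \<E>(4)[OF x] by (simp add: span_insert)
  qed (use \<E> E in auto)
qed

text \<open>In an orthonormal frame the representing vector is the sum of the members
  \<open>E\<close> with the smooth coefficients \<open>K x (E x)\<close>. This replaces the
  inversion of the metric matrix in the proof that Christoffel symbols are smooth.\<close>

lemma smooth_on_riesz:
  fixes B :: "'a::real_normed_vector \<Rightarrow> 'b::euclidean_space \<Rightarrow> 'b \<Rightarrow> real"
  assumes S: "open S" and B: "\<And>x. x \<in> S \<Longrightarrow> inner_form (B x)" and sB: "smooth_family S B"
    and K: "\<And>x. x \<in> S \<Longrightarrow> linear (K x)" "\<And>v. smooth_on S (\<lambda>x. K x v)"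
    and r: "\<And>x v. x \<in> S \<Longrightarrow> B x (r x) v = K x v"
  shows "smooth_on S r"
proof -
  define \<V> :: "('a \<Rightarrow> 'b) set" where "\<V> = (\<lambda>b _. b) ` Basis"
  have ev: "(\<lambda>V. V x) ` \<V> = Basis" for x by (simp add: \<V>_def image_image)
  have "\<exists>\<E>. finite \<E> \<and> (\<forall>E\<in>\<E>. smooth_on S E) \<and> orthonormal_on S B \<E> \<and>
    (\<forall>x\<in>S. span ((\<lambda>E. E x) ` \<E>) = span ((\<lambda>V. V x) ` \<V>))"
    by (rule smooth_orthonormal_frame[OF S B sB])
      (unfold ev, auto simp: \<V>_def inj_on_def independent_Basis intro: smooth_on_const S)
  then obtain \<E> where \<E>: "finite \<E>" "\<And>E. E \<in> \<E> \<Longrightarrow> smooth_on S E" "orthonormal_on S B \<E>"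
    "\<And>x. x \<in> S \<Longrightarrow> span ((\<lambda>E. E x) ` \<E>) = UNIV"
    unfolding ev by (auto simp: span_Basis)
  show ?thesis
  proof (rule smooth_on_cong[OF S])
    show "smooth_on S (\<lambda>x. \<Sum>E\<in>\<E>. K x (E x) *\<^sub>R E x)"
      by (intro smooth_on_sum smooth_on_scaleR S smooth_on_linear_family[OF S K] \<E>)
    fix x assume x: "x \<in> S"
    note bl = inner_form_bilinear[OF B[OF x]]
    let ?s = "\<Sum>E\<in>\<E>. K x (E x) *\<^sub>R E x"
    have "B x ?s (E x) = K x (E x)" if "E \<in> \<E>" for E
    proof -
      have "B x ?s (E x) = (\<Sum>E'\<in>\<E>. K x (E' x) * B x (E' x) (E x))"
        using bl by (simp add: bilinear_sum_left bilinear_lmul)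
      also have "\<dots> = (\<Sum>E'\<in>\<E>. if E' = E then K x (E' x) else 0)"
        by (rule sum.cong) (use \<E>(3) that x in \<open>auto simp: orthonormal_on_def\<close>)
      also have "\<dots> = K x (E x)" using that \<E>(1) by simp
      finally show ?thesis .
    qed
    then have "B x ?s v = K x v" for v
      using linear_eq_on_span[OF bilinear_linear_right[OF bl] K(1)[OF x], of "(\<lambda>E. E x) ` \<E>" _ v]
        \<E>(4)[OF x] by auto
    then show "?s = r x"
      using inner_form_eqI[OF B[OF x]] r[OF x] by simp
  qed
qed

section \<open>Differentiating families of linear and bilinear maps\<close>

lemma frechet_derivative_eqI: "(f has_derivative f') (at x) \<Longrightarrow> frechet_derivative f (at x) = f'"
  using frechet_derivative_at by metis

lemma linear_frechet_family:
  fixes L :: "'a::real_normed_vector \<Rightarrow> 'b::real_vector \<Rightarrow> 'c::real_normed_vector"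
  assumes Z: "open Z" "z \<in> Z" and L: "\<And>y. y \<in> Z \<Longrightarrow> linear (L y)"
    and d: "\<And>u. (\<lambda>y. L y u) differentiable at z"
  shows "linear (\<lambda>u. frechet_derivative (\<lambda>y. L y u) (at z) w)"
proof (rule linearI)
  note D = frechet_derivative_works[THEN iffD1, OF d]
  fix u v c
  have "((\<lambda>y. L y (u + v)) has_derivative
      (\<lambda>w. frechet_derivative (\<lambda>y. L y u) (at z) w + frechet_derivative (\<lambda>y. L y v) (at z) w)) (at z)"
    by (rule has_derivative_transform_within_open[OF has_derivative_add[OF D D] Z])
      (simp add: linear_add[OF L])
  then show "frechet_derivative (\<lambda>y. L y (u + v)) (at z) w =
      frechet_derivative (\<lambda>y. L y u) (at z) w + frechet_derivative (\<lambda>y. L y v) (at z) w"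
    by (simp add: frechet_derivative_eqI)
  have "((\<lambda>y. L y (c *\<^sub>R u)) has_derivative (\<lambda>w. c *\<^sub>R frechet_derivative (\<lambda>y. L y u) (at z) w)) (at z)"
    by (rule has_derivative_transform_within_open[OF has_derivative_scaleR_right[OF D] Z])
      (simp add: linear_scale[OF L])
  then show "frechet_derivative (\<lambda>y. L y (c *\<^sub>R u)) (at z) w = c *\<^sub>R frechet_derivative (\<lambda>y. L y u) (at z) w"
    by (simp add: frechet_derivative_eqI)
qed

text \<open>Product rule for an operator at a moving point applied to a moving vector.
  Differentiability is assumed of \<open>y \<mapsto> L y u\<close> for fixed \<open>u\<close> only,
  so the vector is expanded in the standard basis.\<close>

lemma has_derivative_linear_family:
  fixes L :: "'a::real_normed_vector \<Rightarrow> 'b::euclidean_space \<Rightarrow> 'c::real_normed_vector"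
  assumes Z: "open Z" "\<phi> x \<in> Z" and L: "\<And>y. y \<in> Z \<Longrightarrow> linear (L y)"
    and d: "\<And>u. (\<lambda>y. L y u) differentiable at (\<phi> x)"
    and \<phi>: "(\<phi> has_derivative \<phi>') (at x)" and P: "(P has_derivative P') (at x)"
  shows "((\<lambda>x. L (\<phi> x) (P x)) has_derivative
    (\<lambda>h. frechet_derivative (\<lambda>y. L y (P x)) (at (\<phi> x)) (\<phi>' h) + L (\<phi> x) (P' h))) (at x)"
proof (rule has_derivative_transform_eventually)
  note D = frechet_derivative_works[THEN iffD1, OF d]
  have "((\<lambda>x. L (\<phi> x) u) has_derivative (\<lambda>h. frechet_derivative (\<lambda>y. L y u) (at (\<phi> x)) (\<phi>' h))) (at x)" for u
    using diff_chain_at[OF \<phi> D[of u]] by (simp add: o_def)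
  then have "((\<lambda>x. \<Sum>b\<in>Basis. (P x \<bullet> b) *\<^sub>R L (\<phi> x) b) has_derivative
      (\<lambda>h. \<Sum>b\<in>Basis. (P x \<bullet> b) *\<^sub>R frechet_derivative (\<lambda>y. L y b) (at (\<phi> x)) (\<phi>' h) + (P' h \<bullet> b) *\<^sub>R L (\<phi> x) b)) (at x)"
    by (intro has_derivative_sum has_derivative_scaleR has_derivative_inner_left P)
  also have "(\<lambda>h. \<Sum>b\<in>Basis. (P x \<bullet> b) *\<^sub>R frechet_derivative (\<lambda>y. L y b) (at (\<phi> x)) (\<phi>' h) + (P' h \<bullet> b) *\<^sub>R L (\<phi> x) b)
      = (\<lambda>h. frechet_derivative (\<lambda>y. L y (P x)) (at (\<phi> x)) (\<phi>' h) + L (\<phi> x) (P' h))"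
  proof
    fix h
    have "linear (\<lambda>u. frechet_derivative (\<lambda>y. L y u) (at (\<phi> x)) (\<phi>' h))"
      by (rule linear_frechet_family[OF Z L d])
    from linear_sum_Basis[OF this, of "P x"] linear_sum_Basis[OF L[OF Z(2)], of "P' h"]
    show "(\<Sum>b\<in>Basis. (P x \<bullet> b) *\<^sub>R frechet_derivative (\<lambda>y. L y b) (at (\<phi> x)) (\<phi>' h) + (P' h \<bullet> b) *\<^sub>R L (\<phi> x) b)
      = frechet_derivative (\<lambda>y. L y (P x)) (at (\<phi> x)) (\<phi>' h) + L (\<phi> x) (P' h)"
      by (simp only: sum.distrib)
  qed
  finally show "((\<lambda>x. \<Sum>b\<in>Basis. (P x \<bullet> b) *\<^sub>R L (\<phi> x) b) has_derivative
    (\<lambda>h. frechet_derivative (\<lambda>y. L y (P x)) (at (\<phi> x)) (\<phi>' h) + L (\<phi> x) (P' h))) (at x)" .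
  \<comment> \<open>Linearity holds on \<open>Z\<close>, so the expansion is valid near
    \<open>x\<close>, where continuity keeps \<open>\<phi>\<close> inside the open set
    \<open>Z\<close>.\<close>
  have "(\<phi> \<longlongrightarrow> \<phi> x) (at x)"
    using has_derivative_continuous[OF \<phi>] by (simp add: continuous_within)
  then have "eventually (\<lambda>x. \<phi> x \<in> Z) (at x)"
    using Z by (rule topological_tendstoD)
  then show "\<forall>\<^sub>F x in at x. (\<Sum>b\<in>Basis. (P x \<bullet> b) *\<^sub>R L (\<phi> x) b) = L (\<phi> x) (P x)"
    by eventually_elim (simp add: linear_sum_Basis[OF L, symmetric])
  show "(\<Sum>b\<in>Basis. (P x \<bullet> b) *\<^sub>R L (\<phi> x) b) = L (\<phi> x) (P x)"
    by (simp add: linear_sum_Basis[OF L, symmetric] Z)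
qed simp

text \<open>The linear case covers the base point and the first argument; expanding the second
  argument in the basis adds the third term.\<close>

lemma has_derivative_bilinear_family:
  fixes B :: "'a::real_normed_vector \<Rightarrow> 'b::euclidean_space \<Rightarrow> 'd::euclidean_space \<Rightarrow> 'c::real_normed_vector"
  assumes Z: "open Z" "\<phi> x \<in> Z" and B: "\<And>y. y \<in> Z \<Longrightarrow> bilinear (B y)"
    and d: "\<And>u v. (\<lambda>y. B y u v) differentiable at (\<phi> x)"
    and \<phi>: "(\<phi> has_derivative \<phi>') (at x)" and P: "(P has_derivative P') (at x)"
    and Q: "(Q has_derivative Q') (at x)"
  shows "((\<lambda>x. B (\<phi> x) (P x) (Q x)) has_derivative
    (\<lambda>h. frechet_derivative (\<lambda>y. B y (P x) (Q x)) (at (\<phi> x)) (\<phi>' h) +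
      B (\<phi> x) (P' h) (Q x) + B (\<phi> x) (P x) (Q' h))) (at x)"
proof (rule has_derivative_transform_eventually)
  note D = frechet_derivative_works[THEN iffD1, OF d]
  have lB: "\<And>y. y \<in> Z \<Longrightarrow> linear (\<lambda>u. B y u v)" for v by (rule bilinear_linear_left[OF B])
  have 1: "((\<lambda>x. B (\<phi> x) (P x) v) has_derivative
    (\<lambda>h. frechet_derivative (\<lambda>y. B y (P x) v) (at (\<phi> x)) (\<phi>' h) + B (\<phi> x) (P' h) v)) (at x)" for v
    by (rule has_derivative_linear_family[where L = "\<lambda>y u. B y u v", OF Z lB d \<phi> P])
  have "((\<lambda>x. \<Sum>b\<in>Basis. (Q x \<bullet> b) *\<^sub>R B (\<phi> x) (P x) b) has_derivative
      (\<lambda>h. \<Sum>b\<in>Basis. (Q x \<bullet> b) *\<^sub>R (frechet_derivative (\<lambda>y. B y (P x) b) (at (\<phi> x)) (\<phi>' h) + B (\<phi> x) (P' h) b)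
        + (Q' h \<bullet> b) *\<^sub>R B (\<phi> x) (P x) b)) (at x)"
    by (intro has_derivative_sum has_derivative_scaleR has_derivative_inner_left 1 Q)
  also have "(\<lambda>h. \<Sum>b\<in>Basis. (Q x \<bullet> b) *\<^sub>R (frechet_derivative (\<lambda>y. B y (P x) b) (at (\<phi> x)) (\<phi>' h) + B (\<phi> x) (P' h) b)
        + (Q' h \<bullet> b) *\<^sub>R B (\<phi> x) (P x) b)
    = (\<lambda>h. frechet_derivative (\<lambda>y. B y (P x) (Q x)) (at (\<phi> x)) (\<phi>' h) +
      B (\<phi> x) (P' h) (Q x) + B (\<phi> x) (P x) (Q' h))"
  proof
    fix h
    have "linear (\<lambda>v. frechet_derivative (\<lambda>y. B y (P x) v) (at (\<phi> x)) (\<phi>' h))"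
      by (rule linear_frechet_family[OF Z]) (auto intro: bilinear_linear_right[OF B] d)
    from linear_sum_Basis[OF this, of "Q x"] linear_sum_Basis[OF bilinear_linear_right[OF B[OF Z(2)]], where u = "Q x"]
      linear_sum_Basis[OF bilinear_linear_right[OF B[OF Z(2)]], where u = "Q' h"]
    show "(\<Sum>b\<in>Basis. (Q x \<bullet> b) *\<^sub>R (frechet_derivative (\<lambda>y. B y (P x) b) (at (\<phi> x)) (\<phi>' h) + B (\<phi> x) (P' h) b)
        + (Q' h \<bullet> b) *\<^sub>R B (\<phi> x) (P x) b)
      = frechet_derivative (\<lambda>y. B y (P x) (Q x)) (at (\<phi> x)) (\<phi>' h) +
        B (\<phi> x) (P' h) (Q x) + B (\<phi> x) (P x) (Q' h)"
      by (simp only: sum.distrib scaleR_add_right)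
  qed
  finally show "((\<lambda>x. \<Sum>b\<in>Basis. (Q x \<bullet> b) *\<^sub>R B (\<phi> x) (P x) b) has_derivative
    (\<lambda>h. frechet_derivative (\<lambda>y. B y (P x) (Q x)) (at (\<phi> x)) (\<phi>' h) +
      B (\<phi> x) (P' h) (Q x) + B (\<phi> x) (P x) (Q' h))) (at x)" .
  have "(\<phi> \<longlongrightarrow> \<phi> x) (at x)"
    using has_derivative_continuous[OF \<phi>] by (simp add: continuous_within)
  then have "eventually (\<lambda>x. \<phi> x \<in> Z) (at x)"
    using Z by (rule topological_tendstoD)
  then show "\<forall>\<^sub>F x in at x. (\<Sum>b\<in>Basis. (Q x \<bullet> b) *\<^sub>R B (\<phi> x) (P x) b) = B (\<phi> x) (P x) (Q x)"
    by eventually_elim (simp add: linear_sum_Basis[OF bilinear_linear_right[OF B], symmetric])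
  show "(\<Sum>b\<in>Basis. (Q x \<bullet> b) *\<^sub>R B (\<phi> x) (P x) b) = B (\<phi> x) (P x) (Q x)"
    by (simp add: linear_sum_Basis[OF bilinear_linear_right[OF B], symmetric] Z)
qed simp

section \<open>Connections and curvature in a coordinate domain\<close>

text \<open>A condition on one bilinear map at the single point \<open>z\<close>, worded like the
  body of \<open>levi_civita\<close> read in a chart, so that the two notions agree by
  unfolding.\<close>

definition metric_compatible ::
  "('a::real_normed_vector \<Rightarrow> 'a \<Rightarrow> 'a \<Rightarrow> real) \<Rightarrow> 'a \<Rightarrow> ('a \<Rightarrow> 'a \<Rightarrow> 'a) \<Rightarrow> bool" where
  "metric_compatible g z \<Gamma> \<longleftrightarrow> bilinear \<Gamma> \<and> (\<forall>u v. \<Gamma> u v = \<Gamma> v u) \<and>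
     (\<forall>u v w. frechet_derivative (\<lambda>y. g y u v) (at z) w = g z (\<Gamma> w u) v + g z u (\<Gamma> w v))"

definition christoffel :: "('a::real_normed_vector \<Rightarrow> 'a \<Rightarrow> 'a \<Rightarrow> real) \<Rightarrow> 'a \<Rightarrow> 'a \<Rightarrow> 'a \<Rightarrow> 'a" where
  "christoffel g z = (THE \<Gamma>. metric_compatible g z \<Gamma>)"

text \<open>After six alternating transpositions, three of each kind, the arguments are back in
  place and the sign has changed three times.\<close>

lemma symmetric_skew_eq_0:
  fixes T :: "'a \<Rightarrow> 'a \<Rightarrow> 'a \<Rightarrow> real"
  assumes "\<And>u v w. T u v w = T v u w" "\<And>u v w. T u v w = - T u w v"
  shows "T u v w = 0"
proof -
  have "T u v w = - T u v w"
    using assms by metis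
  then show ?thesis by simp
qed

text \<open>The connection pulled back along \<open>\<phi>\<close>, acting on a field
  \<open>P\<close> along \<open>\<phi>\<close>. For \<open>\<phi>\<close> the identity it is the
  usual covariant derivative.\<close>

definition cov ::
  "('b \<Rightarrow> 'b \<Rightarrow> 'b \<Rightarrow> 'b) \<Rightarrow> ('a::real_normed_vector \<Rightarrow> 'b::real_normed_vector) \<Rightarrow> ('a \<Rightarrow> 'b) \<Rightarrow> 'a \<Rightarrow> 'a \<Rightarrow> 'b" where
  "cov \<Gamma> \<phi> P x w = frechet_derivative P (at x) w +
     \<Gamma> (\<phi> x) (frechet_derivative \<phi> (at x) w) (P x)"

definition curv ::
  "('a \<Rightarrow> 'a \<Rightarrow> 'a \<Rightarrow> 'a) \<Rightarrow> 'a::real_normed_vector \<Rightarrow> 'a \<Rightarrow> 'a \<Rightarrow> 'a \<Rightarrow> 'a" where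
  "curv \<Gamma> z u v w = (frechet_derivative (\<lambda>y. \<Gamma> y v w) (at z) u + \<Gamma> z u (\<Gamma> z v w)) -
     (frechet_derivative (\<lambda>y. \<Gamma> y u w) (at z) v + \<Gamma> z v (\<Gamma> z u w))"

section \<open>The Levi-Civita connection in coordinates\<close>

locale metric_domain =
  fixes Z :: "'e::euclidean_space set" and g :: "'e \<Rightarrow> 'e \<Rightarrow> 'e \<Rightarrow> real"
  assumes open_Z: "open Z" and inner: "z \<in> Z \<Longrightarrow> inner_form (g z)" and smooth: "smooth_family Z g"
begin

abbreviation "\<Gamma> \<equiv> christoffel g"

lemma smooth_g: "smooth_on Z (\<lambda>z. g z u v)"
  using smooth by (simp add: smooth_family_def)

lemma g_bilinear: "z \<in> Z \<Longrightarrow> bilinear (g z)"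
  and g_commute: "z \<in> Z \<Longrightarrow> g z u v = g z v u"
  using inner inner_form_bilinear inner_form_commute by blast+

lemma g_differentiable: "z \<in> Z \<Longrightarrow> (\<lambda>z. g z u v) differentiable at z"
  using smooth_on_differentiable[OF smooth_g] .

definition dg :: "'e \<Rightarrow> 'e \<Rightarrow> 'e \<Rightarrow> 'e \<Rightarrow> real" where
  "dg z w u v = frechet_derivative (\<lambda>y. g y u v) (at z) w"

lemma dg_linear:
  assumes "z \<in> Z"
  shows "linear (\<lambda>w. dg z w u v)" "linear (\<lambda>u. dg z w u v)" "linear (\<lambda>v. dg z w u v)"
  unfolding dg_def
  using linear_frechet_derivative[OF g_differentiable[OF assms]]
    linear_frechet_family[OF open_Z assms bilinear_linear_left[OF g_bilinear] g_differentiable[OF assms]]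
    linear_frechet_family[OF open_Z assms bilinear_linear_right[OF g_bilinear] g_differentiable[OF assms]]
  by auto

lemma dg_commute: "z \<in> Z \<Longrightarrow> dg z w u v = dg z w v u"
  unfolding dg_def
  using frechet_derivative_transform_within_open[OF g_differentiable[of z u v] open_Z _ g_commute] by simp

text \<open>Koszul's formula on fields with constant components: their brackets vanish, and only
  derivatives of the metric remain.\<close>

definition koszul :: "'e \<Rightarrow> 'e \<Rightarrow> 'e \<Rightarrow> 'e \<Rightarrow> real" where
  "koszul z w u v = (dg z w u v + dg z u w v - dg z v w u) / 2"

lemma koszul_linear:
  assumes "z \<in> Z"
  shows "linear (\<lambda>w. koszul z w u v)" "linear (\<lambda>u. koszul z w u v)" "linear (\<lambda>v. koszul z w u v)"
  by (rule linearI; simp add: koszul_def linear_add[OF dg_linear(1)[OF assms]] linear_add[OF dg_linear(2)[OF assms]]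
      linear_add[OF dg_linear(3)[OF assms]] linear_scale[OF dg_linear(1)[OF assms]]
      linear_scale[OF dg_linear(2)[OF assms]] linear_scale[OF dg_linear(3)[OF assms]] field_simps)+

text \<open>The difference of two candidates, paired with a third vector, is symmetric in the first
  two arguments by torsion-freeness and skew in the last two by compatibility.\<close>

lemma metric_compatible_unique:
  assumes z: "z \<in> Z" and 1: "metric_compatible g z \<Gamma>1" and 2: "metric_compatible g z \<Gamma>2"
  shows "\<Gamma>1 = \<Gamma>2"
proof (intro ext)
  note bl = bilinear_lsub[OF g_bilinear[OF z]] bilinear_rsub[OF g_bilinear[OF z]]
  fix u v
  have "g z (\<Gamma>1 u v - \<Gamma>2 u v) w = 0" for w
  proof (rule symmetric_skew_eq_0[where T = "\<lambda>u v w. g z (\<Gamma>1 u v - \<Gamma>2 u v) w"])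
    show "g z (\<Gamma>1 u v - \<Gamma>2 u v) w = g z (\<Gamma>1 v u - \<Gamma>2 v u) w" for u v w
      using 1 2 by (metis metric_compatible_def)
    show "g z (\<Gamma>1 u v - \<Gamma>2 u v) w = - g z (\<Gamma>1 u w - \<Gamma>2 u w) v" for u v w
    proof -
      have "g z (\<Gamma>1 u v) w + g z v (\<Gamma>1 u w) = g z (\<Gamma>2 u v) w + g z v (\<Gamma>2 u w)"
        using 1 2 unfolding metric_compatible_def by metis
      then show ?thesis
        by (simp add: bl g_commute[OF z, of v])
    qed
  qed
  then show "\<Gamma>1 u v = \<Gamma>2 u v"
    using inner_form_eqI[OF inner[OF z], of "\<Gamma>1 u v" "\<Gamma>2 u v"] by (simp add: bl)
qed

text \<open>For fixed \<open>w\<close> and \<open>u\<close> the Koszul expression is linear in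
  \<open>v\<close>, and its Riesz representative is the Christoffel symbol. Its properties are read
  off after pairing with an arbitrary vector.\<close>

lemma ex_metric_compatible:
  assumes z: "z \<in> Z"
  obtains \<Gamma>' where "metric_compatible g z \<Gamma>'" "\<And>w u v. g z (\<Gamma>' w u) v = koszul z w u v"
proof -
  have "\<exists>r. \<forall>v. g z r v = koszul z w u v" for w u
    using inner_form_riesz[OF inner[OF z] koszul_linear(3)[OF z]] by metis
  then obtain \<Gamma>' where \<Gamma>': "\<And>w u v. g z (\<Gamma>' w u) v = koszul z w u v"
    by metis
  note eqI = inner_form_eqI[OF inner[OF z]]
  note bl = bilinear_ladd[OF g_bilinear[OF z]] bilinear_lmul[OF g_bilinear[OF z]]
  have "metric_compatible g z \<Gamma>'"
    unfolding metric_compatible_def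
  proof (intro conjI allI)
    show "bilinear \<Gamma>'"
      unfolding bilinear_def
      by (intro conjI allI linearI eqI; simp add: bl \<Gamma>' linear_add[OF koszul_linear(1)[OF z]] linear_add[OF koszul_linear(2)[OF z]]
          linear_scale[OF koszul_linear(1)[OF z]] linear_scale[OF koszul_linear(2)[OF z]])
    show "\<Gamma>' u v = \<Gamma>' v u" for u v
      by (rule eqI) (simp add: \<Gamma>' koszul_def dg_commute[OF z, of _ u v])
    show "frechet_derivative (\<lambda>y. g y u v) (at z) w = g z (\<Gamma>' w u) v + g z u (\<Gamma>' w v)" for u v w
      unfolding g_commute[OF z, of u] \<Gamma>' dg_def[symmetric]
      by (simp add: koszul_def dg_commute[OF z, of _ u v] dg_commute[OF z, of _ u w] dg_commute[OF z, of _ w v]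
          field_simps)
  qed
  then show ?thesis using \<Gamma>' by (rule that)
qed

lemma christoffel_compatible: "z \<in> Z \<Longrightarrow> metric_compatible g z (\<Gamma> z)"
  unfolding christoffel_def
  using ex_metric_compatible metric_compatible_unique by (metis theI)

lemma christoffel_koszul: "z \<in> Z \<Longrightarrow> g z (\<Gamma> z w u) v = koszul z w u v"
  using ex_metric_compatible metric_compatible_unique christoffel_compatible by metis

lemma christoffel_bilinear: "z \<in> Z \<Longrightarrow> bilinear (\<Gamma> z)"
  and christoffel_commute: "z \<in> Z \<Longrightarrow> \<Gamma> z u v = \<Gamma> z v u"
  and christoffel_metric: "z \<in> Z \<Longrightarrow>
    frechet_derivative (\<lambda>y. g y u v) (at z) w = g z (\<Gamma> z w u) v + g z u (\<Gamma> z w v)"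
  using christoffel_compatible unfolding metric_compatible_def by blast+

lemma christoffel_smooth: "smooth_on Z (\<lambda>z. \<Gamma> z w u)"
proof (rule smooth_on_riesz[OF open_Z inner smooth koszul_linear(3) _ christoffel_koszul])
  have "smooth_on Z (\<lambda>z. (dg z w u v + dg z u w v - dg z v w u) * (1/2))" for v
    unfolding dg_def
    by (intro smooth_on_mult smooth_on_diff smooth_on_add smooth_on_const smooth_on_deriv smooth_g open_Z)
  then show "smooth_on Z (\<lambda>z. koszul z w u v)" for v
    by (simp add: koszul_def)
qed

lemma christoffel_differentiable: "z \<in> Z \<Longrightarrow> (\<lambda>z. \<Gamma> z u v) differentiable at z"
  using smooth_on_differentiable[OF christoffel_smooth] .

section \<open>Covariant derivatives along maps, and curvature\<close>

lemma has_derivative_metric_along: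
  assumes x: "\<phi> x \<in> Z" and d: "\<phi> differentiable at x" "P differentiable at x" "Q differentiable at x"
  shows "((\<lambda>x. g (\<phi> x) (P x) (Q x)) has_derivative
    (\<lambda>w. g (\<phi> x) (cov \<Gamma> \<phi> P x w) (Q x) + g (\<phi> x) (P x) (cov \<Gamma> \<phi> Q x w))) (at x)"
proof -
  note D = d[unfolded frechet_derivative_works]
  have "((\<lambda>x. g (\<phi> x) (P x) (Q x)) has_derivative
    (\<lambda>h. frechet_derivative (\<lambda>y. g y (P x) (Q x)) (at (\<phi> x)) (frechet_derivative \<phi> (at x) h) +
      g (\<phi> x) (frechet_derivative P (at x) h) (Q x) + g (\<phi> x) (P x) (frechet_derivative Q (at x) h))) (at x)"
    by (rule has_derivative_bilinear_family[OF open_Z x g_bilinear g_differentiable[OF x] D])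
  then show ?thesis
    by (rule has_derivative_eq_rhs)
      (simp add: fun_eq_iff cov_def christoffel_metric[OF x] bilinear_ladd[OF g_bilinear[OF x]]
        bilinear_radd[OF g_bilinear[OF x]])
qed

lemma cov_has_derivative:
  assumes "open S" "smooth_on S \<phi>" "\<phi> ` S \<subseteq> Z" "smooth_on S P" "x \<in> S"
  shows "((\<lambda>x. cov \<Gamma> \<phi> P x v) has_derivative
    (\<lambda>u. frechet_derivative (\<lambda>x. frechet_derivative P (at x) v) (at x) u +
      (frechet_derivative (\<lambda>y. \<Gamma> y (frechet_derivative \<phi> (at x) v) (P x)) (at (\<phi> x)) (frechet_derivative \<phi> (at x) u) +
      \<Gamma> (\<phi> x) (frechet_derivative (\<lambda>x. frechet_derivative \<phi> (at x) v) (at x) u) (P x) +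
      \<Gamma> (\<phi> x) (frechet_derivative \<phi> (at x) v) (frechet_derivative P (at x) u)))) (at x)"
  unfolding cov_def
  using assms
  by (intro has_derivative_add has_derivative_bilinear_family[OF open_Z] christoffel_bilinear
      christoffel_differentiable smooth_on_has_derivative[OF _ \<open>x \<in> S\<close>] smooth_on_deriv) auto

text \<open>The directions \<open>u\<close> and \<open>v\<close> are constant, so there is no
  bracket term. The second derivatives of \<open>P\<close> and \<open>\<phi>\<close> are symmetric,
  and so is the sum of the products of first derivatives; what survives is the curvature of the
  target.\<close>

lemma cov_commutator:
  assumes S: "open S" "smooth_on S \<phi>" "\<phi> ` S \<subseteq> Z" "smooth_on S P" "x \<in> S"
  shows "cov \<Gamma> \<phi> (\<lambda>x. cov \<Gamma> \<phi> P x v) x u - cov \<Gamma> \<phi> (\<lambda>x. cov \<Gamma> \<phi> P x u) x v =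
    curv \<Gamma> (\<phi> x) (frechet_derivative \<phi> (at x) u) (frechet_derivative \<phi> (at x) v) (P x)"
proof -
  have x: "\<phi> x \<in> Z" using S by auto
  note D = frechet_derivative_eqI[OF cov_has_derivative[OF S]]
  have 1: "cov \<Gamma> \<phi> (\<lambda>x. cov \<Gamma> \<phi> P x v) x u =
      frechet_derivative (\<lambda>x. frechet_derivative P (at x) v) (at x) u +
      frechet_derivative (\<lambda>y. \<Gamma> y (frechet_derivative \<phi> (at x) v) (P x)) (at (\<phi> x)) (frechet_derivative \<phi> (at x) u) +
      \<Gamma> (\<phi> x) (frechet_derivative (\<lambda>x. frechet_derivative \<phi> (at x) v) (at x) u) (P x) +
      \<Gamma> (\<phi> x) (frechet_derivative \<phi> (at x) v) (frechet_derivative P (at x) u) +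
      \<Gamma> (\<phi> x) (frechet_derivative \<phi> (at x) u) (frechet_derivative P (at x) v) +
      \<Gamma> (\<phi> x) (frechet_derivative \<phi> (at x) u) (\<Gamma> (\<phi> x) (frechet_derivative \<phi> (at x) v) (P x))" for u v
    unfolding cov_def[of _ _ "\<lambda>x. cov \<Gamma> \<phi> P x v"] D
    by (simp add: cov_def bilinear_radd[OF christoffel_bilinear[OF x]])
  show ?thesis
    unfolding 1 curv_def
    using second_derivative_symmetric[OF S(4,1,5), of u v] second_derivative_symmetric[OF S(2,1,5), of u v]
    by simp
qed

lemma curv_skew: "curv \<Gamma> z u v w = - curv \<Gamma> z v u w"
  by (simp add: curv_def)

text \<open>Torsion-freeness makes \<open>\<Gamma>\<close> and its derivatives symmetric in the two
  arguments, so that the terms of the cyclic sum cancel in pairs.\<close>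

lemma Bianchi:
  assumes z: "z \<in> Z"
  shows "curv \<Gamma> z u v w + curv \<Gamma> z v w u + curv \<Gamma> z w u v = 0"
proof -
  have "frechet_derivative (\<lambda>y. \<Gamma> y u v) (at z) = frechet_derivative (\<lambda>y. \<Gamma> y v u) (at z)" for u v
    by (rule frechet_derivative_transform_within_open[OF christoffel_differentiable[OF z] open_Z z christoffel_commute])
  from this[of v u] this[of w u] this[of w v] show ?thesis
    by (simp add: curv_def christoffel_commute[OF z, of w u] christoffel_commute[OF z, of w v]
        christoffel_commute[OF z, of v u])
qed

lemma curv_linear:
  assumes z: "z \<in> Z"
  shows "linear (\<lambda>u. curv \<Gamma> z u v w)" "linear (\<lambda>v. curv \<Gamma> z u v w)" "linear (\<lambda>w. curv \<Gamma> z u v w)"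
proof -
  note D = linear_frechet_derivative[OF christoffel_differentiable[OF z]]
  note DL = linear_frechet_family[OF open_Z z bilinear_linear_left[OF christoffel_bilinear]
      christoffel_differentiable[OF z]]
  note DR = linear_frechet_family[OF open_Z z bilinear_linear_right[OF christoffel_bilinear]
      christoffel_differentiable[OF z]]
  note bl = christoffel_bilinear[OF z]
  note simps = curv_def linear_add[OF D] linear_scale[OF D] linear_add[OF DL] linear_scale[OF DL]
    linear_add[OF DR] linear_scale[OF DR] bilinear_ladd[OF bl] bilinear_radd[OF bl]
    bilinear_lmul[OF bl] bilinear_rmul[OF bl] algebra_simps
  show "linear (\<lambda>u. curv \<Gamma> z u v w)" "linear (\<lambda>v. curv \<Gamma> z u v w)" "linear (\<lambda>w. curv \<Gamma> z u v w)"
    by (rule linearI; simp add: simps)+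
qed

text \<open>The function \<open>y \<mapsto> g y a b\<close> has symmetric second derivatives.
  Expressed through \<open>cov\<close>, the difference of the two orders is the curvature acting on
  \<open>a\<close> plus the curvature acting on \<open>b\<close>.\<close>

lemma curv_metric_skew:
  assumes z: "z \<in> Z"
  shows "g z (curv \<Gamma> z u v a) b = - g z a (curv \<Gamma> z u v b)"
proof -
  note bl = g_bilinear[OF z]
  have D: "frechet_derivative (\<lambda>y. frechet_derivative (\<lambda>y. g y a b) (at y) w) (at z) w' =
      g z (cov \<Gamma> (\<lambda>y. y) (\<lambda>y. \<Gamma> y w a) z w') b + g z (\<Gamma> z w a) (\<Gamma> z w' b) +
      (g z (\<Gamma> z w' a) (\<Gamma> z w b) + g z a (cov \<Gamma> (\<lambda>y. y) (\<lambda>y. \<Gamma> y w b) z w'))" for w w'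
  proof -
    have c: "cov \<Gamma> (\<lambda>y. y) (\<lambda>y. c) z w' = \<Gamma> z w' c" for c by (simp add: cov_def)
    have "((\<lambda>y. g y (\<Gamma> y w a) b + g y a (\<Gamma> y w b)) has_derivative
        (\<lambda>w'. (g z (cov \<Gamma> (\<lambda>y. y) (\<lambda>y. \<Gamma> y w a) z w') b + g z (\<Gamma> z w a) (cov \<Gamma> (\<lambda>y. y) (\<lambda>y. b) z w')) +
        (g z (cov \<Gamma> (\<lambda>y. y) (\<lambda>y. a) z w') (\<Gamma> z w b) + g z a (cov \<Gamma> (\<lambda>y. y) (\<lambda>y. \<Gamma> y w b) z w')))) (at z)"
      by (intro has_derivative_add has_derivative_metric_along christoffel_differentiable z) simp_all
    then have "((\<lambda>y. frechet_derivative (\<lambda>y. g y a b) (at y) w) has_derivative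
        (\<lambda>w'. (g z (cov \<Gamma> (\<lambda>y. y) (\<lambda>y. \<Gamma> y w a) z w') b + g z (\<Gamma> z w a) (cov \<Gamma> (\<lambda>y. y) (\<lambda>y. b) z w')) +
        (g z (cov \<Gamma> (\<lambda>y. y) (\<lambda>y. a) z w') (\<Gamma> z w b) + g z a (cov \<Gamma> (\<lambda>y. y) (\<lambda>y. \<Gamma> y w b) z w')))) (at z)"
      by (rule has_derivative_transform_within_open[OF _ open_Z z]) (simp add: christoffel_metric)
    from fun_cong[OF frechet_derivative_eqI[OF this], of w'] show ?thesis
      by (simp add: cov_def)
  qed
  have R: "curv \<Gamma> z u v c = cov \<Gamma> (\<lambda>y. y) (\<lambda>y. \<Gamma> y v c) z u - cov \<Gamma> (\<lambda>y. y) (\<lambda>y. \<Gamma> y u c) z v" for c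
    by (simp add: curv_def cov_def)
  show ?thesis
    using second_derivative_symmetric[OF smooth_g open_Z z, of a b u v] unfolding D R
    by (simp add: bilinear_lsub[OF bl] bilinear_rsub[OF bl])
qed

text \<open>\<open>E\<close>, the failure of the transformation law, is symmetric because second
  derivatives commute and both connections are torsion-free. Differentiating the isometry condition
  makes its pairing with the image of the derivative of \<open>\<tau>\<close> skew, so this pairing
  vanishes; surjectivity then gives \<open>E = 0\<close>.\<close>

lemma christoffel_isometry:
  assumes "metric_domain Z' g'" and S: "open S" "S \<subseteq> Z" "z \<in> S" and \<tau>: "smooth_on S \<tau>" "\<tau> ` S \<subseteq> Z'"
    and iso: "\<And>y u v. y \<in> S \<Longrightarrow>
      g' (\<tau> y) (frechet_derivative \<tau> (at y) u) (frechet_derivative \<tau> (at y) v) = g y u v"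
    and surj: "surj (frechet_derivative \<tau> (at z))"
  shows "frechet_derivative \<tau> (at z) (\<Gamma> z u v) =
    christoffel g' (\<tau> z) (frechet_derivative \<tau> (at z) u) (frechet_derivative \<tau> (at z) v) +
    frechet_derivative (\<lambda>y. frechet_derivative \<tau> (at y) v) (at z) u"
proof -
  interpret B: metric_domain Z' g' by fact
  define T where "T = frechet_derivative \<tau> (at z)"
  have z: "z \<in> Z" and z': "\<tau> z \<in> Z'" using S \<tau> by auto
  define E where "E u v = cov B.\<Gamma> \<tau> (\<lambda>y. frechet_derivative \<tau> (at y) v) z u - T (\<Gamma> z u v)" for u v
  have E_sym: "E u v = E v u" for u v
    using second_derivative_symmetric[OF \<tau>(1) S(1,3), of u v]
      B.christoffel_commute[OF z', of "T u" "T v"] christoffel_commute[OF z, of u v]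
    by (simp add: E_def cov_def T_def)
  have D: "g' (\<tau> z) (cov B.\<Gamma> \<tau> (\<lambda>y. frechet_derivative \<tau> (at y) u) z w) (T v) +
      g' (\<tau> z) (T u) (cov B.\<Gamma> \<tau> (\<lambda>y. frechet_derivative \<tau> (at y) v) z w) =
      g z (\<Gamma> z w u) v + g z u (\<Gamma> z w v)" for u v w
  proof -
    have "((\<lambda>y. g' (\<tau> y) (frechet_derivative \<tau> (at y) u) (frechet_derivative \<tau> (at y) v)) has_derivative
        (\<lambda>w. g' (\<tau> z) (cov B.\<Gamma> \<tau> (\<lambda>y. frechet_derivative \<tau> (at y) u) z w) (frechet_derivative \<tau> (at z) v) +
        g' (\<tau> z) (frechet_derivative \<tau> (at z) u) (cov B.\<Gamma> \<tau> (\<lambda>y. frechet_derivative \<tau> (at y) v) z w))) (at z)"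
      by (intro B.has_derivative_metric_along z' smooth_on_differentiable[OF _ S(3)] smooth_on_deriv \<tau>)
    then have "((\<lambda>y. g y u v) has_derivative
        (\<lambda>w. g' (\<tau> z) (cov B.\<Gamma> \<tau> (\<lambda>y. frechet_derivative \<tau> (at y) u) z w) (frechet_derivative \<tau> (at z) v) +
        g' (\<tau> z) (frechet_derivative \<tau> (at z) u) (cov B.\<Gamma> \<tau> (\<lambda>y. frechet_derivative \<tau> (at y) v) z w))) (at z)"
      by (rule has_derivative_transform_within_open[OF _ S(1,3)]) (simp add: iso)
    from fun_cong[OF frechet_derivative_eqI[OF this], of w] show ?thesis
      by (simp add: christoffel_metric[OF z] T_def)
  qed
  have "g' (\<tau> z) (E u v) (T w) = 0" for w
  proof (rule symmetric_skew_eq_0[where T = "\<lambda>u v w. g' (\<tau> z) (E u v) (T w)"])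
    show "g' (\<tau> z) (E u v) (T w) = g' (\<tau> z) (E v u) (T w)" for u v w by (simp add: E_sym)
    show "g' (\<tau> z) (E u v) (T w) = - g' (\<tau> z) (E u w) (T v)" for u v w
      using D[of v u w] iso[OF S(3), of "\<Gamma> z u v" w, folded T_def]
        iso[OF S(3), of v "\<Gamma> z u w", folded T_def]
      by (simp add: E_def bilinear_lsub[OF B.g_bilinear[OF z']] B.g_commute[OF z', of "T v"])
  qed
  then have "g' (\<tau> z) (E u v) w = g' (\<tau> z) 0 w" for w
    using surj bilinear_lzero[OF B.g_bilinear[OF z']] unfolding T_def by (metis surjD)
  then have "E u v = 0" by (rule inner_form_eqI[OF B.inner[OF z']])
  then show ?thesis by (simp add: E_def cov_def T_def add.commute)
qed

text \<open>The inhomogeneous term in the transformation law of the Christoffel symbols is the one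
  which the product rule produces from the moving derivative of \<open>\<tau>\<close>.\<close>

lemma cov_isometry:
  assumes "metric_domain Z' g'" and S: "open S" "S \<subseteq> Z" "\<phi> x \<in> S" and \<tau>: "smooth_on S \<tau>" "\<tau> ` S \<subseteq> Z'"
    and iso: "\<And>y u v. y \<in> S \<Longrightarrow>
      g' (\<tau> y) (frechet_derivative \<tau> (at y) u) (frechet_derivative \<tau> (at y) v) = g y u v"
    and surj: "surj (frechet_derivative \<tau> (at (\<phi> x)))"
    and d: "\<phi> differentiable at x" "P differentiable at x"
  shows "cov (christoffel g') (\<lambda>x. \<tau> (\<phi> x)) (\<lambda>x. frechet_derivative \<tau> (at (\<phi> x)) (P x)) x w =
    frechet_derivative \<tau> (at (\<phi> x)) (cov \<Gamma> \<phi> P x w)"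
proof -
  note D = d[unfolded frechet_derivative_works]
  have 1: "frechet_derivative (\<lambda>x. \<tau> (\<phi> x)) (at x) w = frechet_derivative \<tau> (at (\<phi> x)) (frechet_derivative \<phi> (at x) w)"
    using frechet_derivative_eqI[OF diff_chain_at[OF D(1) smooth_on_has_derivative[OF \<tau>(1) S(3)]]]
    by (simp add: o_def)
  have lin: "y \<in> S \<Longrightarrow> linear (frechet_derivative \<tau> (at y))" for y
    using linear_frechet_derivative smooth_on_differentiable[OF \<tau>(1)] by blast
  have "((\<lambda>x. frechet_derivative \<tau> (at (\<phi> x)) (P x)) has_derivative
      (\<lambda>w. frechet_derivative (\<lambda>y. frechet_derivative \<tau> (at y) (P x)) (at (\<phi> x)) (frechet_derivative \<phi> (at x) w) +
      frechet_derivative \<tau> (at (\<phi> x)) (frechet_derivative P (at x) w))) (at x)"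
    by (rule has_derivative_linear_family[OF S(1,3) lin _ D])
      (auto intro: smooth_on_differentiable[OF smooth_on_deriv[OF \<tau>(1)] S(3)])
  note 2 = fun_cong[OF frechet_derivative_eqI[OF this], of w]
  show ?thesis
    unfolding cov_def 1 2 linear_add[OF lin[OF S(3)]]
    using christoffel_isometry[OF assms(1-7) surj, of "frechet_derivative \<phi> (at x) w" "P x"] by simp
qed

text \<open>Being constant and commuting with \<open>\<Gamma> y u\<close> on all of
  \<open>Z\<close>, the map \<open>j\<close> also commutes with the derivatives of
  \<open>\<Gamma>\<close>.\<close>

lemma curv_complex_linear:
  assumes z: "z \<in> Z" and j: "bounded_linear j"
    and par: "\<And>y u v. y \<in> Z \<Longrightarrow> \<Gamma> y u (j v) = j (\<Gamma> y u v)"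
  shows "curv \<Gamma> z u v (j w) = j (curv \<Gamma> z u v w)"
proof -
  have "frechet_derivative (\<lambda>y. \<Gamma> y u (j w)) (at z) v = j (frechet_derivative (\<lambda>y. \<Gamma> y u w) (at z) v)" for u v
  proof -
    have "((\<lambda>y. j (\<Gamma> y u w)) has_derivative (\<lambda>v. j (frechet_derivative (\<lambda>y. \<Gamma> y u w) (at z) v))) (at z)"
      by (intro bounded_linear.has_derivative[OF j] christoffel_differentiable[OF z, unfolded frechet_derivative_works])
    then have "((\<lambda>y. \<Gamma> y u (j w)) has_derivative (\<lambda>v. j (frechet_derivative (\<lambda>y. \<Gamma> y u w) (at z) v))) (at z)"
      by (rule has_derivative_transform_within_open[OF _ open_Z z]) (simp add: par)
    then show ?thesis by (simp add: frechet_derivative_eqI)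
  qed
  then show ?thesis
    by (simp add: curv_def par[OF z] linear_add[OF bounded_linear.linear[OF j]]
        linear_diff[OF bounded_linear.linear[OF j]])
qed

end

section \<open>Umbilic hypersurfaces\<close>

text \<open>Each of the four Bianchi identities keeps another argument in the last slot. Combined
  with suitable signs and rewritten by the two skew symmetries, they leave twice the difference of
  the two sides.\<close>

lemma curvature_pair_symmetric:
  fixes Q :: "'a \<Rightarrow> 'a \<Rightarrow> 'a \<Rightarrow> 'a \<Rightarrow> real"
  assumes "\<And>u v w z. Q u v w z = - Q v u w z" "\<And>u v w z. Q u v w z = - Q u v z w"
    and "\<And>u v w z. Q u v w z + Q v w u z + Q w u v z = 0"
  shows "Q u v w z = Q w z u v"
  using assms(3)[of u v w z] assms(3)[of v w z u] assms(3)[of w z u v] assms(3)[of z u v w]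
    assms(1)[of v w u z] assms(1)[of w u v z] assms(1)[of u v w z]
    assms(1)[of w z v u] assms(1)[of z v w u] assms(1)[of v w z u]
    assms(1)[of z u w v] assms(1)[of u w z v] assms(1)[of w z u v]
    assms(1)[of u v z w] assms(1)[of v z u w] assms(1)[of z u v w]
    assms(2)[of v w u z] assms(2)[of w u v z] assms(2)[of u v w z]
    assms(2)[of w z v u] assms(2)[of z v w u] assms(2)[of v w z u]
    assms(2)[of z u w v] assms(2)[of u w z v] assms(2)[of w z u v]
    assms(2)[of u v z w] assms(2)[of v z u w] assms(2)[of z u v w]
  by linarith

text \<open>Comparing the terms of bidegree \<open>(2, 2)\<close> in the identity \<open>g (R u (j u) (j u)) u = c (g u u)\<^sup>2\<close> at
  \<open>u = X \<plusminus> n\<close>: those on the left all vanish.\<close>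

lemma holomorphic_curvature_eq_0:
  fixes R :: "'e::real_vector \<Rightarrow> 'e \<Rightarrow> 'e \<Rightarrow> 'e"
  assumes g: "inner_form g"
    and j: "linear j" "\<And>v. j (j v) = - v" "\<And>u v. g (j u) (j v) = g u v"
    and lin: "\<And>v w. linear (\<lambda>u. R u v w)" "\<And>u w. linear (\<lambda>v. R u v w)" "\<And>u v. linear (R u v)"
    and skew: "\<And>u v w. R u v w = - R v u w" "\<And>u v a b. g (R u v a) b = - g a (R u v b)"
    and Bianchi: "\<And>u v w. R u v w + R v w u + R w u v = 0"
    and par: "\<And>u v w. R u v (j w) = j (R u v w)"
    and c: "\<And>u. g (R u (j u) (j u)) u = c * (g u u)\<^sup>2"
    and n: "g n n = 1" "\<And>u v. g u n = 0 \<Longrightarrow> g v n = 0 \<Longrightarrow> \<exists>a b. R u v n = a *\<^sub>R u + b *\<^sub>R v"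
    and X: "g X X = 1" "g X n = 0" "g X (j n) = 0"
  shows "c = 0"
proof -
  define Q where "Q u v w z = g (R u v w) z" for u v w z
  note bl = inner_form_bilinear[OF g]
  note com = inner_form_commute[OF g]
  have add: "Q (u + u') v w z = Q u v w z + Q u' v w z" "Q u (v + v') w z = Q u v w z + Q u v' w z"
    "Q u v (w + w') z = Q u v w z + Q u v w' z" "Q u v w (z + z') = Q u v w z + Q u v w z'" for u u' v v' w w' z z'
    by (simp_all add: Q_def linear_add[OF lin(1)] linear_add[OF lin(2)] linear_add[OF lin(3)]
        bilinear_ladd[OF bl] bilinear_radd[OF bl])
  have neg: "Q (- u) v w z = - Q u v w z" "Q u (- v) w z = - Q u v w z"
    "Q u v (- w) z = - Q u v w z" "Q u v w (- z) = - Q u v w z" for u v w z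
    by (simp_all add: Q_def linear_neg[OF lin(1)] linear_neg[OF lin(2)] linear_neg[OF lin(3)]
        bilinear_lneg[OF bl] bilinear_rneg[OF bl])
  have Q1: "Q u v w z = - Q v u w z" for u v w z
    using skew(1)[of u v w] by (simp add: Q_def bilinear_lneg[OF bl])
  have Q2: "Q u v w z = - Q u v z w" for u v w z
    using skew(2)[of u v w z] com by (simp add: Q_def)
  have Q3: "Q u v w z + Q v w u z + Q w u v z = 0" for u v w z
    using Bianchi[of u v w] by (simp add: Q_def bilinear_ladd[OF bl, symmetric] bilinear_lzero[OF bl])
  note pair = curvature_pair_symmetric[of Q, OF Q1 Q2 Q3]
  have Qj: "Q u v (j w) (j z) = Q u v w z" for u v w z
    by (simp add: Q_def par j)
  have jj: "g (j u) v = - g u (j v)" for u v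
    using j(3)[of "j u" v] by (simp add: j(2) bilinear_lneg[OF bl])
  have self: "g u (j u) = 0" for u
    using jj[of u u] com[of "j u" u] by simp
  \<comment> \<open>By \<open>n(2)\<close> the vector \<open>R u v n\<close> lies in the span of
    \<open>u\<close> and \<open>v\<close>, so it is orthogonal to every \<open>z\<close> orthogonal
    to both.\<close>
  have Qn: "Q u v n z = 0" if "g u n = 0" "g v n = 0" "g u z = 0" "g v z = 0" for u v z
    using n(2)[OF that(1,2)] that(3,4)
    by (auto simp: Q_def bilinear_ladd[OF bl] bilinear_lmul[OF bl])
  have orth: "g (j X) n = 0" "g (j n) n = 0" "g X (j X) = 0" "g (j X) (j n) = 0" "g (j n) (j X) = 0"
    using X n self[of X] self[of n] by (simp_all add: jj j com[of n X] j(2) bilinear_rneg[OF bl])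
  \<comment> \<open>\<open>T1\<close> to \<open>T6\<close> are the six ways of putting
    \<open>n\<close> into two of the four slots. The curvature symmetries and \<open>Qj\<close>
    bring each of them into the form covered by \<open>Qn\<close>.\<close>
  have T1: "Q X (j X) (j n) n = 0"
    using Q2[of X "j X" "j n" n] Qn[of X "j X" "j n"] X orth by simp
  have T2: "Q n (j n) (j X) X = 0"
    using pair[of n "j n" "j X" X] Qn[of "j X" X "j n"] X orth by simp
  have T3: "Q X (j n) (j X) n = 0"
    using Q2[of X "j n" "j X" n] Qn[of X "j n" "j X"] X orth by simp
  have T4: "Q n (j X) (j n) X = 0"
    using pair[of n "j X" "j n" X] Qn[of "j n" X "j X"] X orth by simp
  have T5: "Q X (j n) (j n) X = 0"
    using Qj[of X "j n" "j n" X] Qn[of X "j n" "j X"] X orth by (simp add: j(2) neg)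
  have T6: "Q n (j X) (j X) n = 0"
    using Qj[of n "j X" "j X" n] pair[of n "j X" X "j n"] Qn[of X "j n" "j X"] X orth by (simp add: j(2) neg)
  have norm: "g (X + n) (X + n) = 2" "g (X + - n) (X + - n) = 2"
    using X n com[of n X] by (simp_all add: bilinear_ladd[OF bl] bilinear_radd[OF bl] bilinear_lneg[OF bl] bilinear_rneg[OF bl]
        del: add_uminus_conv_diff)
  \<comment> \<open>Adding the expansions at \<open>X + n\<close> and \<open>X - n\<close> cancels
    the terms of odd degree in \<open>n\<close>. With the six mixed terms gone, the sum reads
    \<open>8 c = 2 (c + c)\<close>.\<close>
  have "Q (X + n) (j (X + n)) (j (X + n)) (X + n) = c * 2\<^sup>2"
    "Q (X + - n) (j (X + - n)) (j (X + - n)) (X + - n) = c * 2\<^sup>2"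
    "Q X (j X) (j X) X = c" "Q n (j n) (j n) n = c"
    unfolding Q_def c norm X(1) n(1) by simp_all
  then show ?thesis
    by (simp add: add neg linear_add[OF j(1)] linear_neg[OF j(1)] T1 T2 T3 T4 T5 T6
        del: add_uminus_conv_diff)
qed

section \<open>Immersed umbilic hypersurfaces in a coordinate domain\<close>

context metric_domain
begin

text \<open>The second covariant derivatives of \<open>N\<close> are computed from the relation
  \<open>umb\<close>. Whatever is symmetric in \<open>u\<close> and \<open>v\<close> drops out of
  the commutator, and only the derivatives of the factor remain.\<close>

lemma curv_umbilic:
  fixes F :: "'x::real_normed_vector \<Rightarrow> 'e"
  assumes S: "open S" "smooth_on S F" "F ` S \<subseteq> Z" "smooth_on S N" "x \<in> S"
    and umb: "\<And>y. y \<in> S \<Longrightarrow> \<exists>l. \<forall>v. cov \<Gamma> F N y v = l *\<^sub>R frechet_derivative F (at y) v"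
    and ne: "frechet_derivative F (at x) w \<noteq> 0"
  shows "\<exists>a b. curv \<Gamma> (F x) (frechet_derivative F (at x) u) (frechet_derivative F (at x) v) (N x) =
    a *\<^sub>R frechet_derivative F (at x) u + b *\<^sub>R frechet_derivative F (at x) v"
proof -
  obtain b where b: "b \<in> Basis" "frechet_derivative F (at x) w \<bullet> b \<noteq> 0"
    using ne euclidean_eqI[of "frechet_derivative F (at x) w" 0] by auto
  have x: "F x \<in> Z" using S by auto
  \<comment> \<open>\<open>umb\<close> asserts a factor for each point separately. As a quotient of
    components, for the fixed direction \<open>w\<close> and coordinate \<open>b\<close>, it becomes
    a function differentiable at \<open>x\<close>, where the denominator is nonzero.\<close>
  define l where "l y = (cov \<Gamma> F N y w \<bullet> b) / (frechet_derivative F (at y) w \<bullet> b)" for y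
  define S' where "S' = {y \<in> S. frechet_derivative F (at y) w \<bullet> b \<noteq> 0}"
  have "continuous_on S (\<lambda>y. frechet_derivative F (at y) w \<bullet> b)"
    by (intro continuous_intros smooth_on_imp_continuous_on smooth_on_deriv S)
  from continuous_open_preimage[OF this S(1), of "- {0}"]
  have "open S'" by (simp add: S'_def vimage_def Int_def open_Compl)
  have "x \<in> S'" using b S(5) by (simp add: S'_def)
  have eq: "cov \<Gamma> F N y v = l y *\<^sub>R frechet_derivative F (at y) v" if "y \<in> S'" for y v
    using umb[of y] that by (auto simp: S'_def l_def)
  obtain l' where l': "(l has_derivative l') (at x)"
  proof -
    have "(\<lambda>y. cov \<Gamma> F N y w) differentiable at x"
      using cov_has_derivative[OF S, of w] by (auto simp: differentiable_def)
    then have "(\<lambda>y. cov \<Gamma> F N y w \<bullet> b) differentiable at x"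
      unfolding differentiable_def
      using bounded_linear.has_derivative[OF bounded_linear_inner_left[of b]] by blast
    moreover have "(\<lambda>y. frechet_derivative F (at y) w \<bullet> b) differentiable at x"
      using smooth_on_differentiable[OF smooth_on_deriv[OF S(2)] S(5), of w] unfolding differentiable_def
      using bounded_linear.has_derivative[OF bounded_linear_inner_left[of b]] by blast
    ultimately have "l differentiable at x"
      unfolding l_def using b(2) by (intro differentiable_divide)
    then show ?thesis using that by (auto simp: differentiable_def)
  qed
  have D: "cov \<Gamma> F (\<lambda>y. cov \<Gamma> F N y v) x u =
      l x *\<^sub>R frechet_derivative (\<lambda>y. frechet_derivative F (at y) v) (at x) u +
      l' u *\<^sub>R frechet_derivative F (at x) v +
      l x *\<^sub>R \<Gamma> (F x) (frechet_derivative F (at x) u) (frechet_derivative F (at x) v)" for u v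
  proof -
    have "((\<lambda>y. l y *\<^sub>R frechet_derivative F (at y) v) has_derivative
      (\<lambda>u. l x *\<^sub>R frechet_derivative (\<lambda>y. frechet_derivative F (at y) v) (at x) u +
        l' u *\<^sub>R frechet_derivative F (at x) v)) (at x)"
      by (intro has_derivative_scaleR l' smooth_on_has_derivative[OF smooth_on_deriv[OF S(2)] S(5)])
    then have "((\<lambda>y. cov \<Gamma> F N y v) has_derivative
      (\<lambda>u. l x *\<^sub>R frechet_derivative (\<lambda>y. frechet_derivative F (at y) v) (at x) u +
        l' u *\<^sub>R frechet_derivative F (at x) v)) (at x)"
      by (rule has_derivative_transform_within_open[OF _ \<open>open S'\<close> \<open>x \<in> S'\<close>]) (simp add: eq)
    from fun_cong[OF frechet_derivative_eqI[OF this], of u] show ?thesis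
      unfolding cov_def[of _ _ "\<lambda>y. cov \<Gamma> F N y v"]
      by (simp add: eq[OF \<open>x \<in> S'\<close>] bilinear_rmul[OF christoffel_bilinear[OF x]])
  qed
  have "curv \<Gamma> (F x) (frechet_derivative F (at x) u) (frechet_derivative F (at x) v) (N x) =
      (- l' v) *\<^sub>R frechet_derivative F (at x) u + l' u *\<^sub>R frechet_derivative F (at x) v"
    unfolding cov_commutator[OF S, symmetric] D
    using second_derivative_symmetric[OF S(2,1,5), of u v]
      christoffel_commute[OF x, of "frechet_derivative F (at x) u" "frechet_derivative F (at x) v"]
    by simp
  then show ?thesis by blast
qed

end

lemma linear_J: "linear (\<lambda>v. J v)"
  by (rule linearI) (simp_all add: vec_eq_iff algebra_simps)

lemma J_J: "J (J v) = - v"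
  by (simp add: vec_eq_iff)

text \<open>The linear map \<open>u \<mapsto> (g u a, g u b)\<close> has a nontrivial kernel, since the dimension is \<open>4\<close>.\<close>

lemma ex_unit_orthogonal_two:
  fixes g :: "complex ^ 2 \<Rightarrow> complex ^ 2 \<Rightarrow> real"
  assumes g: "inner_form g"
  obtains X where "g X X = 1" "g X a = 0" "g X b = 0"
proof -
  note bl = inner_form_bilinear[OF g]
  define L where "L u = (g u a, g u b)" for u
  have L: "linear L"
    by (rule linearI) (simp_all add: L_def bilinear_ladd[OF bl] bilinear_lmul[OF bl])
  have "\<not> inj L"
  proof
    assume "inj L"
    then have "dim (range L) = dim (UNIV :: (complex ^ 2) set)"
      by (intro dim_image_eq L) (simp add: inj_on_subset)
    moreover have "dim (range L) \<le> DIM(real \<times> real)" by (rule dim_subset_UNIV)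
    ultimately show False by simp
  qed
  then obtain Y where Y: "Y \<noteq> 0" "L Y = 0"
    using linear_injective_0[OF L] by blast
  then have pos: "g Y Y > 0" using inner_form_pos[OF g] by blast
  show ?thesis
  proof (rule that[of "inverse (sqrt (g Y Y)) *\<^sub>R Y"])
  qed (use Y pos in \<open>simp_all add: L_def bilinear_lmul[OF bl] bilinear_rmul[OF bl] zero_prod_def divide_simps\<close>)
qed

text \<open>The argument inside one ambient chart. The vector \<open>X\<close> orthogonal to
  \<open>N\<close> is tangent, so besides entering the algebraic lemma it supplies the nonzero
  tangent direction that \<open>curv_umbilic\<close> asks for.\<close>

lemma no_umbilic_hypersurface:
  fixes Z :: "(complex ^ 2) set" and F N :: "'x::real_normed_vector \<Rightarrow> complex ^ 2"
  assumes "metric_domain Z g"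
    and J: "\<And>z u v. z \<in> Z \<Longrightarrow> g z (J u) (J v) = g z u v"
    and par: "\<And>z u v. z \<in> Z \<Longrightarrow> christoffel g z u (J v) = J (christoffel g z u v)"
    and c: "\<And>z u. z \<in> Z \<Longrightarrow> g z (curv (christoffel g) z u (J u) (J u)) u = c * (g z u u)\<^sup>2"
    and S: "open S" "smooth_on S F" "F ` S \<subseteq> Z" "smooth_on S N" "x \<in> S"
    and umb: "\<And>y. y \<in> S \<Longrightarrow> \<exists>l. \<forall>v. cov (christoffel g) F N y v = l *\<^sub>R frechet_derivative F (at y) v"
    and N: "g (F x) (N x) (N x) = 1" "\<And>u. g (F x) u (N x) = 0 \<Longrightarrow> u \<in> range (frechet_derivative F (at x))"
  shows "c = 0"
proof -
  interpret metric_domain Z g by fact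
  have x: "F x \<in> Z" using S by auto
  obtain X where X: "g (F x) X X = 1" "g (F x) X (N x) = 0" "g (F x) X (J (N x)) = 0"
    using ex_unit_orthogonal_two[OF inner[OF x]] by blast
  obtain w where "X = frechet_derivative F (at x) w"
    using N(2)[OF X(2)] by auto
  moreover have "X \<noteq> 0"
    using X(1) bilinear_lzero[OF g_bilinear[OF x]] by auto
  ultimately have ne: "frechet_derivative F (at x) w \<noteq> 0" by simp
  show ?thesis
  proof (rule holomorphic_curvature_eq_0[OF inner[OF x] linear_J J_J J[OF x] curv_linear[OF x] curv_skew
        curv_metric_skew[OF x] Bianchi[OF x] curv_complex_linear[OF x _ par] c[OF x] N(1) _ X])
    show "bounded_linear (\<lambda>v. J v)" using linear_J by (rule linear_conv_bounded_linear[THEN iffD1])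
    fix u v assume "g (F x) u (N x) = 0" "g (F x) v (N x) = 0"
    then obtain u' v' where "u = frechet_derivative F (at x) u'" "v = frechet_derivative F (at x) v'"
      using N(2) by (metis rangeE)
    then show "\<exists>a b. curv \<Gamma> (F x) u v (N x) = a *\<^sub>R u + b *\<^sub>R v"
      using curv_umbilic[OF S umb ne] by blast
  qed
qed

section \<open>Unit normals\<close>

text \<open>In codimension one the range of \<open>T\<close> and the vector \<open>n\<close> span
  everything by a dimension count, so each vector is a multiple of \<open>n\<close> plus a tangent
  part. Pairing with \<open>n\<close>, respectively with the tangent part, eliminates the unwanted
  summand.\<close>

lemma
  fixes T :: "'x::euclidean_space \<Rightarrow> 'e::euclidean_space"
  assumes g: "inner_form g" and T: "linear T" "inj T" "\<And>v. g (T v) n = 0" and n: "n \<noteq> 0"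
    and dim: "DIM('e) = Suc DIM('x)"
  shows normal_imp_range: "g u n = 0 \<Longrightarrow> u \<in> range T"
    and normal_unique: "(\<And>v. g (T v) u = 0) \<Longrightarrow> \<exists>k. u = k *\<^sub>R n"
proof -
  note bl = inner_form_bilinear[OF g]
  have sub: "subspace (range T)"
    using linear_subspace_image[OF T(1) subspace_UNIV] by simp
  have nT: "n \<notin> range T"
    using T(3) inner_form_pos[OF g n] by (metis rangeE less_irrefl)
  have "dim (range T) = DIM('x)"
    using dim_image_eq[OF T(1), of UNIV] T(2) by simp
  moreover have "dim (insert n (range T)) = Suc (dim (range T))"
    using nT by (simp add: dim_insert span_eq_iff[THEN iffD2, OF sub])
  ultimately have "dim (insert n (range T)) = DIM('e)" by (simp add: dim)
  then have "span (insert n (range T)) = UNIV"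
    by (simp add: dim_eq_full)
  then have dec: "\<exists>k v. u = k *\<^sub>R n + T v" for u
    using span_breakdown_eq[of u n "range T"] span_eq_iff[THEN iffD2, OF sub]
    by (metis UNIV_I add.commute diff_add_cancel rangeE)
  show "u \<in> range T" if u: "g u n = 0"
  proof -
    obtain k v where "u = k *\<^sub>R n + T v" using dec by blast
    moreover from this have "k = 0"
      using u T(3) inner_form_pos[OF g n] by (simp add: bilinear_ladd[OF bl] bilinear_lmul[OF bl])
    ultimately show ?thesis by simp
  qed
  show "\<exists>k. u = k *\<^sub>R n" if u: "\<And>v. g (T v) u = 0"
  proof -
    obtain k v where kv: "u = k *\<^sub>R n + T v" using dec by blast
    then have "g (T v) (T v) = 0"
      using u[of v] T(3) by (simp add: bilinear_radd[OF bl] bilinear_rmul[OF bl])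
    then have "T v = 0"
      using inner_form_pos[OF g, of "T v"] by auto
    then show ?thesis using kv by auto
  qed
qed

lemma orthonormal_expansion:
  assumes B: "inner_form (B x)" and E: "finite \<E>" "orthonormal_on S B \<E>" "x \<in> S"
    and u: "u \<in> span ((\<lambda>E. E x) ` \<E>)"
  shows "(\<Sum>E\<in>\<E>. B x u (E x) *\<^sub>R E x) = u"
proof -
  note bl = inner_form_bilinear[OF B]
  have lin: "linear (\<lambda>u. \<Sum>E\<in>\<E>. B x u (E x) *\<^sub>R E x)"
    by (rule linearI) (simp_all add: bilinear_ladd[OF bl] bilinear_lmul[OF bl] sum.distrib
        scaleR_sum_right scaleR_add_left)
  show ?thesis
  proof (rule linear_eq_on_span[OF lin linear_id[unfolded id_def] _ u])
    fix e assume "e \<in> (\<lambda>E. E x) ` \<E>"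
    then obtain E' where E': "E' \<in> \<E>" "e = E' x" by auto
    have "(\<Sum>E\<in>\<E>. B x e (E x) *\<^sub>R E x) = (\<Sum>E\<in>\<E>. if E = E' then E x else 0)"
      by (rule sum.cong) (use E E' in \<open>auto simp: orthonormal_on_def\<close>)
    then show "(\<Sum>E\<in>\<E>. B x e (E x) *\<^sub>R E x) = e"
      using E E' by simp
  qed
qed

text \<open>Gram-Schmidt on the images of the basis vectors gives a smooth tangent frame; one
  further step, applied to a constant vector transversal at \<open>x\<close>, gives the
  normal.\<close>

lemma (in metric_domain) smooth_unit_normal:
  fixes F :: "'x::euclidean_space \<Rightarrow> 'e"
  assumes S: "open S" "smooth_on S F" "F ` S \<subseteq> Z" and x: "x \<in> S"
    and inj: "\<And>y. y \<in> S \<Longrightarrow> inj (frechet_derivative F (at y))"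
    and dim: "DIM('x) < DIM('e)"
  obtains S' N where "open S'" "S' \<subseteq> S" "x \<in> S'" "smooth_on S' N"
    "\<And>y. y \<in> S' \<Longrightarrow> g (F y) (N y) (N y) = 1"
    "\<And>y v. y \<in> S' \<Longrightarrow> g (F y) (frechet_derivative F (at y) v) (N y) = 0"
proof -
  define B where "B y = g (F y)" for y
  have B: "y \<in> S \<Longrightarrow> inner_form (B y)" for y using inner S(3) by (auto simp: B_def)
  have sB: "smooth_family S B"
    unfolding smooth_family_def B_def
    by (intro allI smooth_on_compose[OF S(1,2) smooth_g S(3)])
  have lin: "y \<in> S \<Longrightarrow> linear (frechet_derivative F (at y))" for y
    using smooth_on_differentiable[OF S(2)] by (intro linear_frechet_derivative)
  define \<V> :: "('x \<Rightarrow> 'e) set" where "\<V> = (\<lambda>b y. frechet_derivative F (at y) b) ` Basis"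
  have ev: "(\<lambda>V. V y) ` \<V> = frechet_derivative F (at y) ` Basis" for y
    by (simp add: \<V>_def image_image)
  have span\<V>: "span ((\<lambda>V. V y) ` \<V>) = range (frechet_derivative F (at y))" if "y \<in> S" for y
    unfolding ev linear_span_image[OF lin[OF that]] by (simp add: span_Basis)
  have "\<exists>\<E>. finite \<E> \<and> (\<forall>E\<in>\<E>. smooth_on S E) \<and> orthonormal_on S B \<E> \<and>
    (\<forall>y\<in>S. span ((\<lambda>E. E y) ` \<E>) = span ((\<lambda>V. V y) ` \<V>))"
  proof (rule smooth_orthonormal_frame[OF S(1) B sB])
    show "finite \<V>" unfolding \<V>_def by (rule finite_imageI) simp
    show "smooth_on S V" if "V \<in> \<V>" for V
      using that smooth_on_deriv[OF S(2)] by (auto simp: \<V>_def)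
    fix y assume y: "y \<in> S"
    show "inj_on (\<lambda>V. V y) \<V> \<and> independent ((\<lambda>V. V y) ` \<V>)"
    proof
      show "inj_on (\<lambda>V. V y) \<V>"
        using inj[OF y] by (auto simp: \<V>_def inj_on_def)
      show "independent ((\<lambda>V. V y) ` \<V>)"
        unfolding ev
        by (rule linear_independent_injective_image[OF lin[OF y] independent_Basis])
          (simp add: span_Basis inj[OF y])
    qed
  qed
  then obtain \<E> where \<E>: "finite \<E>" "\<And>E. E \<in> \<E> \<Longrightarrow> smooth_on S E" "orthonormal_on S B \<E>"
    "\<And>y. y \<in> S \<Longrightarrow> span ((\<lambda>E. E y) ` \<E>) = range (frechet_derivative F (at y))"
    by (auto simp: span\<V>)
  have "dim (range (frechet_derivative F (at x))) = DIM('x)"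
    using dim_image_eq[OF lin[OF x], of UNIV] inj[OF x] by simp
  then have "range (frechet_derivative F (at x)) \<noteq> UNIV"
    using dim by auto
  then obtain a where a: "a \<notin> range (frechet_derivative F (at x))" by auto
  \<comment> \<open>The normal component of the constant field \<open>a\<close>: it is nonzero at
    \<open>x\<close> and, by continuity, on the open set \<open>S'\<close>.\<close>
  define m where "m y = a - (\<Sum>E\<in>\<E>. B y a (E y) *\<^sub>R E y)" for y
  define S' where "S' = {y \<in> S. m y \<noteq> 0}"
  have "smooth_on S (\<lambda>y. B y a (E y))" if "E \<in> \<E>" for E
    by (rule smooth_on_linear_family[where L = "\<lambda>y. B y a", OF S(1) _ _ \<E>(2)[OF that]])
      (use sB in \<open>auto simp: smooth_family_def intro: bilinear_linear_right inner_form_bilinear B\<close>)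
  then have "smooth_on S m"
    unfolding m_def
    by (intro smooth_on_diff smooth_on_sum smooth_on_scaleR smooth_on_const \<E>(2) S(1))
  from continuous_open_preimage[OF smooth_on_imp_continuous_on[OF this] S(1), of "- {0}"]
  have op: "open S'" by (simp add: S'_def vimage_def Int_def open_Compl)
  have sub: "S' \<subseteq> S" by (auto simp: S'_def)
  have "x \<in> S'"
  proof -
    have "(\<Sum>E\<in>\<E>. B x a (E x) *\<^sub>R E x) \<in> span ((\<lambda>E. E x) ` \<E>)"
      by (intro span_sum span_scale span_base) auto
    then show ?thesis using x a \<E>(4)[OF x] by (auto simp: S'_def m_def)
  qed
  have a: "a \<notin> span ((\<lambda>E. E y) ` \<E>)" if "y \<in> S'" for y
    using orthonormal_expansion[OF B \<E>(1,3), of y a] that by (auto simp: S'_def m_def)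
  have on: "orthonormal_on S' B \<E>"
    using \<E>(3) sub by (auto simp: orthonormal_on_def)
  have B': "inner_form (B y)" if "y \<in> S'" for y using B sub that by auto
  have sE: "smooth_on S' E" if "E \<in> \<E>" for E by (rule smooth_on_subset[OF \<E>(2)[OF that] sub])
  have sB': "smooth_family S' B"
    using sB smooth_on_subset[OF _ sub] by (auto simp: smooth_family_def)
  obtain N where N: "smooth_on S' N" "orthonormal_on S' B (insert N \<E>)" "\<And>y. y \<in> S' \<Longrightarrow> N \<notin> \<E>"
    by (rule Gram_Schmidt_step[OF op B' sB' \<E>(1) sE on smooth_on_const[OF op] a]) blast+
  show ?thesis
  proof (rule that[OF op sub \<open>x \<in> S'\<close> N(1)])
    fix y assume y: "y \<in> S'"
    then have y': "y \<in> S" using sub by auto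
    show "g (F y) (N y) (N y) = 1"
      using N(2) y by (auto simp: orthonormal_on_def B_def)
    fix v
    have "B y u (N y) = 0" if "u \<in> span ((\<lambda>E. E y) ` \<E>)" for u
    proof (rule linear_eq_0_on_span[OF bilinear_linear_left[OF inner_form_bilinear[OF B[OF y']]] _ that])
      fix e assume "e \<in> (\<lambda>E. E y) ` \<E>"
      then obtain E where "E \<in> \<E>" "e = E y" by auto
      then show "B y e (N y) = 0"
        using N(2) N(3)[OF y] y by (auto simp: orthonormal_on_def)
    qed
    then show "g (F y) (frechet_derivative F (at y) v) (N y) = 0"
      using \<E>(4)[OF y'] by (auto simp: B_def)
  qed
qed

section \<open>Charts\<close>

lemma chart_inv_snd: "is_chart \<alpha> \<Longrightarrow> p \<in> fst \<alpha> \<Longrightarrow> chart_inv \<alpha> (snd \<alpha> p) = p"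
  by (auto simp: is_chart_def homeomorphism_def)

lemma snd_chart_inv: "is_chart \<alpha> \<Longrightarrow> x \<in> snd \<alpha> ` fst \<alpha> \<Longrightarrow> snd \<alpha> (chart_inv \<alpha> x) = x"
  by (auto simp: is_chart_def homeomorphism_def)

lemma chart_inv_in: "is_chart \<alpha> \<Longrightarrow> x \<in> snd \<alpha> ` fst \<alpha> \<Longrightarrow> chart_inv \<alpha> x \<in> fst \<alpha>"
  by (auto simp: is_chart_def homeomorphism_def)

lemma open_chart_image:
  assumes "is_chart \<alpha>" "open U"
  shows "open (snd \<alpha> ` (U \<inter> fst \<alpha>))"
proof -
  have "continuous_on (snd \<alpha> ` fst \<alpha>) (chart_inv \<alpha>)" "open (snd \<alpha> ` fst \<alpha>)"
    using assms by (auto simp: is_chart_def homeomorphism_def)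
  then have "open (snd \<alpha> ` fst \<alpha> \<inter> chart_inv \<alpha> -` U)"
    by (rule continuous_open_preimage) fact
  moreover have "snd \<alpha> ` fst \<alpha> \<inter> chart_inv \<alpha> -` U = snd \<alpha> ` (U \<inter> fst \<alpha>)"
    by (auto simp: chart_inv_snd[OF assms(1)])
  ultimately show ?thesis by simp
qed

lemma open_chart_preimage:
  assumes "is_chart \<alpha>" "open S"
  shows "open {p \<in> fst \<alpha>. snd \<alpha> p \<in> S}"
proof -
  have "continuous_on (fst \<alpha>) (snd \<alpha>)" "open (fst \<alpha>)"
    using assms by (auto simp: is_chart_def homeomorphism_def)
  then have "open (fst \<alpha> \<inter> snd \<alpha> -` S)"
    by (rule continuous_open_preimage) fact
  then show ?thesis by (simp add: vimage_def Int_def)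
qed

text \<open>The middle chart \<beta> covers only the image of a neighbourhood of \<open>p\<close>.
  On \<open>?T\<close> inserting \<open>chart_inv \<beta> \<circ> snd \<beta>\<close> changes
  nothing, and the Euclidean chain rule applies.\<close>

lemma dd_compose:
  assumes \<alpha>: "is_chart \<alpha>" "p \<in> fst \<alpha>" and \<beta>: "is_chart \<beta>" "f p \<in> fst \<beta>" and f: "continuous_on UNIV f"
    and d: "(snd \<beta> \<circ> f \<circ> chart_inv \<alpha>) differentiable at (snd \<alpha> p)" "(H \<circ> chart_inv \<beta>) differentiable at (snd \<beta> (f p))"
  shows "dd \<alpha> (H \<circ> f) p v = dd \<beta> H (f p) (dd \<alpha> (snd \<beta> \<circ> f) p v)"
proof -
  let ?T = "snd \<alpha> ` (f -` fst \<beta> \<inter> fst \<alpha>)"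
  have "open ?T"
    by (rule open_chart_image[OF \<alpha>(1)]) (use \<beta>(1) f in \<open>auto simp: is_chart_def intro: open_vimage\<close>)
  have x: "snd \<alpha> p \<in> ?T" using \<alpha> \<beta> by auto
  have fp: "(snd \<beta> \<circ> f \<circ> chart_inv \<alpha>) (snd \<alpha> p) = snd \<beta> (f p)"
    by (simp add: chart_inv_snd[OF \<alpha>])
  have "(((H \<circ> chart_inv \<beta>) \<circ> (snd \<beta> \<circ> f \<circ> chart_inv \<alpha>)) has_derivative
      (frechet_derivative (H \<circ> chart_inv \<beta>) (at (snd \<beta> (f p))) \<circ>
       frechet_derivative (snd \<beta> \<circ> f \<circ> chart_inv \<alpha>) (at (snd \<alpha> p)))) (at (snd \<alpha> p))"
    by (rule diff_chain_at) (use d in \<open>simp_all only: fp frechet_derivative_works\<close>)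
  then have "((H \<circ> f \<circ> chart_inv \<alpha>) has_derivative
      (frechet_derivative (H \<circ> chart_inv \<beta>) (at (snd \<beta> (f p))) \<circ>
       frechet_derivative (snd \<beta> \<circ> f \<circ> chart_inv \<alpha>) (at (snd \<alpha> p)))) (at (snd \<alpha> p))"
    by (rule has_derivative_transform_within_open[OF _ \<open>open ?T\<close> x])
      (auto simp: chart_inv_snd[OF \<alpha>(1)] chart_inv_snd[OF \<beta>(1)])
  from frechet_derivative_eqI[OF this] show ?thesis
    by (simp add: dd_def)
qed

lemma dd_linear: "(F \<circ> chart_inv \<alpha>) differentiable at (snd \<alpha> p) \<Longrightarrow> linear (dd \<alpha> F p)"
  unfolding dd_def using linear_frechet_derivative by blast

locale smooth_manifold =
  fixes \<A> :: "('m::{t2_space,second_countable_topology}, 'e::euclidean_space) chart set"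
  assumes atlas: "smooth_atlas \<A>"
begin

lemma chart: "\<alpha> \<in> \<A> \<Longrightarrow> is_chart \<alpha>"
  using atlas by (simp add: smooth_atlas_def)

lemma open_domain: "\<alpha> \<in> \<A> \<Longrightarrow> open (fst \<alpha>)"
  using chart by (auto simp: is_chart_def)

lemma chart_at: "chart_at \<A> p \<in> \<A>" "p \<in> fst (chart_at \<A> p)"
proof -
  have "\<exists>\<alpha>. \<alpha> \<in> \<A> \<and> p \<in> fst \<alpha>"
    using atlas unfolding smooth_atlas_def by blast
  from someI_ex[OF this] show "chart_at \<A> p \<in> \<A>" "p \<in> fst (chart_at \<A> p)"
    by (auto simp: chart_at_def)
qed

lemma transition_smooth:
  "\<alpha> \<in> \<A> \<Longrightarrow> \<beta> \<in> \<A> \<Longrightarrow> smooth_on (snd \<alpha> ` (fst \<beta> \<inter> fst \<alpha>)) (snd \<beta> \<circ> chart_inv \<alpha>)"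
  using atlas by (simp add: smooth_atlas_def smooth_fun_def)

lemma transition_differentiable:
  "\<alpha> \<in> \<A> \<Longrightarrow> \<beta> \<in> \<A> \<Longrightarrow> p \<in> fst \<alpha> \<Longrightarrow> p \<in> fst \<beta> \<Longrightarrow> (snd \<beta> \<circ> chart_inv \<alpha>) differentiable at (snd \<alpha> p)"
  by (rule smooth_on_differentiable[OF transition_smooth]) auto

lemma dd_change:
  assumes "\<alpha> \<in> \<A>" "\<beta> \<in> \<A>" "p \<in> fst \<alpha>" "p \<in> fst \<beta>" "(H \<circ> chart_inv \<beta>) differentiable at (snd \<beta> p)"
  shows "dd \<beta> H p (dd \<alpha> (snd \<beta>) p v) = dd \<alpha> H p v"
  using dd_compose[where f = "\<lambda>p. p" and \<alpha> = \<alpha> and \<beta> = \<beta> and H = H and p = p and v = v] assms chart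
    transition_differentiable[of \<alpha> \<beta> p]
  by (simp add: o_def)

lemma dd_self: "\<alpha> \<in> \<A> \<Longrightarrow> p \<in> fst \<alpha> \<Longrightarrow> dd \<alpha> (snd \<alpha>) p v = v"
proof -
  assume \<alpha>: "\<alpha> \<in> \<A>" "p \<in> fst \<alpha>"
  have "frechet_derivative (\<lambda>x. x) (at (snd \<alpha> p)) = frechet_derivative (snd \<alpha> \<circ> chart_inv \<alpha>) (at (snd \<alpha> p))"
    by (rule frechet_derivative_transform_within_open[where X = "snd \<alpha> ` fst \<alpha>"])
      (use \<alpha> chart[OF \<alpha>(1)] in \<open>auto simp: snd_chart_inv is_chart_def chart_inv_snd\<close>)
  then have "frechet_derivative (snd \<alpha> \<circ> chart_inv \<alpha>) (at (snd \<alpha> p)) = (\<lambda>v. v)"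
    by simp
  then show ?thesis by (simp add: dd_def)
qed

lemma dd_inverse:
  "\<alpha> \<in> \<A> \<Longrightarrow> \<beta> \<in> \<A> \<Longrightarrow> p \<in> fst \<alpha> \<Longrightarrow> p \<in> fst \<beta> \<Longrightarrow> dd \<beta> (snd \<alpha>) p (dd \<alpha> (snd \<beta>) p v) = v"
  by (subst dd_change) (simp_all add: dd_self transition_differentiable)

lemma dd_transition_linear:
  "\<alpha> \<in> \<A> \<Longrightarrow> \<beta> \<in> \<A> \<Longrightarrow> p \<in> fst \<alpha> \<Longrightarrow> p \<in> fst \<beta> \<Longrightarrow> linear (dd \<alpha> (snd \<beta>) p)"
  by (intro dd_linear transition_differentiable)

section \<open>Extending coordinate fields by zero\<close>

definition extend_field :: "('m, 'e) chart \<Rightarrow> ('e \<Rightarrow> 'e) \<Rightarrow> ('m, 'e) vfield" where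
  "extend_field \<alpha> w \<alpha>' p = (if p \<in> fst \<alpha> then dd \<alpha> (snd \<alpha>') p (w (snd \<alpha> p)) else 0)"

lemma extend_field_self: "\<alpha> \<in> \<A> \<Longrightarrow> p \<in> fst \<alpha> \<Longrightarrow> extend_field \<alpha> w \<alpha> p = w (snd \<alpha> p)"
  by (simp add: extend_field_def dd_self)

lemma dd_extend_field:
  assumes "\<alpha> \<in> \<A>" "p \<in> fst \<alpha>" "w differentiable at (snd \<alpha> p)"
  shows "dd \<alpha> (extend_field \<alpha> w \<alpha>) p v = frechet_derivative w (at (snd \<alpha> p)) v"
proof -
  have "frechet_derivative w (at (snd \<alpha> p)) = frechet_derivative (extend_field \<alpha> w \<alpha> \<circ> chart_inv \<alpha>) (at (snd \<alpha> p))"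
    by (rule frechet_derivative_transform_within_open[OF assms(3), where X = "snd \<alpha> ` fst \<alpha>"])
      (use assms chart[OF assms(1)] in \<open>auto simp: is_chart_def chart_inv_snd extend_field_self\<close>)
  then show ?thesis by (simp add: dd_def)
qed

text \<open>Smoothness is local: around points of the domain of \<alpha> the components come from
  transition maps, and around all other points the field is zero.\<close>

lemma vector_field_extend:
  assumes \<alpha>: "\<alpha> \<in> \<A>" and w: "smooth_on (snd \<alpha> ` fst \<alpha>) w"
    and K: "compact K" "K \<subseteq> snd \<alpha> ` fst \<alpha>" "\<And>x. x \<notin> K \<Longrightarrow> w x = 0"
  shows "vector_field \<A> UNIV (extend_field \<alpha> w)"
  unfolding vector_field_def vector_field_along_def
proof (intro conjI ballI impI)
  \<comment> \<open>A compact set in a Hausdorff space is closed, so the complement of this image is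
    an open set; the field vanishes on it.\<close>
  have K': "closed (chart_inv \<alpha> ` K)"
  proof (intro compact_imp_closed compact_continuous_image[OF _ K(1)])
    show "continuous_on K (chart_inv \<alpha>)"
      using chart[OF \<alpha>] K(2) by (auto simp: is_chart_def homeomorphism_def intro: continuous_on_subset)
  qed
  fix \<beta> assume \<beta>: "\<beta> \<in> \<A>"
  show "smooth_fun \<A> (UNIV \<inter> (\<lambda>p. p) -` fst \<beta>) (extend_field \<alpha> w \<beta>)"
    unfolding smooth_fun_def
  proof (intro ballI smooth_on_local)
    fix \<gamma> x assume \<gamma>: "\<gamma> \<in> \<A>" and "x \<in> snd \<gamma> ` (UNIV \<inter> (\<lambda>p. p) -` fst \<beta> \<inter> fst \<gamma>)"
    then obtain p where p: "p \<in> fst \<beta>" "p \<in> fst \<gamma>" "x = snd \<gamma> p" by auto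
    show "\<exists>T. open T \<and> x \<in> T \<and> smooth_on T (extend_field \<alpha> w \<beta> \<circ> chart_inv \<gamma>)"
    proof (cases "p \<in> fst \<alpha>")
      case True
      define T where "T = snd \<gamma> ` ((fst \<alpha> \<inter> fst \<beta>) \<inter> fst \<gamma>)"
      have T: "open T"
        unfolding T_def by (intro open_chart_image chart \<gamma> open_Int open_domain \<alpha> \<beta>)
      let ?\<sigma> = "snd \<alpha> \<circ> chart_inv \<gamma>" and ?\<tau> = "snd \<beta> \<circ> chart_inv \<alpha>"
      have \<sigma>: "smooth_on T ?\<sigma>"
        by (rule smooth_on_subset[OF transition_smooth[OF \<gamma> \<alpha>]]) (auto simp: T_def)
      have im: "?\<sigma> ` T \<subseteq> snd \<alpha> ` (fst \<beta> \<inter> fst \<alpha>)"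
        by (auto simp: T_def chart_inv_snd[OF chart[OF \<gamma>]])
      have "smooth_on T (\<lambda>y. frechet_derivative ?\<tau> (at (?\<sigma> y)) (w (?\<sigma> y)))"
      proof (rule smooth_on_linear_family[where L = "\<lambda>y. frechet_derivative ?\<tau> (at (?\<sigma> y))"
            and P = "\<lambda>y. w (?\<sigma> y)", OF T])
        show "linear (frechet_derivative ?\<tau> (at (?\<sigma> y)))" if "y \<in> T" for y
          using smooth_on_differentiable[OF transition_smooth[OF \<alpha> \<beta>]] im that
          by (intro linear_frechet_derivative) blast
        show "smooth_on T (\<lambda>y. frechet_derivative ?\<tau> (at (?\<sigma> y)) u)" for u
          by (rule smooth_on_compose[OF T \<sigma> smooth_on_deriv[OF transition_smooth[OF \<alpha> \<beta>]] im])
        show "smooth_on T (\<lambda>y. w (?\<sigma> y))"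
          by (rule smooth_on_compose[OF T \<sigma> w]) (use im in auto)
      qed
      then have "smooth_on T (extend_field \<alpha> w \<beta> \<circ> chart_inv \<gamma>)"
        by (rule smooth_on_cong[OF T, rotated])
          (auto simp: T_def extend_field_def dd_def chart_inv_snd[OF chart[OF \<gamma>]])
      then show ?thesis using T p True by (auto simp: T_def)
    next
      case False
      define T where "T = snd \<gamma> ` ((- chart_inv \<alpha> ` K \<inter> fst \<beta>) \<inter> fst \<gamma>)"
      have T: "open T"
        unfolding T_def using K' by (intro open_chart_image chart \<gamma> open_Int open_domain \<beta>) auto
      have "q \<notin> chart_inv \<alpha> ` K \<Longrightarrow> q \<in> fst \<beta> \<Longrightarrow> extend_field \<alpha> w \<beta> q = 0" for q
        using K(3)[of "snd \<alpha> q"] chart_inv_snd[OF chart[OF \<alpha>], of q]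
          linear_0[OF dd_transition_linear[OF \<alpha> \<beta>], of q]
        by (auto simp: extend_field_def) (metis image_eqI)
      then have "smooth_on T (extend_field \<alpha> w \<beta> \<circ> chart_inv \<gamma>)"
        by (intro smooth_on_cong[OF T _ smooth_on_const[OF T, of 0]])
          (auto simp: T_def chart_inv_snd[OF chart[OF \<gamma>]])
      moreover have "p \<notin> chart_inv \<alpha> ` K"
        using False K(2) chart_inv_in[OF chart[OF \<alpha>]] by auto
      then have "x \<in> T" using p by (auto simp: T_def)
      ultimately show ?thesis using T by blast
    qed
  qed
  fix \<beta>' p assume "\<beta>' \<in> \<A>" "p \<in> UNIV" "p \<in> fst \<beta> \<inter> fst \<beta>'"
  then show "extend_field \<alpha> w \<beta>' p = dd \<beta> (snd \<beta>') p (extend_field \<alpha> w \<beta> p)"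
    using dd_change[of \<alpha> \<beta> p "snd \<beta>'"] \<alpha> \<beta> linear_0[OF dd_transition_linear[of \<beta> \<beta>' p]]
      transition_differentiable[of \<beta> \<beta>' p]
    by (simp add: extend_field_def)
qed

end

lemma cov_cong:
  assumes "open T" "x \<in> T" "\<And>y. y \<in> T \<Longrightarrow> \<phi> y = \<phi>' y" "\<And>y. y \<in> T \<Longrightarrow> P y = P' y"
    and "\<phi> differentiable at x" "P differentiable at x"
  shows "cov \<Gamma> \<phi> P x v = cov \<Gamma> \<phi>' P' x v"
  using frechet_derivative_transform_within_open[OF assms(5,1,2,3)]
    frechet_derivative_transform_within_open[OF assms(6,1,2,4)] assms(2-4)
  by (simp add: cov_def)

section \<open>Metrics and connections in charts\<close>

abbreviation coord_metric :: "('m, 'e) metric \<Rightarrow> ('m, 'e) chart \<Rightarrow> 'e \<Rightarrow> 'e \<Rightarrow> 'e \<Rightarrow> real" where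
  "coord_metric G \<beta> z \<equiv> G \<beta> (chart_inv \<beta> z)"

locale riemannian_manifold = smooth_manifold \<B>
  for \<B> :: "('n::{t2_space,second_countable_topology}, 'f::euclidean_space) chart set" +
  fixes G :: "('n, 'f) metric"
  assumes metric: "riemannian_metric \<B> G"
begin

lemma metric_inner: "\<beta> \<in> \<B> \<Longrightarrow> q \<in> fst \<beta> \<Longrightarrow> inner_form (G \<beta> q)"
  using metric unfolding riemannian_metric_def inner_form_def by blast

lemma metric_change:
  "\<beta> \<in> \<B> \<Longrightarrow> \<beta>' \<in> \<B> \<Longrightarrow> q \<in> fst \<beta> \<Longrightarrow> q \<in> fst \<beta>' \<Longrightarrow>
    G \<beta>' q (dd \<beta> (snd \<beta>') q u) (dd \<beta> (snd \<beta>') q v) = G \<beta> q u v"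
  using metric unfolding riemannian_metric_def by blast

lemma metric_domain_chart: "\<beta> \<in> \<B> \<Longrightarrow> metric_domain (snd \<beta> ` fst \<beta>) (coord_metric G \<beta>)"
proof (rule metric_domain.intro)
  assume \<beta>: "\<beta> \<in> \<B>"
  show "open (snd \<beta> ` fst \<beta>)" using chart[OF \<beta>] by (auto simp: is_chart_def)
  show "inner_form (coord_metric G \<beta> z)" if "z \<in> snd \<beta> ` fst \<beta>" for z
    using metric_inner[OF \<beta>] chart_inv_in[OF chart[OF \<beta>] that] by blast
  show "smooth_family (snd \<beta> ` fst \<beta>) (coord_metric G \<beta>)"
    using metric \<beta> unfolding riemannian_metric_def smooth_family_def by blast
qed

lemma levi_civita_eq_christoffel:
  "\<beta> \<in> \<B> \<Longrightarrow> q \<in> fst \<beta> \<Longrightarrow> levi_civita G \<beta> q = christoffel (coord_metric G \<beta>) (snd \<beta> q)"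
  by (simp add: levi_civita_def christoffel_def metric_compatible_def dd_def o_def chart_inv_snd[OF chart])

lemma curvature_eq_curv:
  assumes \<beta>: "\<beta> \<in> \<B>" "q \<in> fst \<beta>"
  shows "curvature (levi_civita G) \<beta> q u v w = curv (christoffel (coord_metric G \<beta>)) (snd \<beta> q) u v w"
proof -
  interpret D: metric_domain "snd \<beta> ` fst \<beta>" "coord_metric G \<beta>" by (rule metric_domain_chart[OF \<beta>(1)])
  have "frechet_derivative (\<lambda>y. D.\<Gamma> y v w) (at (snd \<beta> q)) =
      frechet_derivative ((\<lambda>q. levi_civita G \<beta> q v w) \<circ> chart_inv \<beta>) (at (snd \<beta> q))" for v w
    by (rule frechet_derivative_transform_within_open[OF D.christoffel_differentiable D.open_Z])
      (use \<beta> chart[OF \<beta>(1)] in \<open>auto simp: levi_civita_eq_christoffel chart_inv_snd\<close>)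
  then show ?thesis
    by (simp add: curvature_def nabla_def curv_def dd_def levi_civita_eq_christoffel[OF \<beta>] o_def)
qed

lemma nabla_along_eq_cov:
  assumes "\<beta> \<in> \<B>" "f p \<in> fst \<beta>" "is_chart \<alpha>" "p \<in> fst \<alpha>"
  shows "nabla_along (levi_civita G) f \<alpha> V p v \<beta> =
    cov (christoffel (coord_metric G \<beta>)) (snd \<beta> \<circ> f \<circ> chart_inv \<alpha>) (V \<beta> \<circ> chart_inv \<alpha>) (snd \<alpha> p) v"
  by (simp add: nabla_along_def cov_def dd_def levi_civita_eq_christoffel[OF assms(1,2)] chart_inv_snd[OF assms(3,4)])

text \<open>A transition map \<open>\<tau>\<close> is an isometry between the two coordinate
  metrics, and the components of \<open>V\<close> transform by its derivative. Thus
  \<open>cov_isometry\<close> applies.\<close>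

lemma nabla_along_change:
  fixes \<A> :: "('m::{t2_space,second_countable_topology}, 'e::euclidean_space) chart set"
  assumes \<beta>: "\<beta> \<in> \<B>" "\<beta>' \<in> \<B>" "f p \<in> fst \<beta>" "f p \<in> fst \<beta>'" and \<alpha>: "smooth_atlas \<A>" "\<alpha> \<in> \<A>" "p \<in> fst \<alpha>"
    and f: "smooth_map \<A> \<B> f" and U: "open U" "p \<in> U" and V: "vector_field_along \<A> \<B> f U V"
  shows "nabla_along (levi_civita G) f \<alpha> V p v \<beta>' =
    dd \<beta> (snd \<beta>') (f p) (nabla_along (levi_civita G) f \<alpha> V p v \<beta>)"
proof -
  interpret M: smooth_manifold \<A> by standard fact
  interpret D: metric_domain "snd \<beta> ` fst \<beta>" "coord_metric G \<beta>" by (rule metric_domain_chart[OF \<beta>(1)])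
  note ch = chart[OF \<beta>(1)] chart[OF \<beta>(2)] M.chart[OF \<alpha>(2)]
  define \<tau> where "\<tau> = snd \<beta>' \<circ> chart_inv \<beta>"
  define \<phi> where "\<phi> = snd \<beta> \<circ> f \<circ> chart_inv \<alpha>"
  define P where "P = V \<beta> \<circ> chart_inv \<alpha>"
  define S where "S = snd \<beta> ` (fst \<beta>' \<inter> fst \<beta>)"
  define x where "x = snd \<alpha> p"
  have contf: "continuous_on UNIV f" using f by (simp add: smooth_map_def)
  have px: "chart_inv \<alpha> x = p" by (simp add: x_def chart_inv_snd[OF ch(3) \<alpha>(3)])
  have \<phi>x: "\<phi> x = snd \<beta> (f p)" by (simp add: \<phi>_def px)
  have smf: "smooth_on (snd \<alpha> ` (f -` fst \<beta> \<inter> fst \<alpha>)) \<phi>"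
    using f \<beta> \<alpha> by (simp add: smooth_map_def smooth_fun_def \<phi>_def)
  have smV: "smooth_on (snd \<alpha> ` (U \<inter> f -` fst \<beta> \<inter> fst \<alpha>)) P"
    using V \<beta> \<alpha> by (simp add: vector_field_along_def smooth_fun_def P_def)
  have \<phi>d: "\<phi> differentiable at x"
    by (rule smooth_on_differentiable[OF smf]) (use \<alpha> \<beta> in \<open>auto simp: x_def\<close>)
  have Pd: "P differentiable at x"
    by (rule smooth_on_differentiable[OF smV]) (use \<alpha> \<beta> U in \<open>auto simp: x_def\<close>)
  have Dt: "frechet_derivative \<tau> (at (snd \<beta> q)) = dd \<beta> (snd \<beta>') q" for q
    by (simp add: dd_def \<tau>_def fun_eq_iff)
  have \<tau>q: "\<tau> (snd \<beta> q) = snd \<beta>' q" if "q \<in> fst \<beta>" for q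
    using that by (simp add: \<tau>_def chart_inv_snd[OF ch(1)])
  have \<tau>s: "smooth_on S \<tau>" unfolding \<tau>_def S_def by (rule transition_smooth[OF \<beta>(1,2)])
  have "surj (dd \<beta> (snd \<beta>') (f p))"
    by (metis \<beta> dd_inverse surjI)
  then have "cov (christoffel (coord_metric G \<beta>')) (\<lambda>x. \<tau> (\<phi> x)) (\<lambda>x. frechet_derivative \<tau> (at (\<phi> x)) (P x)) x v =
      frechet_derivative \<tau> (at (\<phi> x)) (cov D.\<Gamma> \<phi> P x v)"
  proof (intro D.cov_isometry[OF metric_domain_chart[OF \<beta>(2)], of S] \<phi>d Pd \<tau>s)
    show "S \<subseteq> snd \<beta> ` fst \<beta>" by (auto simp: S_def)
    show "\<phi> x \<in> S" using \<beta> by (simp add: \<phi>x S_def)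
    show "open S" unfolding S_def by (intro open_chart_image ch open_domain \<beta>)
    show "coord_metric G \<beta>' (\<tau> y) (frechet_derivative \<tau> (at y) u) (frechet_derivative \<tau> (at y) v) =
        coord_metric G \<beta> y u v" if "y \<in> S" for y u v
    proof -
      obtain q where "q \<in> fst \<beta>" "q \<in> fst \<beta>'" "y = snd \<beta> q" using \<open>y \<in> S\<close> by (auto simp: S_def)
      then show ?thesis
        using metric_change[OF \<beta>(1,2)] by (simp add: Dt \<tau>q chart_inv_snd[OF ch(1)] chart_inv_snd[OF ch(2)])
    qed
    show "\<tau> ` S \<subseteq> snd \<beta>' ` fst \<beta>'"
      by (auto simp: S_def \<tau>q)
  qed (simp add: \<phi>x Dt)
  moreover have "cov (christoffel (coord_metric G \<beta>')) (snd \<beta>' \<circ> f \<circ> chart_inv \<alpha>) (V \<beta>' \<circ> chart_inv \<alpha>) x v =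
      cov (christoffel (coord_metric G \<beta>')) (\<lambda>x. \<tau> (\<phi> x)) (\<lambda>x. frechet_derivative \<tau> (at (\<phi> x)) (P x)) x v"
  proof (rule cov_cong)
    let ?W = "U \<inter> f -` fst \<beta> \<inter> f -` fst \<beta>'"
    have "open ?W"
      by (intro open_Int U open_vimage open_domain \<beta> contf)
    then show "open (snd \<alpha> ` (?W \<inter> fst \<alpha>))"
      by (rule open_chart_image[OF ch(3)])
    show "x \<in> snd \<alpha> ` (?W \<inter> fst \<alpha>)" using U \<beta> \<alpha> by (auto simp: x_def)
    fix y assume "y \<in> snd \<alpha> ` (?W \<inter> fst \<alpha>)"
    then obtain q where q: "q \<in> U" "f q \<in> fst \<beta>" "f q \<in> fst \<beta>'" "q \<in> fst \<alpha>" "y = snd \<alpha> q" by auto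
    show "(snd \<beta>' \<circ> f \<circ> chart_inv \<alpha>) y = \<tau> (\<phi> y)"
      using q by (simp add: \<tau>_def \<phi>_def chart_inv_snd[OF ch(1)] chart_inv_snd[OF ch(3)])
    show "(V \<beta>' \<circ> chart_inv \<alpha>) y = frechet_derivative \<tau> (at (\<phi> y)) (P y)"
    proof -
      have "V \<beta>' q = dd \<beta> (snd \<beta>') (f q) (V \<beta> q)"
        using V q \<beta> unfolding vector_field_along_def by blast
      then show ?thesis using q by (simp add: chart_inv_snd[OF ch(3)] \<phi>_def Dt P_def)
    qed
  next
    show "(snd \<beta>' \<circ> f \<circ> chart_inv \<alpha>) differentiable at x"
      by (rule smooth_on_differentiable[where S = "snd \<alpha> ` (f -` fst \<beta>' \<inter> fst \<alpha>)"])
        (use f \<beta> \<alpha> in \<open>auto simp: smooth_map_def smooth_fun_def x_def\<close>)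
    show "(V \<beta>' \<circ> chart_inv \<alpha>) differentiable at x"
      by (rule smooth_on_differentiable[where S = "snd \<alpha> ` (U \<inter> f -` fst \<beta>' \<inter> fst \<alpha>)"])
        (use V \<beta> \<alpha> U in \<open>auto simp: vector_field_along_def smooth_fun_def x_def\<close>)
  qed
  ultimately show ?thesis
    unfolding nabla_along_eq_cov[where f = f, OF \<beta>(1,3) ch(3) \<alpha>(3)]
      nabla_along_eq_cov[where f = f, OF \<beta>(2,4) ch(3) \<alpha>(3)]
    by (simp add: \<phi>_def[symmetric] P_def[symmetric] x_def[symmetric] \<phi>x Dt)
qed

end

section \<open>Real hypersurfaces\<close>

text \<open>\<open>w\<close> is arbitrary outside \<open>S\<close>. The open sets \<open>S\<close>
  and \<open>- K\<close> cover the space: on the first both factors are smooth, on the second the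
  product is zero.\<close>

lemma smooth_on_bump_scaleR:
  fixes w :: "'a::real_normed_vector \<Rightarrow> 'b::real_normed_vector"
  assumes b: "smooth_on UNIV b" "\<And>y. y \<notin> K \<Longrightarrow> b y = 0" and K: "compact K" "K \<subseteq> S"
    and S: "open S" "smooth_on S w"
  shows "smooth_on UNIV (\<lambda>y. b y *\<^sub>R w y)"
proof (rule smooth_on_local)
  fix y :: 'a
  have "open (- K)" using compact_imp_closed[OF K(1)] by auto
  have "smooth_on S (\<lambda>y. b y *\<^sub>R w y)"
    by (intro smooth_on_scaleR S smooth_on_subset[OF b(1)]) auto
  moreover have "smooth_on (- K) (\<lambda>y. b y *\<^sub>R w y)"
    by (rule smooth_on_cong[OF \<open>open (- K)\<close> _ smooth_on_const[OF \<open>open (- K)\<close>, of 0]]) (simp add: b)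
  ultimately show "\<exists>T. open T \<and> y \<in> T \<and> smooth_on T (\<lambda>y. b y *\<^sub>R w y)"
    using S(1) \<open>open (- K)\<close> K(2) by (metis ComplI subsetD)
qed

locale hypersurface = riemannian_manifold \<B> G
  for \<B> :: "('a::{t2_space,second_countable_topology}, complex ^ 2) chart set" and G +
  fixes \<A> :: "('m::{t2_space,second_countable_topology}, real ^ 3) chart set" and f :: "'m \<Rightarrow> 'a"
  assumes hyp: "real_hypersurface \<B> \<A> f"
    and holomorphic: "complex_atlas \<B>" and kaehler: "kaehler_metric \<B> G"
begin

sublocale M: smooth_manifold \<A>
  using hyp by unfold_locales (simp add: real_hypersurface_def)

lemma immersion_f: "immersion \<A> \<B> f"
  using hyp by (simp add: real_hypersurface_def)

lemma smooth_map_f: "smooth_map \<A> \<B> f"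
  using immersion_f by (simp add: immersion_def)

lemma cont_f: "continuous_on UNIV f"
  using smooth_map_f by (simp add: smooth_map_def)

lemma smooth_f:
  "\<alpha> \<in> \<A> \<Longrightarrow> \<beta> \<in> \<B> \<Longrightarrow> smooth_on (snd \<alpha> ` (f -` fst \<beta> \<inter> fst \<alpha>)) (snd \<beta> \<circ> f \<circ> chart_inv \<alpha>)"
  using smooth_map_f by (simp add: smooth_map_def smooth_fun_def)

abbreviation df :: "('m, real ^ 3) chart \<Rightarrow> ('a, complex ^ 2) chart \<Rightarrow> 'm \<Rightarrow> real ^ 3 \<Rightarrow> complex ^ 2" where
  "df \<alpha> \<beta> p \<equiv> dd \<alpha> (snd \<beta> \<circ> f) p"

lemma differentiable_f:
  "\<alpha> \<in> \<A> \<Longrightarrow> \<beta> \<in> \<B> \<Longrightarrow> p \<in> fst \<alpha> \<Longrightarrow> f p \<in> fst \<beta> \<Longrightarrow> (snd \<beta> \<circ> f \<circ> chart_inv \<alpha>) differentiable at (snd \<alpha> p)"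
  by (rule smooth_on_differentiable[OF smooth_f]) auto

lemma df_linear: "\<alpha> \<in> \<A> \<Longrightarrow> \<beta> \<in> \<B> \<Longrightarrow> p \<in> fst \<alpha> \<Longrightarrow> f p \<in> fst \<beta> \<Longrightarrow> linear (df \<alpha> \<beta> p)"
  by (intro dd_linear differentiable_f)

lemma df_inj: "\<alpha> \<in> \<A> \<Longrightarrow> \<beta> \<in> \<B> \<Longrightarrow> p \<in> fst \<alpha> \<Longrightarrow> f p \<in> fst \<beta> \<Longrightarrow> inj (df \<alpha> \<beta> p)"
  using immersion_f by (simp add: immersion_def)

lemma df_change_target:
  assumes "\<alpha> \<in> \<A>" "\<beta> \<in> \<B>" "\<beta>' \<in> \<B>" "p \<in> fst \<alpha>" "f p \<in> fst \<beta>" "f p \<in> fst \<beta>'"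
  shows "dd \<beta> (snd \<beta>') (f p) (df \<alpha> \<beta> p v) = df \<alpha> \<beta>' p v"
  using dd_compose[where f = f and H = "snd \<beta>'" and \<alpha> = \<alpha> and \<beta> = \<beta>, OF M.chart _ chart _ cont_f differentiable_f] assms
  by (simp add: transition_differentiable)

lemma df_change_source:
  assumes "\<alpha> \<in> \<A>" "\<alpha>' \<in> \<A>" "\<beta> \<in> \<B>" "p \<in> fst \<alpha>" "p \<in> fst \<alpha>'" "f p \<in> fst \<beta>"
  shows "df \<alpha>' \<beta> p (dd \<alpha> (snd \<alpha>') p v) = df \<alpha> \<beta> p v"
  by (rule M.dd_change) (use assms differentiable_f in auto)

lemma dd_J:
  "\<beta> \<in> \<B> \<Longrightarrow> \<beta>' \<in> \<B> \<Longrightarrow> q \<in> fst \<beta> \<Longrightarrow> q \<in> fst \<beta>' \<Longrightarrow> dd \<beta> (snd \<beta>') q (J v) = J (dd \<beta> (snd \<beta>') q v)"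
  using holomorphic by (simp add: complex_atlas_def)

lemma metric_J: "\<beta> \<in> \<B> \<Longrightarrow> q \<in> fst \<beta> \<Longrightarrow> G \<beta> q (J u) (J v) = G \<beta> q u v"
  using kaehler by (simp add: kaehler_metric_def)

lemma metric_bilinear: "\<beta> \<in> \<B> \<Longrightarrow> q \<in> fst \<beta> \<Longrightarrow> bilinear (G \<beta> q)"
  by (intro inner_form_bilinear metric_inner)

text \<open>Applying the isometry \<open>J\<close> to both arguments turns \<open>G (J u) u\<close>
  into its negative, because the square of \<open>J\<close> is -1.\<close>

lemma metric_J_self: "\<beta> \<in> \<B> \<Longrightarrow> q \<in> fst \<beta> \<Longrightarrow> G \<beta> q (J u) u = 0" "\<beta> \<in> \<B> \<Longrightarrow> q \<in> fst \<beta> \<Longrightarrow> G \<beta> q u (J u) = 0"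
proof -
  assume \<beta>: "\<beta> \<in> \<B>" "q \<in> fst \<beta>"
  have "G \<beta> q (J (J u)) (J u) = G \<beta> q (J u) u" by (rule metric_J[OF \<beta>])
  then show "G \<beta> q (J u) u = 0" "G \<beta> q u (J u) = 0"
    using inner_form_commute[OF metric_inner[OF \<beta>], of u "J u"]
    by (simp_all add: J_J bilinear_lneg[OF metric_bilinear[OF \<beta>]])
qed

definition coord_dom :: "'m set \<Rightarrow> ('m, real ^ 3) chart \<Rightarrow> ('a, complex ^ 2) chart \<Rightarrow> (real ^ 3) set" where
  "coord_dom U \<alpha> \<beta> = snd \<alpha> ` (U \<inter> f -` fst \<beta> \<inter> fst \<alpha>)"

lemma open_dom: "open U \<Longrightarrow> \<alpha> \<in> \<A> \<Longrightarrow> \<beta> \<in> \<B> \<Longrightarrow> open (coord_dom U \<alpha> \<beta>)"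
  unfolding coord_dom_def by (intro open_chart_image M.chart open_Int open_vimage open_domain cont_f)

lemma smooth_f_dom: "\<alpha> \<in> \<A> \<Longrightarrow> \<beta> \<in> \<B> \<Longrightarrow> smooth_on (coord_dom U \<alpha> \<beta>) (snd \<beta> \<circ> f \<circ> chart_inv \<alpha>)"
  by (rule smooth_on_subset[OF smooth_f]) (auto simp: coord_dom_def)

lemma f_dom: "\<alpha> \<in> \<A> \<Longrightarrow> (snd \<beta> \<circ> f \<circ> chart_inv \<alpha>) ` coord_dom U \<alpha> \<beta> \<subseteq> snd \<beta> ` fst \<beta>"
  by (auto simp: coord_dom_def chart_inv_snd[OF M.chart])

text \<open>The condition on the shape operator is quantified over unit normal fields; existence
  around each point keeps it from being vacuous.\<close>

lemma unit_normal_exists: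
  obtains U N where "unit_normal_field \<B> G \<A> f U N" "p \<in> U"
proof -
  define \<alpha> where "\<alpha> = chart_at \<A> p"
  define \<beta> where "\<beta> = chart_at \<B> (f p)"
  have \<alpha>: "\<alpha> \<in> \<A>" "p \<in> fst \<alpha>" and \<beta>: "\<beta> \<in> \<B>" "f p \<in> fst \<beta>"
    by (simp_all add: \<alpha>_def \<beta>_def chart_at M.chart_at)
  note ch = M.chart[OF \<alpha>(1)] chart[OF \<beta>(1)]
  interpret D: metric_domain "snd \<beta> ` fst \<beta>" "coord_metric G \<beta>" by (rule metric_domain_chart[OF \<beta>(1)])
  define \<phi> where "\<phi> = snd \<beta> \<circ> f \<circ> chart_inv \<alpha>"
  define S where "S = coord_dom UNIV \<alpha> \<beta>"
  have S: "open S" "smooth_on S \<phi>" "\<phi> ` S \<subseteq> snd \<beta> ` fst \<beta>"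
    unfolding S_def \<phi>_def using open_dom smooth_f_dom f_dom \<alpha> \<beta> by auto
  have x: "snd \<alpha> p \<in> S" using \<alpha> \<beta> by (simp add: S_def coord_dom_def)
  have D\<phi>: "frechet_derivative \<phi> (at (snd \<alpha> q)) = df \<alpha> \<beta> q" for q
    by (simp add: dd_def \<phi>_def fun_eq_iff)
  have inj: "inj (frechet_derivative \<phi> (at y))" if "y \<in> S" for y
    using that df_inj[OF \<alpha>(1) \<beta>(1)] by (auto simp: S_def coord_dom_def D\<phi>)
  have dim: "DIM(real ^ 3) < DIM(complex ^ 2)" by simp
  obtain S' N where N: "open S'" "S' \<subseteq> S" "snd \<alpha> p \<in> S'" "smooth_on S' N"
    "\<And>y. y \<in> S' \<Longrightarrow> coord_metric G \<beta> (\<phi> y) (N y) (N y) = 1"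
    "\<And>y v. y \<in> S' \<Longrightarrow> coord_metric G \<beta> (\<phi> y) (frechet_derivative \<phi> (at y) v) (N y) = 0"
    by (rule D.smooth_unit_normal[OF S x inj dim]) blast+
  define U where "U = {q \<in> fst \<alpha>. snd \<alpha> q \<in> S'}"
  have U: "open U" unfolding U_def by (rule open_chart_preimage[OF ch(1) N(1)])
  have Uf: "q \<in> fst \<alpha>" "f q \<in> fst \<beta>" "snd \<alpha> q \<in> S'" if "q \<in> U" for q
  proof -
    have "snd \<alpha> q \<in> S" and q: "q \<in> fst \<alpha>" "snd \<alpha> q \<in> S'" using that N(2) by (auto simp: U_def)
    then obtain q' where "q' \<in> fst \<alpha>" "f q' \<in> fst \<beta>" "snd \<alpha> q' = snd \<alpha> q" by (auto simp: S_def coord_dom_def)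
    then show "q \<in> fst \<alpha>" "f q \<in> fst \<beta>" "snd \<alpha> q \<in> S'"
      using q chart_inv_snd[OF ch(1)] by metis+
  qed
  \<comment> \<open>The normal is constructed in the chart \<beta> and carried to every other chart
    by the derivative of the transition map, so that compatibility becomes the chain rule.\<close>
  define V where "V \<beta>' q = dd \<beta> (snd \<beta>') (f q) (N (snd \<alpha> q))" for \<beta>' :: "('a, complex ^ 2) chart" and q
  have \<phi>q: "chart_inv \<beta> (\<phi> (snd \<alpha> q)) = f q" if "q \<in> U" for q
    using Uf[OF that] by (simp add: \<phi>_def chart_inv_snd[OF ch(1)] chart_inv_snd[OF ch(2)])
  have nn: "G \<beta> (f q) (N (snd \<alpha> q)) (N (snd \<alpha> q)) = 1"
    and nT: "G \<beta> (f q) (df \<alpha> \<beta> q v) (N (snd \<alpha> q)) = 0" if "q \<in> U" for q v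
    using N(5)[OF Uf(3)[OF that]] N(6)[OF Uf(3)[OF that], of v] by (simp_all add: \<phi>q[OF that] D\<phi>)
  have "vector_field_along \<A> \<B> f U V"
    unfolding vector_field_along_def smooth_fun_def
  proof (intro conjI ballI impI)
    fix \<beta>' \<gamma> assume \<beta>': "\<beta>' \<in> \<B>" and \<gamma>: "\<gamma> \<in> \<A>"
    define T where "T = snd \<gamma> ` (U \<inter> f -` fst \<beta>' \<inter> fst \<gamma>)"
    have T: "open T"
      unfolding T_def by (intro open_chart_image M.chart \<gamma> open_Int U open_vimage open_domain \<beta>' cont_f)
    let ?\<tau> = "snd \<beta>' \<circ> chart_inv \<beta>" and ?\<psi> = "snd \<beta> \<circ> f \<circ> chart_inv \<gamma>" and ?\<sigma> = "snd \<alpha> \<circ> chart_inv \<gamma>"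
    have \<tau>: "smooth_on (snd \<beta> ` (fst \<beta>' \<inter> fst \<beta>)) ?\<tau>" by (rule transition_smooth[OF \<beta>(1) \<beta>'])
    have \<psi>: "smooth_on T ?\<psi>"
      by (rule smooth_on_subset[OF smooth_f[OF \<gamma> \<beta>(1)]]) (use Uf in \<open>auto simp: T_def\<close>)
    have \<psi>T: "?\<psi> ` T \<subseteq> snd \<beta> ` (fst \<beta>' \<inter> fst \<beta>)"
      using Uf by (auto simp: T_def chart_inv_snd[OF M.chart[OF \<gamma>]])
    have \<sigma>: "smooth_on T ?\<sigma>"
      by (rule smooth_on_subset[OF M.transition_smooth[OF \<gamma> \<alpha>(1)]]) (use Uf in \<open>auto simp: T_def\<close>)
    have "smooth_on T (\<lambda>y. frechet_derivative ?\<tau> (at (?\<psi> y)) (N (?\<sigma> y)))"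
    proof (rule smooth_on_linear_family[where L = "\<lambda>y. frechet_derivative ?\<tau> (at (?\<psi> y))"
          and P = "\<lambda>y. N (?\<sigma> y)", OF T])
      show "linear (frechet_derivative ?\<tau> (at (?\<psi> y)))" if "y \<in> T" for y
        using smooth_on_differentiable[OF \<tau>] \<psi>T that by (intro linear_frechet_derivative) blast
      show "smooth_on T (\<lambda>y. frechet_derivative ?\<tau> (at (?\<psi> y)) u)" for u
        by (rule smooth_on_compose[OF T \<psi> smooth_on_deriv[OF \<tau>] \<psi>T])
      show "smooth_on T (\<lambda>y. N (?\<sigma> y))"
        by (rule smooth_on_compose[OF T \<sigma> N(4)])
          (use Uf in \<open>auto simp: T_def chart_inv_snd[OF M.chart[OF \<gamma>]]\<close>)
    qed
    then have "smooth_on T (V \<beta>' \<circ> chart_inv \<gamma>)"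
      by (rule smooth_on_cong[OF T, rotated]) (simp add: V_def dd_def)
    then show "smooth_on (snd \<gamma> ` (U \<inter> f -` fst \<beta>' \<inter> fst \<gamma>)) (V \<beta>' \<circ> chart_inv \<gamma>)"
      by (simp add: T_def)
  next
    fix \<beta>1 \<beta>2 q assume "\<beta>1 \<in> \<B>" "\<beta>2 \<in> \<B>" "q \<in> U" "f q \<in> fst \<beta>1 \<inter> fst \<beta>2"
    then show "V \<beta>2 q = dd \<beta>1 (snd \<beta>2) (f q) (V \<beta>1 q)"
      using \<beta>(1) Uf(2)[of q] by (simp add: V_def dd_change transition_differentiable)
  qed
  then have "unit_normal_field \<B> G \<A> f U V"
    unfolding unit_normal_field_def
  proof (intro conjI ballI impI allI U)
    fix \<beta>' q assume \<beta>': "\<beta>' \<in> \<B>" and "q \<in> U \<inter> f -` fst \<beta>'"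
    then have q: "q \<in> U" "f q \<in> fst \<beta>'" by auto
    note change = metric_change[OF \<beta>(1) \<beta>' Uf(2)[OF q(1)] q(2)]
    show "G \<beta>' (f q) (V \<beta>' q) (V \<beta>' q) = 1"
      by (simp add: V_def change nn[OF q(1)])
    fix \<alpha>' v assume "\<alpha>' \<in> \<A>" "q \<in> fst \<alpha>'"
    then have "df \<alpha>' \<beta>' q v = df \<alpha> \<beta>' q (dd \<alpha>' (snd \<alpha>) q v)"
      using \<alpha>(1) \<beta>' q Uf(1)[OF q(1)] by (simp add: df_change_source)
    also have "\<dots> = dd \<beta> (snd \<beta>') (f q) (df \<alpha> \<beta> q (dd \<alpha>' (snd \<alpha>) q v))"
      using \<alpha>(1) \<beta>(1) \<beta>' q Uf[OF q(1)] by (simp add: df_change_target)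
    finally show "G \<beta>' (f q) (df \<alpha>' \<beta>' q v) (V \<beta>' q) = 0"
      by (simp add: V_def change nT[OF q(1)])
  qed
  moreover have "p \<in> U" using \<alpha> N(3) by (simp add: U_def)
  ultimately show ?thesis by (rule that)
qed

section \<open>Shape operator and structure field of a local unit normal\<close>

context
  fixes U N
  assumes unf: "unit_normal_field \<B> G \<A> f U N"
begin

lemma open_U: "open U"
  and N_along: "vector_field_along \<A> \<B> f U N"
  and N_unit: "\<beta> \<in> \<B> \<Longrightarrow> p \<in> U \<Longrightarrow> f p \<in> fst \<beta> \<Longrightarrow> G \<beta> (f p) (N \<beta> p) (N \<beta> p) = 1"
  and N_normal: "\<alpha> \<in> \<A> \<Longrightarrow> \<beta> \<in> \<B> \<Longrightarrow> p \<in> U \<Longrightarrow> f p \<in> fst \<beta> \<Longrightarrow> p \<in> fst \<alpha> \<Longrightarrow>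
    G \<beta> (f p) (df \<alpha> \<beta> p v) (N \<beta> p) = 0"
  using unf unfolding unit_normal_field_def by auto

lemma N_change: "\<beta> \<in> \<B> \<Longrightarrow> \<beta>' \<in> \<B> \<Longrightarrow> p \<in> U \<Longrightarrow> f p \<in> fst \<beta> \<Longrightarrow> f p \<in> fst \<beta>' \<Longrightarrow>
    N \<beta>' p = dd \<beta> (snd \<beta>') (f p) (N \<beta> p)"
  using N_along unfolding vector_field_along_def by blast

lemma N_ne_0: "\<beta> \<in> \<B> \<Longrightarrow> p \<in> U \<Longrightarrow> f p \<in> fst \<beta> \<Longrightarrow> N \<beta> p \<noteq> 0"
  using N_unit[of \<beta> p] bilinear_lzero[OF metric_bilinear[of \<beta> "f p"], of "N \<beta> p"] by auto

lemma
  assumes p: "\<alpha> \<in> \<A>" "\<beta> \<in> \<B>" "p \<in> U" "f p \<in> fst \<beta>" "p \<in> fst \<alpha>"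
  shows range_if_tangent: "G \<beta> (f p) u (N \<beta> p) = 0 \<Longrightarrow> u \<in> range (df \<alpha> \<beta> p)"
    and normal_multiple: "(\<And>v. G \<beta> (f p) (df \<alpha> \<beta> p v) u = 0) \<Longrightarrow> \<exists>k. u = k *\<^sub>R N \<beta> p"
proof -
  have dim: "DIM(complex ^ 2) = Suc DIM(real ^ 3)" by simp
  note h = metric_inner[OF p(2,4)] df_linear[OF p(1,2,5,4)] df_inj[OF p(1,2,5,4)] N_normal[OF p] N_ne_0[OF p(2-4)] dim
  show "G \<beta> (f p) u (N \<beta> p) = 0 \<Longrightarrow> u \<in> range (df \<alpha> \<beta> p)"
    by (rule normal_imp_range[OF h])
  show "(\<And>v. G \<beta> (f p) (df \<alpha> \<beta> p v) u = 0) \<Longrightarrow> \<exists>k. u = k *\<^sub>R N \<beta> p"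
    by (rule normal_unique[OF h])
qed

text \<open>\<open>- J N\<close> is tangent because \<open>J N\<close> is orthogonal to
  \<open>N\<close>, so the description in \<open>structure_field\<close> has a solution; injectivity
  of the differential makes it unique.\<close>

lemma eta_eq:
  assumes \<alpha>: "\<alpha> \<in> \<A>" "p \<in> U" "p \<in> fst \<alpha>"
  shows "eta \<B> G f N \<alpha> p v =
    - G (chart_at \<B> (f p)) (f p) (df \<alpha> (chart_at \<B> (f p)) p v) (J (N (chart_at \<B> (f p)) p))"
proof -
  define \<beta> where "\<beta> = chart_at \<B> (f p)"
  have \<beta>: "\<beta> \<in> \<B>" "f p \<in> fst \<beta>" by (simp_all add: \<beta>_def chart_at)
  have "G \<beta> (f p) (- J (N \<beta> p)) (N \<beta> p) = 0"
    by (simp add: bilinear_lneg[OF metric_bilinear[OF \<beta>]] metric_J_self[OF \<beta>])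
  then obtain \<xi> where \<xi>: "df \<alpha> \<beta> p \<xi> = - J (N \<beta> p)"
    using range_if_tangent[OF \<alpha>(1) \<beta>(1) \<alpha>(2) \<beta>(2) \<alpha>(3)] by (metis rangeE)
  have "structure_field \<B> f N \<alpha> p = \<xi>"
    unfolding structure_field_def Let_def \<beta>_def[symmetric]
    using \<xi> injD[OF df_inj[OF \<alpha>(1) \<beta>(1) \<alpha>(3) \<beta>(2)]] by (intro the_equality) simp_all
  then show ?thesis
    by (simp add: eta_def induced_metric_def Let_def \<beta>_def[symmetric] \<xi> bilinear_rneg[OF metric_bilinear[OF \<beta>]])
qed

lemma smooth_N_dom: "\<alpha> \<in> \<A> \<Longrightarrow> \<beta> \<in> \<B> \<Longrightarrow> smooth_on (coord_dom U \<alpha> \<beta>) (N \<beta> \<circ> chart_inv \<alpha>)"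
  using N_along by (simp add: vector_field_along_def smooth_fun_def coord_dom_def)

lemma differentiable_N:
  "\<alpha> \<in> \<A> \<Longrightarrow> \<beta> \<in> \<B> \<Longrightarrow> p \<in> U \<Longrightarrow> f p \<in> fst \<beta> \<Longrightarrow> p \<in> fst \<alpha> \<Longrightarrow>
    (N \<beta> \<circ> chart_inv \<alpha>) differentiable at (snd \<alpha> p)"
  by (rule smooth_on_differentiable[OF smooth_N_dom]) (auto simp: coord_dom_def)

lemma nabla_N_linear:
  assumes \<alpha>: "\<alpha> \<in> \<A>" "p \<in> U" "p \<in> fst \<alpha>" and \<beta>: "\<beta> \<in> \<B>" "f p \<in> fst \<beta>"
  shows "linear (\<lambda>v. nabla_along (levi_civita G) f \<alpha> N p v \<beta>)"
proof -
  interpret D: metric_domain "snd \<beta> ` fst \<beta>" "coord_metric G \<beta>" by (rule metric_domain_chart[OF \<beta>(1)])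
  have z: "snd \<beta> (f p) \<in> snd \<beta> ` fst \<beta>" using \<beta> by simp
  note bl = D.christoffel_bilinear[OF z]
  have N: "linear (dd \<alpha> (N \<beta>) p)" by (intro dd_linear differentiable_N \<alpha> \<beta>)
  have df: "linear (df \<alpha> \<beta> p)" by (intro df_linear \<alpha> \<beta>)
  show ?thesis
    unfolding nabla_along_def levi_civita_eq_christoffel[OF \<beta>]
    by (rule linearI) (simp_all add: linear_add[OF N] linear_scale[OF N] linear_add[OF df] linear_scale[OF df]
        bilinear_ladd[OF bl] bilinear_lmul[OF bl] scaleR_add_right)
qed

text \<open>Twice this product is the derivative of the constant function
  \<open>G (N, N) = 1\<close>.\<close>

lemma nabla_N_tangent:
  assumes \<alpha>: "\<alpha> \<in> \<A>" "p \<in> U" "p \<in> fst \<alpha>" and \<beta>: "\<beta> \<in> \<B>" "f p \<in> fst \<beta>"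
  shows "G \<beta> (f p) (nabla_along (levi_civita G) f \<alpha> N p v \<beta>) (N \<beta> p) = 0"
proof -
  interpret D: metric_domain "snd \<beta> ` fst \<beta>" "coord_metric G \<beta>" by (rule metric_domain_chart[OF \<beta>(1)])
  define \<phi> where "\<phi> = snd \<beta> \<circ> f \<circ> chart_inv \<alpha>"
  define P where "P = N \<beta> \<circ> chart_inv \<alpha>"
  note ch = M.chart[OF \<alpha>(1)] chart[OF \<beta>(1)]
  have x: "snd \<alpha> p \<in> coord_dom U \<alpha> \<beta>" using \<alpha> \<beta> by (simp add: coord_dom_def)
  have px: "\<phi> (snd \<alpha> q) = snd \<beta> (f q)" "P (snd \<alpha> q) = N \<beta> q" if "q \<in> fst \<alpha>" for q
    using that by (simp_all add: \<phi>_def P_def chart_inv_snd[OF ch(1)])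
  have d: "\<phi> differentiable at (snd \<alpha> p)" "P differentiable at (snd \<alpha> p)" "P differentiable at (snd \<alpha> p)"
    unfolding \<phi>_def P_def by (intro differentiable_f differentiable_N \<alpha> \<beta>)+
  have z: "\<phi> (snd \<alpha> p) \<in> snd \<beta> ` fst \<beta>" using \<beta> by (simp add: px \<alpha>)
  have "((\<lambda>y. coord_metric G \<beta> (\<phi> y) (P y) (P y)) has_derivative
      (\<lambda>w. coord_metric G \<beta> (\<phi> (snd \<alpha> p)) (cov D.\<Gamma> \<phi> P (snd \<alpha> p) w) (P (snd \<alpha> p)) +
        coord_metric G \<beta> (\<phi> (snd \<alpha> p)) (P (snd \<alpha> p)) (cov D.\<Gamma> \<phi> P (snd \<alpha> p) w))) (at (snd \<alpha> p))"
    by (rule D.has_derivative_metric_along[OF z d])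
  then have "((\<lambda>y. 1) has_derivative
      (\<lambda>w. coord_metric G \<beta> (\<phi> (snd \<alpha> p)) (cov D.\<Gamma> \<phi> P (snd \<alpha> p) w) (P (snd \<alpha> p)) +
        coord_metric G \<beta> (\<phi> (snd \<alpha> p)) (P (snd \<alpha> p)) (cov D.\<Gamma> \<phi> P (snd \<alpha> p) w))) (at (snd \<alpha> p))"
    by (rule has_derivative_transform_within_open[OF _ open_dom[OF open_U \<alpha>(1) \<beta>(1)] x])
      (use N_unit[OF \<beta>(1)] in \<open>auto simp: coord_dom_def px chart_inv_snd[OF ch(2)]\<close>)
  from fun_cong[OF frechet_derivative_eqI[OF this], of v]
  have "2 * G \<beta> (f p) (cov D.\<Gamma> \<phi> P (snd \<alpha> p) v) (N \<beta> p) = 0"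
    by (simp add: px \<alpha> chart_inv_snd[OF ch(2) \<beta>(2)] inner_form_commute[OF metric_inner[OF \<beta>], of "N \<beta> p"])
  then show ?thesis
    by (simp add: nabla_along_eq_cov[where f = f, OF \<beta> ch(1) \<alpha>(3)] \<phi>_def P_def)
qed

text \<open>Existence of the described vector is tangency of the derivative of \<open>N\<close>, and
  uniqueness is injectivity of the differential. The formula is stated in the chart selected by
  \<open>chart_at\<close>, which is the one used in the definition.\<close>

lemma shape_operator_eq:
  assumes \<alpha>: "\<alpha> \<in> \<A>" "p \<in> U" "p \<in> fst \<alpha>"
  defines "\<beta> \<equiv> chart_at \<B> (f p)"
  shows "nabla_along (levi_civita G) f \<alpha> N p v \<beta> = - df \<alpha> \<beta> p (shape_operator \<B> G f N \<alpha> p v)"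
proof -
  have \<beta>: "\<beta> \<in> \<B>" "f p \<in> fst \<beta>" by (simp_all add: \<beta>_def chart_at)
  obtain a where "nabla_along (levi_civita G) f \<alpha> N p v \<beta> = df \<alpha> \<beta> p a"
    using range_if_tangent[OF \<alpha>(1) \<beta>(1) \<alpha>(2) \<beta>(2) \<alpha>(3) nabla_N_tangent[OF \<alpha> \<beta>]] by blast
  then have a: "nabla_along (levi_civita G) f \<alpha> N p v \<beta> = - df \<alpha> \<beta> p (- a)"
    using linear_neg[OF df_linear[OF \<alpha>(1) \<beta>(1) \<alpha>(3) \<beta>(2)], of a] by simp
  have "shape_operator \<B> G f N \<alpha> p v = - a"
    unfolding shape_operator_def Let_def \<beta>_def[symmetric]
    using a df_inj[OF \<alpha>(1) \<beta>(1) \<alpha>(3) \<beta>(2)] by (intro the_equality) (auto dest: injD)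
  then show ?thesis using a by simp
qed

lemma shape_operator_linear:
  assumes \<alpha>: "\<alpha> \<in> \<A>" "p \<in> U" "p \<in> fst \<alpha>"
  shows "linear (shape_operator \<B> G f N \<alpha> p)"
proof -
  define \<beta> where "\<beta> = chart_at \<B> (f p)"
  have \<beta>: "\<beta> \<in> \<B>" "f p \<in> fst \<beta>" by (simp_all add: \<beta>_def chart_at)
  note df = df_linear[OF \<alpha>(1) \<beta>(1) \<alpha>(3) \<beta>(2)]
  note nb = nabla_N_linear[OF \<alpha> \<beta>]
  have A: "df \<alpha> \<beta> p (shape_operator \<B> G f N \<alpha> p v) = - nabla_along (levi_civita G) f \<alpha> N p v \<beta>" for v
    using shape_operator_eq[OF \<alpha>] by (simp add: \<beta>_def)
  show ?thesis
    by (rule linearI; rule injD[OF df_inj[OF \<alpha>(1) \<beta>(1) \<alpha>(3) \<beta>(2)]])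
      (simp_all add: linear_add[OF df] linear_scale[OF df] A linear_add[OF nb] linear_scale[OF nb])
qed

end

text \<open>\<open>valued_in_D\<close> tests against every local unit normal in every chart. Normals
  at \<open>p\<close> are proportional, and ambient transition maps preserve \<open>G\<close> and
  \<open>J\<close>, so one test at \<open>p\<close> decides all of them.\<close>

lemma eta_eq_0:
  assumes N: "unit_normal_field \<B> G \<A> f U N" "unit_normal_field \<B> G \<A> f U' N'"
    and p: "p \<in> U" "p \<in> U'" "\<alpha> \<in> \<A>" "\<alpha>' \<in> \<A>" "p \<in> fst \<alpha>" "p \<in> fst \<alpha>'" and \<beta>: "\<beta> \<in> \<B>" "f p \<in> fst \<beta>"
    and v: "G \<beta> (f p) (df \<alpha> \<beta> p v) (J (N \<beta> p)) = 0"
  shows "eta \<B> G f N' \<alpha>' p (dd \<alpha> (snd \<alpha>') p v) = 0"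
proof -
  define \<beta>' where "\<beta>' = chart_at \<B> (f p)"
  have \<beta>': "\<beta>' \<in> \<B>" "f p \<in> fst \<beta>'" by (simp_all add: \<beta>'_def chart_at)
  obtain k where k: "N' \<beta> p = k *\<^sub>R N \<beta> p"
    using normal_multiple[OF N(1) p(3) \<beta>(1) p(1) \<beta>(2) p(5)] N_normal[OF N(2) p(3) \<beta>(1) p(2) \<beta>(2) p(5)] by blast
  have "eta \<B> G f N' \<alpha>' p (dd \<alpha> (snd \<alpha>') p v) = - G \<beta>' (f p) (df \<alpha> \<beta>' p v) (J (N' \<beta>' p))"
    unfolding eta_eq[OF N(2) p(4,2,6)] \<beta>'_def[symmetric] df_change_source[OF p(3,4) \<beta>'(1) p(5,6) \<beta>'(2)] ..
  also have "\<dots> = - G \<beta> (f p) (df \<alpha> \<beta> p v) (J (N' \<beta> p))"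
    unfolding N_change[OF N(2) \<beta>(1) \<beta>'(1) p(2) \<beta>(2) \<beta>'(2)] dd_J[OF \<beta>(1) \<beta>'(1) \<beta>(2) \<beta>'(2), symmetric]
      df_change_target[OF p(3) \<beta>(1) \<beta>'(1) p(5) \<beta>(2) \<beta>'(2), symmetric] metric_change[OF \<beta>(1) \<beta>'(1) \<beta>(2) \<beta>'(2)] ..
  also have "\<dots> = 0"
    using v linear_scale[OF linear_J, of k "N \<beta> p"]
    by (simp add: k bilinear_rmul[OF metric_bilinear[OF \<beta>]])
  finally show ?thesis .
qed

end

section \<open>The Lie derivative of the shape operator\<close>

context hypersurface
begin

definition lie_eq_nabla :: bool where
  "lie_eq_nabla \<longleftrightarrow> (\<forall>U N. unit_normal_field \<B> G \<A> f U N \<longrightarrow>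
      (\<forall>X Y. vector_field \<A> UNIV X \<and> valued_in_D \<B> G \<A> f X \<and> vector_field \<A> UNIV Y \<longrightarrow>
        (\<forall>\<alpha>\<in>\<A>. \<forall>p\<in>U \<inter> fst \<alpha>.
          lie_derivative X (shape_operator \<B> G f N) Y \<alpha> p =
          covariant_derivative (levi_civita (induced_metric \<B> G f)) X (shape_operator \<B> G f N) Y \<alpha> p)))"

text \<open>Where the coordinate formula is available, \<open>eta_eq_0\<close> spreads its single
  test to all normals and charts; at all other points the field is zero.\<close>

lemma valued_in_D_extend:
  assumes N: "unit_normal_field \<B> G \<A> f U N" and \<alpha>: "\<alpha> \<in> \<A>" and \<beta>: "\<beta> \<in> \<B>"
    and w: "\<And>y. y \<notin> coord_dom U \<alpha> \<beta> \<Longrightarrow> w y = 0"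
      "\<And>q. q \<in> U \<Longrightarrow> f q \<in> fst \<beta> \<Longrightarrow> q \<in> fst \<alpha> \<Longrightarrow> G \<beta> (f q) (df \<alpha> \<beta> q (w (snd \<alpha> q))) (J (N \<beta> q)) = 0"
  shows "valued_in_D \<B> G \<A> f (M.extend_field \<alpha> w)"
  unfolding valued_in_D_def
proof (intro allI impI ballI)
  fix U' N' \<alpha>' p assume N': "unit_normal_field \<B> G \<A> f U' N'" and \<alpha>': "\<alpha>' \<in> \<A>" and "p \<in> U' \<inter> fst \<alpha>'"
  then have p: "p \<in> U'" "p \<in> fst \<alpha>'" by auto
  show "eta \<B> G f N' \<alpha>' p (M.extend_field \<alpha> w \<alpha>' p) = 0"
  proof (cases "p \<in> U \<and> f p \<in> fst \<beta> \<and> p \<in> fst \<alpha>")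
    case True
    then show ?thesis
      using eta_eq_0[OF N N' _ p(1) \<alpha> \<alpha>' _ p(2) \<beta> _ w(2)] by (simp add: M.extend_field_def)
  next
    case False
    have "M.extend_field \<alpha> w \<alpha>' p = 0"
    proof (cases "p \<in> fst \<alpha>")
      case True
      have "snd \<alpha> p \<notin> coord_dom U \<alpha> \<beta>"
      proof
        assume "snd \<alpha> p \<in> coord_dom U \<alpha> \<beta>"
        then obtain q where "q \<in> U" "f q \<in> fst \<beta>" "q \<in> fst \<alpha>" "snd \<alpha> p = snd \<alpha> q" by (auto simp: coord_dom_def)
        then show False
          using chart_inv_snd[OF M.chart[OF \<alpha>]] True False by metis
      qed
      then show ?thesis
        using w(1) linear_0[OF M.dd_transition_linear[OF \<alpha> \<alpha>' True p(2)]] True by (simp add: M.extend_field_def)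
    qed (simp add: M.extend_field_def)
    moreover define \<beta>' where "\<beta>' = chart_at \<B> (f p)"
    have \<beta>': "\<beta>' \<in> \<B>" "f p \<in> fst \<beta>'" by (simp_all add: \<beta>'_def chart_at)
    have "eta \<B> G f N' \<alpha>' p 0 = 0"
      unfolding eta_eq[OF N' \<alpha>' p] \<beta>'_def[symmetric]
      by (simp add: linear_0[OF df_linear[OF \<alpha>' \<beta>'(1) p(2) \<beta>'(2)]] bilinear_lzero[OF metric_bilinear[OF \<beta>']])
    ultimately show ?thesis by simp
  qed
qed

text \<open>Fields with the same value at \<open>p\<close> but different derivatives are compared: then the
  connection terms cancel and only the derivatives of the fields themselves remain.\<close>

lemma lie_eq_nabla_compare:
  assumes P: "lie_eq_nabla" and N: "unit_normal_field \<B> G \<A> f U N"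
    and p: "\<alpha> \<in> \<A>" "p \<in> U" "p \<in> fst \<alpha>"
    and X: "vector_field \<A> UNIV X" "valued_in_D \<B> G \<A> f X"
      "vector_field \<A> UNIV X'" "valued_in_D \<B> G \<A> f X'" "X \<alpha> p = X' \<alpha> p"
    and Y: "vector_field \<A> UNIV Y"
  defines "A \<equiv> shape_operator \<B> G f N \<alpha> p"
  shows "dd \<alpha> (X' \<alpha>) p (A (Y \<alpha> p)) - dd \<alpha> (X \<alpha>) p (A (Y \<alpha> p)) =
    A (dd \<alpha> (X' \<alpha>) p (Y \<alpha> p) - dd \<alpha> (X \<alpha>) p (Y \<alpha> p))"
proof -
  let ?\<Gamma> = "levi_civita (induced_metric \<B> G f)"
  have A: "linear A" unfolding A_def by (rule shape_operator_linear[OF N p])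
  have eq: "dd \<alpha> (Z \<alpha>) p (A (Y \<alpha> p)) - A (dd \<alpha> (Z \<alpha>) p (Y \<alpha> p)) =
      A (?\<Gamma> \<alpha> p (Z \<alpha> p) (Y \<alpha> p)) - ?\<Gamma> \<alpha> p (Z \<alpha> p) (A (Y \<alpha> p))"
    if Z: "vector_field \<A> UNIV Z" "valued_in_D \<B> G \<A> f Z" for Z
  proof -
    have "lie_derivative Z (shape_operator \<B> G f N) Y \<alpha> p =
        covariant_derivative ?\<Gamma> Z (shape_operator \<B> G f N) Y \<alpha> p"
      using P N Z Y p unfolding lie_eq_nabla_def by blast
    then show ?thesis
      unfolding lie_derivative_def covariant_derivative_def lie_bracket_def nabla_def endo_apply_def
        A_def[symmetric]
      by (simp add: linear_diff[OF A] linear_add[OF A] algebra_simps)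
  qed
  have "dd \<alpha> (X' \<alpha>) p (A (Y \<alpha> p)) - A (dd \<alpha> (X' \<alpha>) p (Y \<alpha> p)) =
      dd \<alpha> (X \<alpha>) p (A (Y \<alpha> p)) - A (dd \<alpha> (X \<alpha>) p (Y \<alpha> p))"
    using eq[OF X(1,2)] eq[OF X(3,4)] X(5) by simp
  then show ?thesis by (simp add: linear_diff[OF A] algebra_simps)
qed

lemma lie_eq_nabla_imp_umbilic:
  assumes P: "lie_eq_nabla" and N: "unit_normal_field \<B> G \<A> f U N"
    and p: "\<alpha> \<in> \<A>" "p \<in> U" "p \<in> fst \<alpha>"
  shows "\<exists>l. \<forall>v. shape_operator \<B> G f N \<alpha> p v = l *\<^sub>R v"
proof -
  define A where "A = shape_operator \<B> G f N \<alpha> p"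
  have A: "linear A" unfolding A_def by (rule shape_operator_linear[OF N p])
  define \<beta> where "\<beta> = chart_at \<B> (f p)"
  have \<beta>: "\<beta> \<in> \<B>" "f p \<in> fst \<beta>" by (simp_all add: \<beta>_def chart_at)
  interpret D: metric_domain "snd \<beta> ` fst \<beta>" "coord_metric G \<beta>" by (rule metric_domain_chart[OF \<beta>(1)])
  note ch = M.chart[OF p(1)] chart[OF \<beta>(1)]
  define S where "S = coord_dom U \<alpha> \<beta>"
  define x where "x = snd \<alpha> p"
  define \<phi> where "\<phi> = snd \<beta> \<circ> f \<circ> chart_inv \<alpha>"
  define n where "n = N \<beta> \<circ> chart_inv \<alpha>"
  have S: "open S" "smooth_on S \<phi>" "\<phi> ` S \<subseteq> snd \<beta> ` fst \<beta>" "smooth_on S n"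
    unfolding S_def \<phi>_def n_def
    by (rule open_dom[OF open_U[OF N] p(1) \<beta>(1)] smooth_f_dom[OF p(1) \<beta>(1)] f_dom[OF p(1)]
        smooth_N_dom[OF N p(1) \<beta>(1)])+
  have SA: "S \<subseteq> snd \<alpha> ` fst \<alpha>" by (auto simp: S_def coord_dom_def)
  have x: "x \<in> S" using p \<beta> by (simp add: S_def coord_dom_def x_def)
  \<comment> \<open>The form -\<eta> in coordinates, since the structure field is
    \<open>- J N\<close>.\<close>
  define \<omega> where "\<omega> y v = coord_metric G \<beta> (\<phi> y) (frechet_derivative \<phi> (at y) v) (J (n y))" for y v
  have \<omega>q: "\<omega> (snd \<alpha> q) v = G \<beta> (f q) (df \<alpha> \<beta> q v) (J (N \<beta> q))" if "q \<in> fst \<alpha>" "f q \<in> fst \<beta>" for q v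
    using that by (simp add: \<omega>_def \<phi>_def n_def dd_def chart_inv_snd[OF ch(1)] chart_inv_snd[OF ch(2)])
  have \<omega>_linear: "linear (\<omega> (snd \<alpha> q))" if "q \<in> fst \<alpha>" "f q \<in> fst \<beta>" for q
    by (rule linearI) (simp_all add: \<omega>q[OF that] linear_add[OF df_linear[OF p(1) \<beta>(1) that]]
        linear_scale[OF df_linear[OF p(1) \<beta>(1) that]] bilinear_ladd[OF metric_bilinear[OF \<beta>(1) that(2)]]
        bilinear_lmul[OF metric_bilinear[OF \<beta>(1) that(2)]])
  have \<omega>_smooth: "smooth_on S (\<lambda>y. \<omega> y v)" for v
    unfolding \<omega>_def
  proof (rule smooth_on_bilinear_family[where B = "\<lambda>y. coord_metric G \<beta> (\<phi> y)"
        and P = "\<lambda>y. frechet_derivative \<phi> (at y) v" and Q = "\<lambda>y. J (n y)", OF S(1)])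
    show "bilinear (coord_metric G \<beta> (\<phi> y))" if "y \<in> S" for y
      using S(3) that by (intro D.g_bilinear) auto
    show "smooth_on S (\<lambda>y. coord_metric G \<beta> (\<phi> y) u v)" for u v
      by (rule smooth_on_compose[OF S(1,2) D.smooth_g S(3)])
    show "smooth_on S (\<lambda>y. frechet_derivative \<phi> (at y) v)" by (rule smooth_on_deriv[OF S(2)])
    show "smooth_on S (\<lambda>y. J (n y))"
      by (rule smooth_on_linear[OF linear_conv_bounded_linear[THEN iffD1, OF linear_J] S(1,4)])
  qed
  have "G \<beta> (f p) (J (N \<beta> p)) (N \<beta> p) = 0" by (rule metric_J_self[OF \<beta>])
  then obtain b where b: "df \<alpha> \<beta> p b = J (N \<beta> p)"
    using range_if_tangent[OF N p(1) \<beta>(1) p(2) \<beta>(2) p(3)] by (metis rangeE)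
  have \<omega>b: "\<omega> x b = 1"
    unfolding x_def \<omega>q[OF p(3) \<beta>(2)] b metric_J[OF \<beta>] by (rule N_unit[OF N \<beta>(1) p(2) \<beta>(2)])
  have "dim (span {b}) \<noteq> DIM(real ^ 3)"
    using dim_le_card'[of "{b}"] by simp
  then have "span {b} \<noteq> UNIV" by (metis dim_UNIV)
  then obtain a where a: "a \<notin> span {b}" by blast
  \<comment> \<open>The combination of the constant fields \<open>a\<close> and \<open>b\<close>
    that \<omega> annihilates. At \<open>x\<close> it is \<open>a\<close> minus a multiple of
    \<open>b\<close>, hence nonzero by the choice of \<open>a\<close>.\<close>
  define w where "w y = \<omega> y b *\<^sub>R a - \<omega> y a *\<^sub>R b" for y
  have \<omega>w: "\<omega> (snd \<alpha> q) (w (snd \<alpha> q)) = 0" if "q \<in> fst \<alpha>" "f q \<in> fst \<beta>" for q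
    by (simp add: w_def linear_diff[OF \<omega>_linear[OF that]] linear_scale[OF \<omega>_linear[OF that]])
  have w: "smooth_on S w"
    unfolding w_def by (intro smooth_on_diff smooth_on_scaleR smooth_on_const \<omega>_smooth S)
  have wx: "w x \<noteq> 0"
  proof
    assume "w x = 0"
    then have "a = \<omega> x a *\<^sub>R b" unfolding w_def \<omega>b by (simp only: scaleR_one right_minus_eq)
    then obtain k where "a = k *\<^sub>R b" by blast
    then show False using a span_scale[OF span_base, of b "{b}" k] by simp
  qed
  obtain \<rho> :: "real ^ 3 \<Rightarrow> real" and K where \<rho>: "smooth_on UNIV \<rho>" "compact K" "K \<subseteq> S" "\<rho> x \<noteq> 0" "\<And>y. y \<notin> K \<Longrightarrow> \<rho> y = 0"
    by (rule smooth_bump[OF S(1) x]) blast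
  define W where "W = \<rho> x *\<^sub>R w x"
  have W: "W \<noteq> 0" using wx \<rho>(4) by (simp add: W_def)
  have field: "vector_field \<A> UNIV (M.extend_field \<alpha> (\<lambda>y. r y *\<^sub>R v y))"
    if "smooth_on UNIV r" "\<And>y. y \<notin> K \<Longrightarrow> r y = 0" "smooth_on S v" for r v
    by (rule M.vector_field_extend[OF p(1) smooth_on_subset[OF smooth_on_bump_scaleR[OF that(1,2) \<rho>(2,3) S(1) that(3)]] \<rho>(2)])
      (use \<rho>(3) SA that in auto)
  have inD: "valued_in_D \<B> G \<A> f (M.extend_field \<alpha> (\<lambda>y. r y *\<^sub>R w y))" if "\<And>y. y \<notin> K \<Longrightarrow> r y = 0" for r
  proof (rule valued_in_D_extend[OF N p(1) \<beta>(1)])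
    show "r y *\<^sub>R w y = 0" if "y \<notin> coord_dom U \<alpha> \<beta>" for y
      using that \<rho>(3) \<open>\<And>y. y \<notin> K \<Longrightarrow> r y = 0\<close>[of y] by (auto simp: S_def)
    show "G \<beta> (f q) (df \<alpha> \<beta> q (r (snd \<alpha> q) *\<^sub>R w (snd \<alpha> q))) (J (N \<beta> q)) = 0"
      if "q \<in> U" "f q \<in> fst \<beta>" "q \<in> fst \<alpha>" for q
      using \<omega>w[OF that(3,2)] linear_scale[OF \<omega>_linear[OF that(3,2)], of "r (snd \<alpha> q)" "w (snd \<alpha> q)"]
      by (simp add: \<omega>q[OF that(3,2)])
  qed
  have key: "(A u \<bullet> e) *\<^sub>R W = (u \<bullet> e) *\<^sub>R A W" for u e
  proof -
    \<comment> \<open>The extra factor has value 1 and derivative \<open>v \<bullet> e\<close> at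
      \<open>x\<close>: the fields \<open>X\<close> and \<open>X'\<close> agree at \<open>p\<close>,
      and their derivatives along \<open>v\<close> differ by
      \<open>(v \<bullet> e) W\<close>.\<close>
    define r where "r y = \<rho> y * (1 + (y - x) \<bullet> e)" for y
    define X where "X = M.extend_field \<alpha> (\<lambda>y. \<rho> y *\<^sub>R w y)"
    define X' where "X' = M.extend_field \<alpha> (\<lambda>y. r y *\<^sub>R w y)"
    \<comment> \<open>Dividing by \<open>\<rho> x\<close> compensates the cut-off, so that
      \<open>Y\<close> takes the prescribed value \<open>u\<close> at \<open>p\<close>.\<close>
    define Y where "Y = M.extend_field \<alpha> (\<lambda>y. \<rho> y *\<^sub>R (inverse (\<rho> x) *\<^sub>R u))"
    have r: "smooth_on UNIV r" "\<And>y. y \<notin> K \<Longrightarrow> r y = 0"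
      unfolding r_def
      by (auto intro!: smooth_on_mult smooth_on_add smooth_on_inner smooth_on_diff smooth_on_const smooth_on_id \<rho>(1)
          simp: \<rho>(5))
    have at: "X \<alpha> p = W" "X' \<alpha> p = W" "Y \<alpha> p = u"
      unfolding X_def X'_def Y_def using p \<rho>(4)
      by (simp_all add: M.extend_field_self W_def r_def x_def[symmetric])
    have sm: "smooth_on UNIV (\<lambda>y. \<rho> y *\<^sub>R w y)" "smooth_on UNIV (\<lambda>y. r y *\<^sub>R w y)"
      by (rule smooth_on_bump_scaleR[OF _ _ \<rho>(2,3) S(1) w]; use \<rho> r in simp)+
    note Dw = smooth_on_has_derivative[OF sm(1) UNIV_I, of x]
    have "((\<lambda>y. (1 + (y - x) \<bullet> e) *\<^sub>R (\<rho> y *\<^sub>R w y)) has_derivative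
        (\<lambda>v. (1 + (x - x) \<bullet> e) *\<^sub>R frechet_derivative (\<lambda>y. \<rho> y *\<^sub>R w y) (at x) v + (v \<bullet> e) *\<^sub>R (\<rho> x *\<^sub>R w x))) (at x)"
      by (rule has_derivative_scaleR[OF _ Dw]) (auto intro!: derivative_eq_intros)
    moreover have "(\<lambda>y. (1 + (y - x) \<bullet> e) *\<^sub>R (\<rho> y *\<^sub>R w y)) = (\<lambda>y. r y *\<^sub>R w y)"
      by (simp add: r_def mult.commute)
    ultimately have "((\<lambda>y. r y *\<^sub>R w y) has_derivative
        (\<lambda>v. frechet_derivative (\<lambda>y. \<rho> y *\<^sub>R w y) (at x) v + (v \<bullet> e) *\<^sub>R W)) (at x)"
      by (simp add: W_def)
    note D' = frechet_derivative_eqI[OF this]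
    have "dd \<alpha> (X' \<alpha>) p v = frechet_derivative (\<lambda>y. r y *\<^sub>R w y) (at x) v"
      "dd \<alpha> (X \<alpha>) p v = frechet_derivative (\<lambda>y. \<rho> y *\<^sub>R w y) (at x) v" for v
      unfolding X'_def X_def x_def
      by (intro M.dd_extend_field p smooth_on_differentiable[OF sm(1) UNIV_I] smooth_on_differentiable[OF sm(2) UNIV_I])+
    then have diff: "dd \<alpha> (X' \<alpha>) p v - dd \<alpha> (X \<alpha>) p v = (v \<bullet> e) *\<^sub>R W" for v
      by (simp add: D')
    have "dd \<alpha> (X' \<alpha>) p (A (Y \<alpha> p)) - dd \<alpha> (X \<alpha>) p (A (Y \<alpha> p)) =
        A (dd \<alpha> (X' \<alpha>) p (Y \<alpha> p) - dd \<alpha> (X \<alpha>) p (Y \<alpha> p))"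
      unfolding A_def
    proof (rule lie_eq_nabla_compare[OF P N p])
      show "vector_field \<A> UNIV X" "vector_field \<A> UNIV X'" "vector_field \<A> UNIV Y"
        unfolding X_def X'_def Y_def by (rule field; use \<rho> r w smooth_on_const S in simp)+
      show "valued_in_D \<B> G \<A> f X" "valued_in_D \<B> G \<A> f X'"
        unfolding X_def X'_def by (rule inD; use \<rho> r in simp)+
    qed (simp add: at)
    then show ?thesis
      unfolding diff at linear_scale[OF A] .
  qed
  obtain e :: "real ^ 3" where e: "e \<in> Basis" using nonempty_Basis by blast
  \<comment> \<open>\<open>key\<close> at \<open>u = e\<close> says that \<open>W\<close> is an
    eigenvector with this eigenvalue. Inserted back into \<open>key\<close>, this leaves multiples
    of \<open>W\<close> on both sides, and \<open>W\<close> can be cancelled.\<close>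
  define l where "l = A e \<bullet> e"
  have AW: "A W = l *\<^sub>R W"
    using key[of e e] e by (simp add: l_def)
  have "A v = l *\<^sub>R v" for v
  proof (rule euclidean_eqI)
    fix e' :: "real ^ 3" assume "e' \<in> Basis"
    have "(A v \<bullet> e') *\<^sub>R W = ((l *\<^sub>R v) \<bullet> e') *\<^sub>R W"
      using key[of v e'] by (simp add: AW mult.commute)
    then show "A v \<bullet> e' = (l *\<^sub>R v) \<bullet> e'" using W by simp
  qed
  then show ?thesis unfolding A_def by blast
qed

text \<open>\<open>shape_operator\<close> at \<open>q\<close> is read in the chart
  \<open>chart_at \<B> (f q)\<close>, which may jump as \<open>q\<close> moves. Before anything is
  differentiated, umbilicity is transported to the fixed chart \<beta> by
  \<open>nabla_along_change\<close>.\<close>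

lemma umbilic_imp_flat:
  assumes N: "unit_normal_field \<B> G \<A> f U N" "p0 \<in> U"
    and umb: "\<And>\<alpha> p. \<alpha> \<in> \<A> \<Longrightarrow> p \<in> U \<Longrightarrow> p \<in> fst \<alpha> \<Longrightarrow> \<exists>l. \<forall>v. shape_operator \<B> G f N \<alpha> p v = l *\<^sub>R v"
    and c: "\<And>\<beta> q u. \<beta> \<in> \<B> \<Longrightarrow> q \<in> fst \<beta> \<Longrightarrow> u \<noteq> 0 \<Longrightarrow> sectional_curvature G \<beta> q u (J u) = c"
  shows "c = 0"
proof -
  define \<alpha> where "\<alpha> = chart_at \<A> p0"
  define \<beta> where "\<beta> = chart_at \<B> (f p0)"
  have \<alpha>: "\<alpha> \<in> \<A>" "p0 \<in> fst \<alpha>" and \<beta>: "\<beta> \<in> \<B>" "f p0 \<in> fst \<beta>"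
    by (simp_all add: \<alpha>_def \<beta>_def chart_at M.chart_at)
  note ch = M.chart[OF \<alpha>(1)] chart[OF \<beta>(1)]
  note md = metric_domain_chart[OF \<beta>(1)]
  interpret D: metric_domain "snd \<beta> ` fst \<beta>" "coord_metric G \<beta>" by (rule md)
  define S where "S = coord_dom U \<alpha> \<beta>"
  define \<phi> where "\<phi> = snd \<beta> \<circ> f \<circ> chart_inv \<alpha>"
  define n where "n = N \<beta> \<circ> chart_inv \<alpha>"
  have S: "open S" "smooth_on S \<phi>" "\<phi> ` S \<subseteq> snd \<beta> ` fst \<beta>" "smooth_on S n"
    unfolding S_def \<phi>_def n_def
    by (rule open_dom[OF open_U[OF N(1)] \<alpha>(1) \<beta>(1)] smooth_f_dom[OF \<alpha>(1) \<beta>(1)] f_dom[OF \<alpha>(1)]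
        smooth_N_dom[OF N(1) \<alpha>(1) \<beta>(1)])+
  have x: "snd \<alpha> p0 \<in> S" using N \<alpha> \<beta> by (simp add: S_def coord_dom_def)
  have D\<phi>: "frechet_derivative \<phi> (at (snd \<alpha> q)) = df \<alpha> \<beta> q" for q
    by (simp add: dd_def \<phi>_def fun_eq_iff)
  have at: "\<phi> (snd \<alpha> p0) = snd \<beta> (f p0)" "n (snd \<alpha> p0) = N \<beta> p0"
    by (simp_all add: \<phi>_def n_def chart_inv_snd[OF ch(1) \<alpha>(2)])
  show ?thesis
  proof (rule no_umbilic_hypersurface[OF md _ _ _ S x])
    fix z u v assume "z \<in> snd \<beta> ` fst \<beta>"
    then obtain q where q: "q \<in> fst \<beta>" "z = snd \<beta> q" by auto
    then have z: "chart_inv \<beta> z = q" by (simp add: chart_inv_snd[OF ch(2)])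
    show "coord_metric G \<beta> z (J u) (J v) = coord_metric G \<beta> z u v"
      unfolding z by (rule metric_J[OF \<beta>(1) q(1)])
    show "D.\<Gamma> z u (J v) = J (D.\<Gamma> z u v)"
      using kaehler \<beta>(1) q
      by (simp add: kaehler_metric_def levi_civita_eq_christoffel[OF \<beta>(1) q(1), symmetric])
    show "coord_metric G \<beta> z (curv D.\<Gamma> z u (J u) (J u)) u = c * (coord_metric G \<beta> z u u)\<^sup>2"
    proof (cases "u = 0")
      case True
      then show ?thesis
        by (simp add: z bilinear_rzero[OF metric_bilinear[OF \<beta>(1) q(1)]])
    next
      case False
      then have "G \<beta> q u u > 0" using inner_form_pos[OF metric_inner[OF \<beta>(1) q(1)]] by simp
      \<comment> \<open>\<open>J u\<close> is orthogonal to \<open>u\<close> and of the same length,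
        so the denominator in \<open>sectional_curvature\<close> is the square of
        \<open>G \<beta> q u u\<close>.\<close>
      moreover have "G \<beta> q (curv D.\<Gamma> z u (J u) (J u)) u / (G \<beta> q u u * G \<beta> q u u) = c"
        using c[OF \<beta>(1) q(1) False]
        by (simp add: sectional_curvature_def curvature_eq_curv[OF \<beta>(1) q(1)] metric_J[OF \<beta>(1) q(1)]
            metric_J_self[OF \<beta>(1) q(1)] q(2))
      ultimately show ?thesis by (simp add: z power2_eq_square field_simps)
    qed
  next
    fix y assume "y \<in> S"
    then obtain q where q: "q \<in> U" "f q \<in> fst \<beta>" "q \<in> fst \<alpha>" "y = snd \<alpha> q" by (auto simp: S_def coord_dom_def)
    define \<beta>' where "\<beta>' = chart_at \<B> (f q)"
    have \<beta>': "\<beta>' \<in> \<B>" "f q \<in> fst \<beta>'" by (simp_all add: \<beta>'_def chart_at)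
    obtain l where l: "\<And>v. shape_operator \<B> G f N \<alpha> q v = l *\<^sub>R v"
      using umb[OF \<alpha>(1) q(1,3)] by blast
    have "cov D.\<Gamma> \<phi> n y v = (- l) *\<^sub>R frechet_derivative \<phi> (at y) v" for v
    proof -
      let ?T = "dd \<beta> (snd \<beta>') (f q)"
      have T: "linear ?T" by (rule dd_transition_linear[OF \<beta>(1) \<beta>'(1) q(2) \<beta>'(2)])
      have "?T (nabla_along (levi_civita G) f \<alpha> N q v \<beta>) = nabla_along (levi_civita G) f \<alpha> N q v \<beta>'"
        by (rule nabla_along_change[OF \<beta>(1) \<beta>'(1) q(2) \<beta>'(2) M.atlas \<alpha>(1) q(3) smooth_map_f
              open_U[OF N(1)] q(1) N_along[OF N(1)], symmetric])
      also have "\<dots> = - df \<alpha> \<beta>' q (l *\<^sub>R v)"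
        using shape_operator_eq[OF N(1) \<alpha>(1) q(1,3), of v] by (simp add: \<beta>'_def l)
      also have "\<dots> = ?T ((- l) *\<^sub>R df \<alpha> \<beta> q v)"
        by (simp add: linear_scale[OF df_linear[OF \<alpha>(1) \<beta>'(1) q(3) \<beta>'(2)]] linear_neg[OF T] linear_scale[OF T]
            df_change_target[OF \<alpha>(1) \<beta>(1) \<beta>'(1) q(3,2) \<beta>'(2)])
      finally have "nabla_along (levi_civita G) f \<alpha> N q v \<beta> = (- l) *\<^sub>R df \<alpha> \<beta> q v"
        using dd_inverse[OF \<beta>(1) \<beta>'(1) q(2) \<beta>'(2)] by metis
      then show ?thesis
        by (simp add: nabla_along_eq_cov[where f = f, OF \<beta>(1) q(2) ch(1) q(3)] \<phi>_def n_def q(4) dd_def)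
    qed
    then show "\<exists>l. \<forall>v. cov D.\<Gamma> \<phi> n y v = l *\<^sub>R frechet_derivative \<phi> (at y) v" by blast
  next
    show "coord_metric G \<beta> (\<phi> (snd \<alpha> p0)) (n (snd \<alpha> p0)) (n (snd \<alpha> p0)) = 1"
      unfolding at chart_inv_snd[OF ch(2) \<beta>(2)] by (rule N_unit[OF N(1) \<beta>(1) N(2) \<beta>(2)])
    show "u \<in> range (frechet_derivative \<phi> (at (snd \<alpha> p0)))"
      if "coord_metric G \<beta> (\<phi> (snd \<alpha> p0)) u (n (snd \<alpha> p0)) = 0" for u
      using that range_if_tangent[OF N(1) \<alpha>(1) \<beta>(1) N(2) \<beta>(2) \<alpha>(2)]
      unfolding at chart_inv_snd[OF ch(2) \<beta>(2)] D\<phi> by blast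
  qed
qed

end

theorem theorem1p2:
  fixes \<B> :: "('a::{t2_space,second_countable_topology}, complex ^ 2) chart set"
    and G :: "('a, complex ^ 2) metric"
    and c :: real
  assumes "c \<noteq> 0" and "space_form \<B> G c"
  shows "\<not> (\<exists>(\<A> :: ('m::{t2_space,second_countable_topology}, real ^ 3) chart set) (f :: 'm \<Rightarrow> 'a).
    real_hypersurface \<B> \<A> f \<and>
    (\<forall>U N. unit_normal_field \<B> G \<A> f U N \<longrightarrow>
      (\<forall>X Y. vector_field \<A> UNIV X \<and> valued_in_D \<B> G \<A> f X \<and> vector_field \<A> UNIV Y \<longrightarrow>
        (\<forall>\<alpha>\<in>\<A>. \<forall>p\<in>U \<inter> fst \<alpha>.
          lie_derivative X (shape_operator \<B> G f N) Y \<alpha> p =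
          covariant_derivative (levi_civita (induced_metric \<B> G f)) X (shape_operator \<B> G f N) Y \<alpha> p))))"
proof (rule notI, elim exE conjE)
  fix \<A> :: "('m, real ^ 3) chart set" and f :: "'m \<Rightarrow> 'a"
  assume hyp: "real_hypersurface \<B> \<A> f" and par: "\<forall>U N. unit_normal_field \<B> G \<A> f U N \<longrightarrow>
      (\<forall>X Y. vector_field \<A> UNIV X \<and> valued_in_D \<B> G \<A> f X \<and> vector_field \<A> UNIV Y \<longrightarrow>
        (\<forall>\<alpha>\<in>\<A>. \<forall>p\<in>U \<inter> fst \<alpha>.
          lie_derivative X (shape_operator \<B> G f N) Y \<alpha> p =
          covariant_derivative (levi_civita (induced_metric \<B> G f)) X (shape_operator \<B> G f N) Y \<alpha> p))"
  interpret hypersurface \<B> G \<A> f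
    by unfold_locales (use assms(2) hyp in \<open>auto simp: space_form_def complex_atlas_def kaehler_metric_def\<close>)
  \<comment> \<open>Types are nonempty, so \<open>undefined\<close> denotes a point of the
    hypersurface; any point would do.\<close>
  obtain U N where N: "unit_normal_field \<B> G \<A> f U N" "undefined \<in> U"
    by (rule unit_normal_exists)
  have "lie_eq_nabla" unfolding lie_eq_nabla_def by (rule par)
  from umbilic_imp_flat[OF N lie_eq_nabla_imp_umbilic[OF this N(1)], of c] assms
  show False by (simp add: space_form_def)
qed

end
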